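(* Let $d\in\mathbb{N}$ and $q>1$ with $d(q-1)<2$. For $v\in\mathbb{R}^d$, define $p^v\colon\mathbb{R}^d\to\mathbb{R}$ by $$p^v(x):=\left[(q-1)|x-v|^2+\left(\Big(\frac{q-1}{\pi}\Big)^{\frac d2}\frac{\Gamma(\frac1{q-1})}{\Gamma(\frac1{q-1}-\frac d2)}\right)^{\frac{2(1-q)}{2+d(1-q)}}\right]^{\frac1{1-q}}.$$ Then the set $\mathcal{M}:=\{p^v\mid v\in\mathbb{R}^d\}$ (a manifold with global coordinate $p^v\mapsto v$) is an identically repeatable $(h_q,\mathrm{id}_{(0,\infty)})$-exponential family. For its repetition $(\iota_k)_{k\in\mathbb{N}}$ (the one specified in the context) and $p\in\mathcal{M}$, any $(h_q,\mathrm{id}_{(0,\infty)})$-dependent and identically distributed random variables $(X_k)_{k\in\mathbb{N}}$ according to $p$, defined on a probability space $(\Omega,\mathbb{P})$, satisfy $$\frac1k\sum_{m=1}^kT(X_m)\xrightarrow{k\to\infty}\int_{\mathbb{R}^d}T(x)\,\iota_1(p)(x)\,dx\quad\mathbb{P}\text{-a.s.},$$ where $(\mathcal{M},\theta,T,c,\psi)$ is an $(h_q,\mathrm{id}_{(0,\infty)})$-exponential coordinate representation on $\mathcal{M}$.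
   Context: Notation: $\mathcal{L}^N$ is Lebesgue measure on $\mathbb{R}^N$; $\mathcal{P}(\mathcal{L}^N)$ is the set of $p\in L^1(\mathcal{L}^N)$ with $p>0$ a.e. and $\|p\|_{L^1}=1$; $e_x(p):=p(x)$. Points of $(\mathbb{R}^d)^k=\mathbb{R}^{dk}$ are $\bm{x}=(x_1,\dots,x_k)$. Manifolds are smooth, Hausdorff, second countable, connected, without boundary. For $q>1$ put $\ln_q(r):=\frac{r^{1-q}-1}{1-q}$ for $r>0$, and $h_q(r):=\int_1^r\ln_q(t)\,dt$, so $h_q'=\ln_q$. The $(h_q,\mathrm{id}_{(0,\infty)})$-exponential function is $\exp_q(u)=[1+(1-q)u]^{\frac1{1-q}}$ for $u<\frac1{q-1}$ and $\exp_q(u)=\infty$ for $u\ge\frac1{q-1}$. Statistical model: a manifold $\mathcal{M}$ contained in $\mathcal{P}(\mathcal{L}^N)$ is a statistical model if there is a Lebesgue-null set $\mathcal{N}\subset\mathbb{R}^N$ such that: (a) the topology of $\mathcal{M}$ is induced by $(e_x)_{x\notin\mathcal{N}}$; (b) $e_x\colon\mathcal{M}\to\mathbb{R}$ is smooth for $x\notin\mathcal{N}$; (c) for $p\in\mathcal{M}$ the derivatives of $e_x$ of any order at $p$ are Borel functions of $x$; (d) for $V\in\mathfrak{X}(\mathcal{M})$, $p\in\mathcal{M}$, $V_p(e_x)=0$ for all $x\notin\mathcal{N}$ iff $V_p=0$; (e) for $V,W\in\mathfrak{X}(\mathcal{M})$, $p\in\mathcal{M}$, the functions $x\mapsto V_p(e_x)$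 and $x\mapsto V_p(We_x)$ are integrable with integral $0$. An $(h_q,\mathrm{id}_{(0,\infty)})$-exponential coordinate representation on an $n$-dimensional manifold $\mathcal{M}\subset\mathcal{P}(\mathcal{L}^d)$ is $(U,\theta,T,c,\psi)$ with $(U,\theta)$ a coordinate system, $T\colon\mathbb{R}^d\to\mathbb{R}^n$ and $c\colon\mathbb{R}^d\to\mathbb{R}$ continuous, $\psi\colon U\to\mathbb{R}$ smooth, and $p(x)=\exp_q(\langle\theta(p),T(x)\rangle-c(x)-\psi(p))$ for all $p\in U$, $x\in\mathbb{R}^d$; it is global if $U=\mathcal{M}$. An $(h_q,\mathrm{id}_{(0,\infty)})$-exponential family is a statistical model each point of which lies in the domain of such a representation. Identical repeatability: such a family $\mathcal{M}$ is identically repeatable if for each $k\in\mathbb{N}$ there exist a positive increasing smooth function $\alpha_k$ on $(0,\infty)$, a positive smooth function $b_k$ on $\mathcal{M}$ and an injection $\iota_k\colon\mathcal{M}\to\mathcal{P}(\mathcal{L}^{dk})$ such that $\iota_k(\mathcal{M})$ is a statistical model in $\mathcal{P}(\mathcal{L}^{dk})$ and, for each global representation $(\mathcal{M},\theta,T,c,\psi)$, there is $\psi_k\in C^\infty(\mathcal{M})$ with $$\iota_k(p)(\bm{x})=\alpha_k\Big(\exp_q\Big(b_k(p)\sum_{m=1}^k(\langle\theta(p),T(x_m)\rangle-c(x_m))-\psi_k(p)\Big)\Big)\quad\text{for }p\in\mathcal{M},\ \bm{x}\in(\mathbb{R}^d)^k,$$ and moreover $\int_{(\mathbb{R}^d)^{k'}}\iota_{k+k'}(p)(\bm{x},\bm{y})\,d\bm{y}=\iota_k(p)(\bm{x})$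 for all $k'\in\mathbb{N}$. Then $(\iota_k)_{k\in\mathbb{N}}$ is called a repetition. Given a repetition, random variables $(X_k)_{k\in\mathbb{N}}$ are $(h_q,\mathrm{id}_{(0,\infty)})$-dependent and identically distributed according to $p\in\mathcal{M}$ if for each $k$ the law of $(X_1,\dots,X_k)$ is $\iota_k(p)\mathcal{L}^{dk}$. The repetition of $\mathcal{M}$: for $k\in\mathbb{N}\cup\{0\}$ let $a_k:=1+(k+3)\frac{d(q-1)}2$, $A_k:=\frac{a_k}{q-1}$, $\beta_k:=\frac{\pi}{q-1}\Gamma(A_k)^{-1/A_k}$, $\nu_k:=-\ln_q\big(\Gamma(A_k)^{1/a_k}\Gamma(A_0)^{-1/a_0}\big)$; for $k\in\mathbb{N}$, $$\iota_k(p^v)(\bm{x}):=\exp_q\Big(-\beta_k\sum_{m=1}^k|x_m-v|^2-\nu_k\Big)^{a_k}.$$ *)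

theory Defs
  imports "HOL-Probability.Probability"
begin

subsection \<open>Smooth maps and smooth manifolds\<close>

text \<open>The library has no $C^k$ maps between normed spaces. Only open sets \<open>S\<close> are used below.\<close>

primrec Ck_on :: "nat \<Rightarrow> 'a::real_normed_vector set \<Rightarrow> ('a \<Rightarrow> 'b::real_normed_vector) \<Rightarrow> bool" where
  "Ck_on 0 S f \<longleftrightarrow> continuous_on S f"
| "Ck_on (Suc k) S f \<longleftrightarrow>
     (\<forall>x\<in>S. f differentiable (at x)) \<and> (\<forall>v. Ck_on k S (\<lambda>x. frechet_derivative f (at x) v))"

definition smooth_on :: "'a::real_normed_vector set \<Rightarrow> ('a \<Rightarrow> 'b::real_normed_vector) \<Rightarrow> bool" where
  "smooth_on S f \<longleftrightarrow> (\<forall>k. Ck_on k S f)"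

text \<open>\<open>dir_deriv [v1, \<dots>, vr] f\<close> is the iterated directional derivative of \<open>f\<close> along \<open>v1, \<dots>, vr\<close>.\<close>

primrec dir_deriv :: "'a::real_normed_vector list \<Rightarrow> ('a \<Rightarrow> 'b::real_normed_vector) \<Rightarrow> 'a \<Rightarrow> 'b" where
  "dir_deriv [] f = f"
| "dir_deriv (v # vs) f = (\<lambda>y. frechet_derivative (dir_deriv vs f) (at y) v)"

type_synonym ('p, 'e) chart = "'p set \<times> ('p \<Rightarrow> 'e)"

definition topological_chart :: "'p topology \<Rightarrow> ('p, 'e::euclidean_space) chart \<Rightarrow> bool" where
  "topological_chart X c \<longleftrightarrow> (case c of (U, \<phi>) \<Rightarrow>
     openin X U \<and> open (\<phi> ` U) \<and>
     homeomorphic_map (subtopology X U) (top_of_set (\<phi> ` U)) \<phi>)"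

definition smoothly_compatible ::
    "('p, 'e::euclidean_space) chart \<Rightarrow> ('p, 'e) chart \<Rightarrow> bool" where
  "smoothly_compatible c c' \<longleftrightarrow> (case (c, c') of ((U, \<phi>), (V, \<psi>)) \<Rightarrow>
     smooth_on (\<phi> ` (U \<inter> V)) (\<psi> \<circ> inv_into U \<phi>) \<and>
     smooth_on (\<psi> ` (U \<inter> V)) (\<phi> \<circ> inv_into V \<psi>))"

text \<open>A manifold is a topology \<open>X\<close> (whose carrier \<open>topspace X\<close> is the underlying set) together with
  a smooth atlas \<open>A\<close>, not necessarily maximal, with charts into a Euclidean space \<open>'e\<close> whose
  dimension is that of the manifold.\<close>

definition smooth_manifold ::
    "'p topology \<Rightarrow> ('p, 'e::euclidean_space) chart set \<Rightarrow> bool" where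
  "smooth_manifold X A \<longleftrightarrow>
     Hausdorff_space X \<and> second_countable X \<and> connected_space X \<and>
     (\<forall>c\<in>A. topological_chart X c) \<and> (\<Union>(U, \<phi>)\<in>A. U) = topspace X \<and>
     (\<forall>c\<in>A. \<forall>c'\<in>A. smoothly_compatible c c')"

text \<open>The coordinate systems are the charts of the maximal atlas containing \<open>A\<close>.\<close>

definition coordinate_systems ::
    "'p topology \<Rightarrow> ('p, 'e::euclidean_space) chart set \<Rightarrow> ('p, 'e) chart set" where
  "coordinate_systems X A = {c. topological_chart X c \<and> (\<forall>c'\<in>A. smoothly_compatible c c')}"

text \<open>\<open>C_inf A U\<close> is the set of smooth real functions on the open subset \<open>U\<close> of the manifold.
  The values outside \<open>U\<close> are irrelevant.\<close>

definition C_inf ::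
    "('p, 'e::euclidean_space) chart set \<Rightarrow> 'p set \<Rightarrow> ('p \<Rightarrow> real) set" where
  "C_inf A U = {f. \<forall>(V, \<phi>)\<in>A. smooth_on (\<phi> ` (V \<inter> U)) (f \<circ> inv_into V \<phi>)}"

text \<open>A smooth vector field is an operator on smooth functions which in each chart has the form
  $V = \sum_i a^i \partial_i$ with smooth $a^i$. Here \<open>V f p\<close> is $V_p(f)$, and the value of \<open>V\<close> on
  non-smooth functions is irrelevant.\<close>

definition vector_fields ::
    "'p topology \<Rightarrow> ('p, 'e::euclidean_space) chart set \<Rightarrow> (('p \<Rightarrow> real) \<Rightarrow> 'p \<Rightarrow> real) set" where
  "vector_fields X A = {V. \<forall>(U, \<phi>)\<in>A. \<exists>a :: 'e \<Rightarrow> 'e. smooth_on (\<phi> ` U) a \<and>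
     (\<forall>f\<in>C_inf A (topspace X). \<forall>p\<in>U.
        V f p = frechet_derivative (f \<circ> inv_into U \<phi>) (at (\<phi> p)) (a (\<phi> p)))}"


subsection \<open>Statistical models\<close>

text \<open>To treat $\mathbb{R}^d$ and $(\mathbb{R}^d)^k$ for all \<open>k\<close> uniformly, the sample space is given
  by a measure \<open>L\<close> which is Lebesgue measure restricted to the Borel sets; Lebesgue measure
  proper is \<open>completion L\<close>. Functions on the sample space are extensional, so that they
  are determined by their values on \<open>space L\<close>.\<close>

definition prob_densities :: "'x measure \<Rightarrow> ('x \<Rightarrow> real) set" where
  "prob_densities L = {p \<in> extensional (space L). integrable (completion L) p \<and>
     (AE x in completion L. p x > 0) \<and> (LINT x|completion L. \<bar>p x\<bar>) = 1}"

definition ev :: "'x \<Rightarrow> ('x \<Rightarrow> real) \<Rightarrow> real" where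
  "ev x p = p x"

text \<open>\<open>restrict_space L (space L - N)\<close> carries the trace of the Borel sets on the complement
  of \<open>N\<close>, on which alone $e_x$ has to be smooth.\<close>

definition statistical_model ::
    "'x measure \<Rightarrow> ('x \<Rightarrow> real) topology \<Rightarrow> ('x \<Rightarrow> real, 'e::euclidean_space) chart set \<Rightarrow> bool" where
  "statistical_model L X A \<longleftrightarrow>
     smooth_manifold X A \<and> topspace X \<subseteq> prob_densities L \<and>
     (\<exists>N \<in> null_sets (completion L).
        X = topology_generated_by {{p \<in> topspace X. ev x p \<in> G} | x G. x \<in> space L - N \<and> open G} \<and>
        (\<forall>x \<in> space L - N. ev x \<in> C_inf A (topspace X)) \<and>
        (\<forall>(U, \<phi>)\<in>A. \<forall>p\<in>U. \<forall>vs.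
           (\<lambda>x. dir_deriv vs (ev x \<circ> inv_into U \<phi>) (\<phi> p))
              \<in> borel_measurable (restrict_space L (space L - N))) \<and>
        (\<forall>V\<in>vector_fields X A. \<forall>p\<in>topspace X.
           (\<forall>x \<in> space L - N. V (ev x) p = 0) \<longleftrightarrow> (\<forall>f\<in>C_inf A (topspace X). V f p = 0)) \<and>
        (\<forall>V\<in>vector_fields X A. \<forall>W\<in>vector_fields X A. \<forall>p\<in>topspace X.
           set_integrable (completion L) (space L - N) (\<lambda>x. V (ev x) p) \<and>
           (LINT x:space L - N|completion L. V (ev x) p) = 0 \<and>
           set_integrable (completion L) (space L - N) (\<lambda>x. V (W (ev x)) p) \<and>
           (LINT x:space L - N|completion L. V (W (ev x)) p) = 0))"


subsection \<open>Exponential families\<close>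

definition ln_q :: "real \<Rightarrow> real \<Rightarrow> real" where
  "ln_q q r = (r powr (1 - q) - 1) / (1 - q)"

definition exp_q :: "real \<Rightarrow> real \<Rightarrow> ereal" where
  "exp_q q u = (if u < 1 / (q - 1) then ereal ((1 + (1 - q) * u) powr (1 / (1 - q))) else \<infinity>)"

definition exp_representation ::
    "real \<Rightarrow> ((real^'d) \<Rightarrow> real) topology \<Rightarrow> ((real^'d) \<Rightarrow> real, real^'n) chart set \<Rightarrow>
     ((real^'d) \<Rightarrow> real) set \<Rightarrow> (((real^'d) \<Rightarrow> real) \<Rightarrow> real^'n) \<Rightarrow>
     (real^'d \<Rightarrow> real^'n) \<Rightarrow> (real^'d \<Rightarrow> real) \<Rightarrow> (((real^'d) \<Rightarrow> real) \<Rightarrow> real) \<Rightarrow> bool" where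
  "exp_representation q X A U \<theta> T c \<psi> \<longleftrightarrow>
     (U, \<theta>) \<in> coordinate_systems X A \<and>
     continuous_on UNIV T \<and> continuous_on UNIV c \<and> \<psi> \<in> C_inf A U \<and>
     (\<forall>p\<in>U. \<forall>x. ereal (p x) = exp_q q (\<theta> p \<bullet> T x - c x - \<psi> p))"

definition exponential_family ::
    "real \<Rightarrow> ((real^'d) \<Rightarrow> real) topology \<Rightarrow> ((real^'d) \<Rightarrow> real, real^'n) chart set \<Rightarrow> bool" where
  "exponential_family q X A \<longleftrightarrow>
     statistical_model lborel X A \<and>
     (\<forall>p\<in>topspace X. \<exists>U \<theta> T c \<psi>. exp_representation q X A U \<theta> T c \<psi> \<and> p \<in> U)"


subsection \<open>Identical repeatability\<close>

definition leb_pow :: "nat \<Rightarrow> (nat \<Rightarrow> real^'d) measure" where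
  "leb_pow k = (\<Pi>\<^sub>M m\<in>{1..k}. lborel)"

definition join :: "nat \<Rightarrow> nat \<Rightarrow> (nat \<Rightarrow> 'a) \<Rightarrow> (nat \<Rightarrow> 'a) \<Rightarrow> nat \<Rightarrow> 'a" where
  "join k k' x y = (\<lambda>m\<in>{1..k + k'}. if m \<le> k then x m else y (m - k))"

text \<open>Since \<open>\<alpha>\<close> is a function on $(0,\infty)$, the argument of \<open>\<alpha>\<close> is required to be finite.
  The manifold \<open>\<iota> k ` M\<close> is modelled on the same $\mathbb{R}^n$ as \<open>M\<close>. If there is a global
  representation, this is automatic: $\iota_k$ is then a smooth bijection between the two manifolds,
  whose dimensions agree by invariance of domain and Sard's theorem.\<close>

definition repetition ::
    "real \<Rightarrow> ((real^'d) \<Rightarrow> real) topology \<Rightarrow> ((real^'d) \<Rightarrow> real, real^'n) chart set \<Rightarrow>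
     (nat \<Rightarrow> ((real^'d) \<Rightarrow> real) \<Rightarrow> ((nat \<Rightarrow> real^'d) \<Rightarrow> real)) \<Rightarrow> bool" where
  "repetition q X A \<iota> \<longleftrightarrow>
     (\<forall>k\<ge>1. \<exists>(\<alpha> :: real \<Rightarrow> real) b.
        smooth_on {0<..} \<alpha> \<and> (\<forall>r>0. \<alpha> r > 0) \<and> strict_mono_on {0<..} \<alpha> \<and>
        b \<in> C_inf A (topspace X) \<and> (\<forall>p\<in>topspace X. b p > 0) \<and>
        inj_on (\<iota> k) (topspace X) \<and>
        (\<exists>Y (B :: ((nat \<Rightarrow> real^'d) \<Rightarrow> real, real^'n) chart set).
           topspace Y = \<iota> k ` topspace X \<and> statistical_model (leb_pow k) Y B) \<and>
        (\<forall>\<theta> T c \<psi>. exp_representation q X A (topspace X) \<theta> T c \<psi> \<longrightarrow>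
           (\<exists>\<psi>k \<in> C_inf A (topspace X). \<forall>p\<in>topspace X. \<forall>x\<in>space (leb_pow k).
              (let u = b p * (\<Sum>m=1..k. \<theta> p \<bullet> T (x m) - c (x m)) - \<psi>k p
               in exp_q q u \<noteq> \<infinity> \<and> \<iota> k p x = \<alpha> (real_of_ereal (exp_q q u)))))) \<and>
     (\<forall>k\<ge>1. \<forall>k'\<ge>1. \<forall>p\<in>topspace X. \<forall>x\<in>space (leb_pow k).
        has_bochner_integral (completion (leb_pow k')) (\<lambda>y. \<iota> (k + k') p (join k k' x y)) (\<iota> k p x))"

definition identically_repeatable ::
    "real \<Rightarrow> ((real^'d) \<Rightarrow> real) topology \<Rightarrow> ((real^'d) \<Rightarrow> real, real^'n) chart set \<Rightarrow> bool" where
  "identically_repeatable q X A \<longleftrightarrow> exponential_family q X A \<and> (\<exists>\<iota>. repetition q X A \<iota>)"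

definition dependent_identically_distributed ::
    "(nat \<Rightarrow> ((real^'d) \<Rightarrow> real) \<Rightarrow> ((nat \<Rightarrow> real^'d) \<Rightarrow> real)) \<Rightarrow> ((real^'d) \<Rightarrow> real) \<Rightarrow>
     'w measure \<Rightarrow> (nat \<Rightarrow> 'w \<Rightarrow> real^'d) \<Rightarrow> bool" where
  "dependent_identically_distributed \<iota> p P X \<longleftrightarrow>
     (\<forall>m\<ge>1. X m \<in> borel_measurable P) \<and>
     (\<forall>k\<ge>1. distributed P (leb_pow k) (\<lambda>\<omega>. \<lambda>m\<in>{1..k}. X m \<omega>) (\<lambda>x. ennreal (\<iota> k p x)))"


subsection \<open>The family of the theorem and its repetition\<close>

definition dens :: "real \<Rightarrow> real^'d \<Rightarrow> real^'d \<Rightarrow> real" where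
  "dens q v x = (let d = real CARD('d) in
     ((q - 1) * (norm (x - v))\<^sup>2 +
      (((q - 1) / pi) powr (d / 2) * Gamma (1 / (q - 1)) / Gamma (1 / (q - 1) - d / 2))
        powr (2 * (1 - q) / (2 + d * (1 - q)))) powr (1 / (1 - q)))"

definition coord :: "real \<Rightarrow> ((real^'d) \<Rightarrow> real) \<Rightarrow> real^'d" where
  "coord q = inv (dens q)"

lemma coord_dens:
  fixes v :: "real^'d"
  assumes q: "q > 1" "real CARD('d) * (q - 1) < 2"
  shows "coord q (dens q v) = v"
proof -
  define d where "d = real CARD('d)"
  define l where "l = (((q - 1) / pi) powr (d / 2) * Gamma (1 / (q - 1)) / Gamma (1 / (q - 1) - d / 2))
        powr (2 * (1 - q) / (2 + d * (1 - q)))"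
  have "1 / (q - 1) - d / 2 > 0" "1 / (q - 1) > 0"
    using q by (auto simp: d_def field_simps)
  then have "Gamma (1 / (q - 1)) > 0" "Gamma (1 / (q - 1) - d / 2) > 0"
    by (auto intro: Gamma_real_pos)
  moreover have "((q - 1) / pi) powr (d / 2) > 0"
    using q by simp
  ultimately have "((q - 1) / pi) powr (d / 2) * Gamma (1 / (q - 1)) / Gamma (1 / (q - 1) - d / 2) > 0"
    by (simp only: divide_pos_pos mult_pos_pos)
  then have l: "l > 0"
    unfolding l_def by (simp only: powr_gt_zero)
  have eq: "dens q v x = ((q - 1) * (norm (x - v))\<^sup>2 + l) powr (1 / (1 - q))" for v x :: "real^'d"
    by (simp only: dens_def l_def d_def Let_def)
  have "inj (dens q :: real^'d \<Rightarrow> _)"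
  proof (rule injI)
    fix v w :: "real^'d"
    assume "dens q v = dens q w"
    then have "dens q v v = dens q w v" by simp
    then have "l powr (1 / (1 - q)) = ((q - 1) * (norm (v - w))\<^sup>2 + l) powr (1 / (1 - q))"
      by (simp add: eq)
    moreover have pos: "(q - 1) * (norm (v - w))\<^sup>2 + l > 0"
      using q l by (simp add: add_nonneg_pos)
    ultimately have "1 / (1 - q) * ln l = 1 / (1 - q) * ln ((q - 1) * (norm (v - w))\<^sup>2 + l)"
      using l by (metis ln_powr less_irrefl)
    then have "ln l = ln ((q - 1) * (norm (v - w))\<^sup>2 + l)"
      using q by simp
    then have "l = (q - 1) * (norm (v - w))\<^sup>2 + l"
      using l pos by (simp only: ln_inj_iff)
    then have "(q - 1) * (norm (v - w))\<^sup>2 = 0"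
      by simp
    then show "v = w"
      using q by simp
  qed
  then show ?thesis
    by (simp add: coord_def)
qed

text \<open>The manifold structure on \<open>range (dens q)\<close> for which \<open>coord q\<close> is a global coordinate.\<close>

definition dens_topology :: "real \<Rightarrow> ((real^'d) \<Rightarrow> real) topology" where
  "dens_topology q = pullback_topology (range (dens q)) (coord q) euclidean"

definition dens_atlas :: "real \<Rightarrow> ((real^'d) \<Rightarrow> real, real^'d) chart set" where
  "dens_atlas q = {(range (dens q), coord q)}"

text \<open>In the following constants \<open>d\<close> is the dimension of the sample space.\<close>

definition rep_a :: "real \<Rightarrow> real \<Rightarrow> nat \<Rightarrow> real" where
  "rep_a d q k = 1 + (real k + 3) * (d * (q - 1) / 2)"

definition rep_A :: "real \<Rightarrow> real \<Rightarrow> nat \<Rightarrow> real" where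
  "rep_A d q k = rep_a d q k / (q - 1)"

definition rep_beta :: "real \<Rightarrow> real \<Rightarrow> nat \<Rightarrow> real" where
  "rep_beta d q k = pi / (q - 1) * Gamma (rep_A d q k) powr (- 1 / rep_A d q k)"

definition rep_nu :: "real \<Rightarrow> real \<Rightarrow> nat \<Rightarrow> real" where
  "rep_nu d q k = - ln_q q (Gamma (rep_A d q k) powr (1 / rep_a d q k) *
                           Gamma (rep_A d q 0) powr (- 1 / rep_a d q 0))"

definition dens_rep :: "real \<Rightarrow> nat \<Rightarrow> ((real^'d) \<Rightarrow> real) \<Rightarrow> ((nat \<Rightarrow> real^'d) \<Rightarrow> real)" where
  "dens_rep q k p = (let d = real CARD('d) in
     (\<lambda>x\<in>space (leb_pow k).
       real_of_ereal (exp_q q (- rep_beta d q k * (\<Sum>m=1..k. (norm (x m - coord q p))\<^sup>2) - rep_nu d q k))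
         powr rep_a d q k))"

end

theory Submission
  imports Defs
begin

text \<open>With $C = \Gamma(A_0)^{1/A_0}$ the densities of the repetition are
  $\Gamma(A_k)(C + \pi\sum_m|x_m-v|^2)^{-A_k}$ with $A_k = A_0 + kd/2$. Writing
  $\Gamma(A)s^{-A} = \int_0^\infty t^{A-1}e^{-ts}\,dt$ exhibits them as mixtures of Gaussians, so that
  integrating out one variable in $\mathbb{R}^d$ lowers $A$ by $d/2$; this gives total mass one and the
  compatibility of the marginals.

  The family \<open>dens\<close> and its repetitions are location families $K(c+\pi\sum_m|x_m-v|^2)^{-E}$. For these
  the evaluation at the diagonal point $(v,\dots,v)$ has the balls around $v$ as superlevel sets, which
  identifies the topology, and the scores integrate to zero by translation invariance.

  In any exponential representation \<open>T\<close> is affine, so the law of large numbers only concerns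
  $\sum_{m\le k}(X_m-v)$. Its law is invariant under changing the sign of a single summand; hence the
  fourth moment is at most $3k^2\,E|X_1-v|^4$, which is summable after division by $k^4$.\<close>

section \<open>Smooth maps\<close>

text \<open>The mixing variable \<open>t\<close> explains the constants. Split
  \<open>t powr (A k - 1)\<close> into \<open>t powr (A 0 - 1)\<close> and
  \<open>t powr (k * d / 2)\<close>. The second factor normalizes k Gaussians proportional to exp(-t
  pi |x - v|^2); the rest is the Gamma law of shape \<open>A 0\<close> and rate \<open>C\<close>,
  which has mass one and is the same for all k. The variables are thus independent only given
  \<open>t\<close>, yet averages converge to a constant because the conditional mean is
  \<open>v\<close> for every \<open>t\<close>. No conditioning is carried out: the sign flips retain
  as much of the independence as a fourth moment needs.

  The first density of the repetition is not \<open>p\<close> itself. The tail of \<open>p\<close>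
  may be too heavy even for a first moment, whereas \<open>A 1\<close> exceeds the exponent
  \<open>1 / (q - 1)\<close> of \<open>p\<close> by \<open>2 * d\<close>, enough for fourth moments.
  Both are powers of a quadratic, so they share the differential part of the argument but are
  normalized separately.

  Differentiation under the integral sign would ask for a domination that is locally uniform in the
  parameter; integrating over a segment of translations asks only for integrability at one
  parameter.\<close>

lemma Ck_on_cong:
  assumes "open S" "\<And>x. x \<in> S \<Longrightarrow> f x = g x" "Ck_on k S f"
  shows "Ck_on k S g"
  using assms(2,3)
proof (induction k arbitrary: f g)
  case 0
  then show ?case
    using continuous_on_cong by force
next
  case (Suc k)
  have d: "g differentiable (at x)" "frechet_derivative f (at x) = frechet_derivative g (at x)"
    if "x \<in> S" for x
  proof -
    have f: "f differentiable (at x)"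
      using Suc.prems that by simp
    then have "(f has_derivative frechet_derivative f (at x)) (at x)"
      by (simp add: frechet_derivative_works)
    then have "(g has_derivative frechet_derivative f (at x)) (at x)"
      by (rule has_derivative_transform_within_open[OF _ assms(1) that]) (use Suc.prems in auto)
    then show "g differentiable (at x)" "frechet_derivative f (at x) = frechet_derivative g (at x)"
      by (rule differentiableI, rule frechet_derivative_at)
  qed
  have "Ck_on k S (\<lambda>x. frechet_derivative g (at x) v)" for v
    by (rule Suc.IH[where f = "\<lambda>x. frechet_derivative f (at x) v"]) (use d(2) Suc.prems in auto)
  with d show ?case by simp
qed

text \<open>\<open>frechet_derivative\<close> is a choice operator; uniqueness of the derivative
  lets an explicit \<open>f'\<close> replace it. The closure rules below all go through this
  rule.\<close>

lemma Ck_on_derivI: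
  assumes "open S" and "\<And>x. x \<in> S \<Longrightarrow> (f has_derivative f' x) (at x)"
    and "\<And>v. Ck_on k S (\<lambda>x. f' x v)"
  shows "Ck_on (Suc k) S f"
proof -
  have "frechet_derivative f (at x) = f' x" if "x \<in> S" for x
    using assms(2)[OF that] by (metis frechet_derivative_at)
  then have "Ck_on k S (\<lambda>x. frechet_derivative f (at x) v)" for v
    by (intro Ck_on_cong[OF assms(1) _ assms(3)[of v]]) simp
  moreover have "f differentiable (at x)" if "x \<in> S" for x
    using assms(2)[OF that] by (rule differentiableI)
  ultimately show ?thesis by simp
qed

lemma Ck_on_has_derivative:
  assumes "Ck_on (Suc k) S f" "x \<in> S"
  shows "(f has_derivative frechet_derivative f (at x)) (at x)"
proof -
  have "f differentiable (at x)"
    using assms by simp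
  then show ?thesis
    by (simp add: frechet_derivative_works)
qed

text \<open>The product rule leaves undifferentiated factors behind, so the induction also needs the
  weaker property for the factors themselves.\<close>

lemma Ck_on_SucD: "Ck_on (Suc k) S f \<Longrightarrow> Ck_on k S f"
proof (induction k arbitrary: f)
  case 0
  then show ?case
    by (simp add: continuous_at_imp_continuous_on differentiable_imp_continuous_within)
next
  case (Suc k)
  have "Ck_on (Suc k) S (\<lambda>x. frechet_derivative f (at x) v)" for v
    using Suc.prems unfolding Ck_on.simps(2)[of "Suc k"] by blast
  then have "Ck_on k S (\<lambda>x. frechet_derivative f (at x) v)" for v
    by (rule Suc.IH)
  moreover have "f differentiable (at x)" if "x \<in> S" for x
    using Suc.prems that unfolding Ck_on.simps(2)[of "Suc k"] by blast
  ultimately show ?case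
    unfolding Ck_on.simps(2)[of k] by blast
qed

lemma Ck_on_const:
  assumes "open S"
  shows "Ck_on k S (\<lambda>x. c)"
proof (induction k arbitrary: c)
  case (Suc k)
  show ?case
    by (rule Ck_on_derivI[OF assms has_derivative_const Suc.IH])
qed simp

lemma Ck_on_bounded_linear:
  assumes "open S" "bounded_linear f"
  shows "Ck_on k S f"
proof (cases k)
  case 0
  then show ?thesis
    using linear_continuous_on[OF assms(2)] by simp
next
  case (Suc m)
  show ?thesis
    unfolding Suc
    by (rule Ck_on_derivI[OF assms(1) bounded_linear_imp_has_derivative[OF assms(2)]
        Ck_on_const[OF assms(1)]])
qed

lemma Ck_on_add:
  assumes "open S"
  shows "Ck_on k S f \<Longrightarrow> Ck_on k S g \<Longrightarrow> Ck_on k S (\<lambda>x. f x + g x)"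
proof (induction k arbitrary: f g)
  case (Suc k)
  show ?case
  proof (rule Ck_on_derivI[OF assms])
    show "((\<lambda>x. f x + g x) has_derivative
        (\<lambda>v. frechet_derivative f (at x) v + frechet_derivative g (at x) v)) (at x)"
      if "x \<in> S" for x
      using Suc.prems that by (intro has_derivative_add Ck_on_has_derivative)
    show "Ck_on k S (\<lambda>x. frechet_derivative f (at x) v + frechet_derivative g (at x) v)" for v
      using Suc.prems unfolding Ck_on.simps(2) by (intro Suc.IH) blast+
  qed
qed (simp add: continuous_on_add)

text \<open>An arbitrary bilinear map covers products of reals and inner products at once.\<close>

lemma Ck_on_bilinear:
  assumes "open S" "bounded_bilinear h"
  shows "Ck_on k S f \<Longrightarrow> Ck_on k S g \<Longrightarrow> Ck_on k S (\<lambda>x. h (f x) (g x))"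
proof (induction k arbitrary: f g)
  case 0
  then show ?case
    using bounded_bilinear.continuous_on[OF assms(2)] by auto
next
  case (Suc k)
  show ?case
  proof (rule Ck_on_derivI[OF assms(1)])
    show "((\<lambda>x. h (f x) (g x)) has_derivative
        (\<lambda>v. h (f x) (frechet_derivative g (at x) v) + h (frechet_derivative f (at x) v) (g x))) (at x)"
      if "x \<in> S" for x
      using Suc.prems that by (intro bounded_bilinear.FDERIV[OF assms(2)] Ck_on_has_derivative)
    show "Ck_on k S (\<lambda>x. h (f x) (frechet_derivative g (at x) v) + h (frechet_derivative f (at x) v) (g x))" for v
      using Suc.prems
      by (intro Ck_on_add[OF assms(1)] Suc.IH Ck_on_SucD[OF Suc.prems(1)] Ck_on_SucD[OF Suc.prems(2)])
        (simp_all only: Ck_on.simps)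
  qed
qed

text \<open>The exponent varies in the induction because differentiation lowers it by one.\<close>

lemma Ck_on_powr:
  fixes f :: "'a::real_normed_vector \<Rightarrow> real"
  assumes "open S" "\<And>x. x \<in> S \<Longrightarrow> f x > 0"
  shows "Ck_on k S f \<Longrightarrow> Ck_on k S (\<lambda>x. f x powr e)"
proof (induction k arbitrary: e)
  case 0
  then show ?case
    using assms by (force intro: continuous_on_powr continuous_on_const)
next
  case (Suc k)
  show ?case
  proof (rule Ck_on_derivI[OF assms(1)])
    show "((\<lambda>x. f x powr e) has_derivative
        (\<lambda>v. frechet_derivative f (at x) v * (e * f x powr (e - 1)))) (at x)"
      if "x \<in> S" for x
      using has_derivative_compose[OF Ck_on_has_derivative[OF Suc.prems that]
          has_real_derivative_powr[OF assms(2)[OF that], of e, unfolded has_field_derivative_def]]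
      by (simp add: mult_ac)
    show "Ck_on k S (\<lambda>x. frechet_derivative f (at x) v * (e * f x powr (e - 1)))" for v
      using Suc.prems
      by (intro Ck_on_bilinear[OF assms(1) bounded_bilinear_mult] Ck_on_const[OF assms(1)]
          Suc.IH[OF Ck_on_SucD[OF Suc.prems]]) (simp only: Ck_on.simps)
  qed
qed

lemma smooth_on_const: "open S \<Longrightarrow> smooth_on S (\<lambda>x. c)"
  and smooth_on_bounded_linear: "open S \<Longrightarrow> bounded_linear l \<Longrightarrow> smooth_on S l"
  and smooth_on_add: "open S \<Longrightarrow> smooth_on S f \<Longrightarrow> smooth_on S g \<Longrightarrow> smooth_on S (\<lambda>x. f x + g x)"
  and smooth_on_bilinear: "open S \<Longrightarrow> bounded_bilinear h \<Longrightarrow> smooth_on S f' \<Longrightarrow> smooth_on S g' \<Longrightarrow>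
    smooth_on S (\<lambda>x. h (f' x) (g' x))"
  and smooth_on_powr: "open S \<Longrightarrow> smooth_on S r \<Longrightarrow> (\<And>x. x \<in> S \<Longrightarrow> r x > 0) \<Longrightarrow>
    smooth_on S (\<lambda>x. r x powr e)" for r :: "_ \<Rightarrow> real"
  unfolding smooth_on_def
  by (auto intro: Ck_on_const Ck_on_bounded_linear Ck_on_add Ck_on_bilinear Ck_on_powr)

lemmas smooth_on_mult = smooth_on_bilinear[OF _ bounded_bilinear_mult]
  and smooth_on_inner = smooth_on_bilinear[OF _ bounded_bilinear_inner]
  and smooth_on_ident = smooth_on_bounded_linear[OF _ bounded_linear_ident]

lemma smooth_on_frechet: "smooth_on S f \<Longrightarrow> smooth_on S (\<lambda>x. frechet_derivative f (at x) v)"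
  unfolding smooth_on_def using Ck_on.simps(2) by blast

lemma smooth_on_has_derivative:
  assumes "smooth_on S f" "x \<in> S"
  shows "(f has_derivative frechet_derivative f (at x)) (at x)"
  using assms Ck_on_has_derivative unfolding smooth_on_def by blast

lemma smooth_on_dir_deriv: "smooth_on S f \<Longrightarrow> smooth_on S (dir_deriv vs f)"
  by (induction vs) (auto intro: smooth_on_frechet)

text \<open>Directional derivatives in the parameter are pointwise limits of difference quotients,
  so they inherit measurability in the other variable.\<close>

lemma borel_measurable_dir_deriv:
  fixes f :: "'x \<Rightarrow> 'a::real_normed_vector \<Rightarrow> real"
  assumes smooth: "\<And>x. x \<in> space M \<Longrightarrow> smooth_on UNIV (f x)"
    and meas: "\<And>v. (\<lambda>x. f x v) \<in> borel_measurable M"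
  shows "(\<lambda>x. dir_deriv vs (f x) v) \<in> borel_measurable M"
proof (induction vs arbitrary: v)
  case Nil
  then show ?case using meas by simp
next
  case (Cons w vs)
  let ?g = "\<lambda>x. dir_deriv vs (f x)"
  show ?case
  proof (rule borel_measurable_LIMSEQ_real)
    \<comment> \<open>\<open>Suc n\<close> keeps the step size 1 / (n + 1) well defined and nonzero
      for every n.\<close>
    show "(\<lambda>x. real (Suc n) * (?g x (v + (1 / real (Suc n)) *\<^sub>R w) - ?g x v)) \<in> borel_measurable M" for n
      using Cons by (intro borel_measurable_times borel_measurable_diff) auto
    fix x assume "x \<in> space M"
    then have d: "(?g x has_derivative frechet_derivative (?g x) (at v)) (at v)"
      by (intro smooth_on_has_derivative[OF smooth_on_dir_deriv[OF smooth]]) auto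
    have "((\<lambda>t. ?g x (v + t *\<^sub>R w)) has_real_derivative frechet_derivative (?g x) (at v) w) (at 0)"
    proof -
      have "((\<lambda>t. v + t *\<^sub>R w) has_derivative (\<lambda>t. t *\<^sub>R w)) (at 0)"
        by (auto intro!: derivative_eq_intros)
      from has_derivative_compose[OF this, of "?g x"] d
      have "((\<lambda>t. ?g x (v + t *\<^sub>R w)) has_derivative
          (\<lambda>t. frechet_derivative (?g x) (at v) (t *\<^sub>R w))) (at 0)"
        by simp
      moreover have "(\<lambda>t. frechet_derivative (?g x) (at v) (t *\<^sub>R w)) = (*) (frechet_derivative (?g x) (at v) w)"
        by (simp add: fun_eq_iff linear_cmul[OF has_derivative_linear[OF d]] mult.commute)
      ultimately show ?thesis
        by (simp add: has_field_derivative_def)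
    qed
    then have "((\<lambda>t. (?g x (v + t *\<^sub>R w) - ?g x v) / t) \<longlongrightarrow> frechet_derivative (?g x) (at v) w) (at 0)"
      by (simp add: DERIV_def)
    moreover have "filterlim (\<lambda>n. 1 / real (Suc n)) (at 0) sequentially"
      using LIMSEQ_Suc[OF lim_1_over_n]  by (auto simp: filterlim_at)
    ultimately have "(\<lambda>n. (?g x (v + (1 / real (Suc n)) *\<^sub>R w) - ?g x v) / (1 / real (Suc n)))
        \<longlonglongrightarrow> frechet_derivative (?g x) (at v) w"
      by (rule filterlim_compose)
    then show "(\<lambda>n. real (Suc n) * (?g x (v + (1 / real (Suc n)) *\<^sub>R w) - ?g x v))
        \<longlonglongrightarrow> dir_deriv (w # vs) (f x) v"
      by (simp add: mult.commute)
  qed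
qed

section \<open>Gamma mixtures of Gaussians\<close>

text \<open>As a function of \<open>s\<close>, this is the Laplace transform of
  \<open>t powr (A - 1)\<close> on the half line. With \<open>Gamma A\<close> kept inside,
  integrating out variables produces no constants.\<close>

definition gker :: "real \<Rightarrow> real \<Rightarrow> real" where
  "gker A s = Gamma A * s powr (- A)"

lemma gker_pos: "A > 0 \<Longrightarrow> s > 0 \<Longrightarrow> gker A s > 0"
  by (simp add: gker_def Gamma_real_pos)

lemma measurable_gker [measurable]: "gker A \<in> borel_measurable borel"
  unfolding gker_def by measurable

text \<open>Euler's integral after the substitution t = s u. The nonnegative integral allows the
  order of integration to be changed without any proof of integrability.\<close>

lemma gker_eq_nn_integral:
  assumes "A > 0" "s > 0"
  shows "ennreal (gker A s) =
    (\<integral>\<^sup>+t. ennreal (indicator {0..} t * t powr (A - 1) * exp (- (s * t))) \<partial>lborel)" (is "_ = ?I")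
proof -
  have "ennreal (Gamma A) = (\<integral>\<^sup>+t. ennreal (indicator {0..} t * t powr (A - 1) / exp t) \<partial>lborel)"
    by (rule Gamma_conv_nn_integral_real[OF assms(1)])
  also have "\<dots> = ennreal s * (\<integral>\<^sup>+u. ennreal (indicator {0..} (s * u) * (s * u) powr (A - 1) / exp (s * u)) \<partial>lborel)"
    using assms(2) by (subst nn_integral_real_affine[where c = s and t = 0]) auto
  also have "(\<integral>\<^sup>+u. ennreal (indicator {0..} (s * u) * (s * u) powr (A - 1) / exp (s * u)) \<partial>lborel)
      = (\<integral>\<^sup>+u. ennreal (s powr (A - 1)) * ennreal (indicator {0..} u * u powr (A - 1) * exp (- (s * u))) \<partial>lborel)"
    using assms(2)
    by (intro nn_integral_cong)
      (auto simp: indicator_def zero_le_mult_iff powr_mult exp_minus divide_inverse mult_ac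
        simp flip: ennreal_mult' ennreal_mult'')
  also have "\<dots> = ennreal (s powr (A - 1)) * ?I"
    by (rule nn_integral_cmult) measurable
  also have "ennreal s * (ennreal (s powr (A - 1)) * ?I) = ennreal (s * s powr (A - 1)) * ?I"
    using assms(2) by (simp add: mult.assoc ennreal_mult)
  also have "s * s powr (A - 1) = s powr A"
    using assms(2) powr_mult_base[of s "A - 1"] by simp
  finally have *: "ennreal (Gamma A) = ennreal (s powr A) * ?I" .
  have "ennreal (gker A s) = ennreal (s powr (- A)) * ennreal (Gamma A)"
    by (simp add: gker_def mult.commute ennreal_mult'')
  also have "\<dots> = ?I"
  proof -
    have "ennreal (s powr (- A)) * (ennreal (s powr A) * ?I) = ennreal (s powr (- A) * s powr A) * ?I"
      by (simp add: mult.assoc ennreal_mult)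
    also have "s powr (- A) * s powr A = 1"
      using assms(2) by (simp flip: powr_add)
    finally show ?thesis unfolding * by simp
  qed
  finally show ?thesis .
qed

lemma nn_integral_gaussian_real:
  assumes "t > 0"
  shows "(\<integral>\<^sup>+y. ennreal (exp (- (t * (pi * (y - m)\<^sup>2)))) \<partial>lborel) = ennreal (t powr (- 1 / 2))"
proof -
  \<comment> \<open>Chosen so that 1 / (2 \<sigma>^2) = t pi; the normalizing factor of the normal
    density is then the square root of t.\<close>
  define \<sigma> where "\<sigma> = sqrt (1 / (2 * pi * t))"
  have \<sigma>: "\<sigma> > 0" "\<sigma>\<^sup>2 = 1 / (2 * pi * t)"
    using assms by (auto simp: \<sigma>_def)
  have "exp (- (t * (pi * (y - m)\<^sup>2))) = t powr (- 1 / 2) * normal_density m \<sigma> y" for y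
    using assms
    by (simp add: normal_density_def \<sigma>(2) powr_minus powr_half_sqrt real_sqrt_divide field_simps)
  then have "(\<integral>\<^sup>+y. ennreal (exp (- (t * (pi * (y - m)\<^sup>2)))) \<partial>lborel)
      = (\<integral>\<^sup>+y. ennreal (t powr (- 1 / 2)) * ennreal (normal_density m \<sigma> y) \<partial>lborel)"
    by (simp add: ennreal_mult)
  also have "\<dots> = ennreal (t powr (- 1 / 2)) * (\<integral>\<^sup>+y. ennreal (normal_density m \<sigma> y) \<partial>lborel)"
    by (rule nn_integral_cmult) measurable
  also have "(\<integral>\<^sup>+y. ennreal (normal_density m \<sigma> y) \<partial>lborel) = 1"
    using \<sigma>(1) by (subst nn_integral_eq_integral) auto
  finally show ?thesis by simp
qed

text \<open>The pi in the exponent cancels the one in the Gaussian integral, so only a power of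
  \<open>t\<close> survives.\<close>

lemma nn_integral_gaussian:
  fixes v :: "'a::euclidean_space"
  assumes "t > 0"
  shows "(\<integral>\<^sup>+y. ennreal (exp (- (t * (pi * (norm (y - v))\<^sup>2)))) \<partial>lborel) = ennreal (t powr (- real DIM('a) / 2))"
proof -
  have "(norm (y - v))\<^sup>2 = (\<Sum>b\<in>Basis. (y \<bullet> b - v \<bullet> b)\<^sup>2)" for y
    unfolding power2_norm_eq_inner euclidean_inner[of "y - v" "y - v"]
    by (simp only: power2_eq_square inner_diff_left)
  then have "ennreal (exp (- (t * (pi * (norm (y - v))\<^sup>2))))
      = (\<Prod>b\<in>Basis. ennreal (exp (- (t * (pi * (y \<bullet> b - v \<bullet> b)\<^sup>2)))))" for y
    by (simp add: prod_ennreal sum_distrib_left sum_negf flip: exp_sum)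
  then have "(\<integral>\<^sup>+y. ennreal (exp (- (t * (pi * (norm (y - v))\<^sup>2)))) \<partial>lborel)
      = (\<Prod>b\<in>Basis. \<integral>\<^sup>+x. ennreal (exp (- (t * (pi * (x - v \<bullet> b)\<^sup>2)))) \<partial>lborel)"
    using nn_integral_lborel_prod[of "\<lambda>b x. ennreal (exp (- (t * (pi * (x - v \<bullet> b)\<^sup>2))))"] by simp
  also have "\<dots> = ennreal ((t powr (- 1 / 2)) ^ DIM('a))"
    using assms by (simp add: nn_integral_gaussian_real ennreal_power)
  also have "(t powr (- 1 / 2)) ^ DIM('a) = t powr (- real DIM('a) / 2)"
    using assms by (subst powr_power) auto
  finally show ?thesis .
qed

lemma nn_integral_gker:
  fixes v :: "'a::euclidean_space"
  assumes "A > real DIM('a) / 2" "s > 0"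
  shows "(\<integral>\<^sup>+y. ennreal (gker A (s + pi * (norm (y - v))\<^sup>2)) \<partial>lborel) = ennreal (gker (A - real DIM('a) / 2) s)"
proof -
  have A: "A > 0"
    by (rule le_less_trans[OF _ assms(1)]) simp
  have "(\<integral>\<^sup>+y. ennreal (gker A (s + pi * (norm (y - v))\<^sup>2)) \<partial>lborel)
    = (\<integral>\<^sup>+y. (\<integral>\<^sup>+t. ennreal (indicator {0..} t * t powr (A - 1) * exp (- ((s + pi * (norm (y - v))\<^sup>2) * t))) \<partial>lborel) \<partial>lborel)"
    using A assms(2) by (simp add: gker_eq_nn_integral add_pos_nonneg)
  also have "\<dots> = (\<integral>\<^sup>+t. (\<integral>\<^sup>+y. ennreal (indicator {0..} t * t powr (A - 1) * exp (- ((s + pi * (norm (y - v))\<^sup>2) * t))) \<partial>lborel) \<partial>lborel)"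
    by (rule lborel_pair.Fubini') measurable
  also have "\<dots> = (\<integral>\<^sup>+t. ennreal (indicator {0..} t * t powr (A - real DIM('a) / 2 - 1) * exp (- (s * t))) \<partial>lborel)"
  proof (rule nn_integral_cong)
    fix t :: real
    have "(\<integral>\<^sup>+y. ennreal (indicator {0..} t * t powr (A - 1) * exp (- ((s + pi * (norm (y - v))\<^sup>2) * t))) \<partial>lborel)
      = (\<integral>\<^sup>+y. ennreal (indicator {0..} t * t powr (A - 1) * exp (- (s * t))) * ennreal (exp (- (t * (pi * (norm (y - v))\<^sup>2)))) \<partial>lborel)"
      by (intro nn_integral_cong) (simp add: algebra_simps exp_add exp_diff exp_minus divide_inverse flip: ennreal_mult)
    also have "\<dots> = ennreal (indicator {0..} t * t powr (A - 1) * exp (- (s * t))) *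
        (\<integral>\<^sup>+y. ennreal (exp (- (t * (pi * (norm (y - v))\<^sup>2)))) \<partial>lborel)"
      by (rule nn_integral_cmult) measurable
    also have "\<dots> = ennreal (indicator {0..} t * t powr (A - real DIM('a) / 2 - 1) * exp (- (s * t)))"
    \<comment> \<open>For t \<le> 0 the Gaussian integral is infinite, but its factor vanishes:
      through the indicator if t < 0, and through \<open>0 powr x = 0\<close> if t = 0. Hence the
      identity holds at every t, not just almost everywhere.\<close>
    proof (cases "t > 0")
      case True
      have "t powr (A - 1) * t powr (- real DIM('a) / 2) = t powr (A - real DIM('a) / 2 - 1)"
        by (simp add: algebra_simps flip: powr_add)
      then have "t powr (A - 1) * exp (- (s * t)) * t powr (- real DIM('a) / 2)
          = t powr (A - real DIM('a) / 2 - 1) * exp (- (s * t))"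
        by (metis mult.commute mult.assoc)
      with True show ?thesis
        unfolding nn_integral_gaussian[OF True] by (simp flip: ennreal_mult)
    qed (auto simp: indicator_def)
    finally show "(\<integral>\<^sup>+y. ennreal (indicator {0..} t * t powr (A - 1) * exp (- ((s + pi * (norm (y - v))\<^sup>2) * t))) \<partial>lborel)
      = ennreal (indicator {0..} t * t powr (A - real DIM('a) / 2 - 1) * exp (- (s * t)))" .
  qed
  also have "\<dots> = ennreal (gker (A - real DIM('a) / 2) s)"
    using assms by (simp add: gker_eq_nn_integral)
  finally show ?thesis .
qed

text \<open>The inserted variable is integrated first, the squares of the others being part of the
  shift. This lowers \<open>A\<close> before the induction hypothesis is applied, so the induction
  runs over all \<open>A\<close>.\<close>

lemma nn_integral_gker_PiM:
  fixes v :: "'a::euclidean_space"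
  assumes "finite I" "A > real (card I) * real DIM('a) / 2" "s > 0"
  shows "(\<integral>\<^sup>+x. ennreal (gker A (s + pi * (\<Sum>m\<in>I. (norm (x m - v))\<^sup>2))) \<partial>(\<Pi>\<^sub>M m\<in>I. lborel))
    = ennreal (gker (A - real (card I) * real DIM('a) / 2) s)"
  using assms
proof (induction I arbitrary: A s rule: finite_induct)
  case empty
  interpret product_sigma_finite "\<lambda>i. lborel :: 'a measure" ..
  from empty show ?case
    by (subst PiM_empty) (simp add: nn_integral_count_space_finite)
next
  case (insert i I)
  interpret product_sigma_finite "\<lambda>i. lborel :: 'a measure" ..
  have eq: "s + pi * (\<Sum>m\<in>insert i I. (norm ((x(i := y)) m - v))\<^sup>2)
      = (s + pi * (\<Sum>m\<in>I. (norm (x m - v))\<^sup>2)) + pi * (norm (y - v))\<^sup>2" for x y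
  proof -
    have "(\<Sum>m\<in>I. (norm ((x(i := y)) m - v))\<^sup>2) = (\<Sum>m\<in>I. (norm (x m - v))\<^sup>2)"
      using insert.hyps by (intro sum.cong) auto
    then show ?thesis
      using insert.hyps by (simp add: algebra_simps)
  qed
  have c: "real (card (insert i I)) * real DIM('a) / 2 = real (card I) * real DIM('a) / 2 + real DIM('a) / 2"
    using insert.hyps by (simp add: algebra_simps add_divide_distrib)
  have "(\<integral>\<^sup>+x. ennreal (gker A (s + pi * (\<Sum>m\<in>insert i I. (norm (x m - v))\<^sup>2))) \<partial>(\<Pi>\<^sub>M m\<in>insert i I. lborel))
    = (\<integral>\<^sup>+x. (\<integral>\<^sup>+y. ennreal (gker A (s + pi * (\<Sum>m\<in>insert i I. (norm ((x(i := y)) m - v))\<^sup>2))) \<partial>lborel) \<partial>(\<Pi>\<^sub>M m\<in>I. lborel))"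
    using insert.hyps by (intro product_nn_integral_insert) measurable
  also have "\<dots> = (\<integral>\<^sup>+x. ennreal (gker (A - real DIM('a) / 2) (s + pi * (\<Sum>m\<in>I. (norm (x m - v))\<^sup>2))) \<partial>(\<Pi>\<^sub>M m\<in>I. lborel))"
  proof (intro nn_integral_cong)
    fix x :: "_ \<Rightarrow> 'a"
    have "A > real DIM('a) / 2"
      by (rule le_less_trans[OF _ insert.prems(1)]) (simp add: c)
    then show "(\<integral>\<^sup>+y. ennreal (gker A (s + pi * (\<Sum>m\<in>insert i I. (norm ((x(i := y)) m - v))\<^sup>2))) \<partial>lborel)
      = ennreal (gker (A - real DIM('a) / 2) (s + pi * (\<Sum>m\<in>I. (norm (x m - v))\<^sup>2)))"
      unfolding eq using insert.prems(2)
      by (intro nn_integral_gker) (auto intro!: add_pos_nonneg sum_nonneg mult_nonneg_nonneg)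
  qed
  also have "\<dots> = ennreal (gker (A - real DIM('a) / 2 - real (card I) * real DIM('a) / 2) s)"
    using insert.prems c by (intro insert.IH) auto
  finally show ?case
    unfolding c by (simp add: algebra_simps)
qed

section \<open>Manifolds with a global coordinate\<close>

context
  fixes F :: "'e::euclidean_space \<Rightarrow> 'p"
  assumes inj: "inj F"
begin

lemma image_inv_range: "inv F ` range F = UNIV"
  using inj by (auto simp: image_image)

text \<open>The inverse of the chart \<open>inv F\<close> is \<open>F\<close>, so every chart
  expression becomes a statement about composition with \<open>F\<close>.\<close>

lemma inv_into_inv: "inv_into (range F) (inv F) = F"
proof
  fix v
  have "inj_on (inv F) (range F)"
    using inj by (auto simp: inj_on_def)
  from inv_into_f_f[OF this, of "F v"] show "inv_into (range F) (inv F) v = F v"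
    using inj by simp
qed

lemma topspace_global: "topspace (pullback_topology (range F) (inv F) euclidean) = range F"
  by (simp add: topspace_pullback_topology)

lemma homeomorphic_map_global:
  "homeomorphic_map (pullback_topology (range F) (inv F) euclidean) euclidean (inv F)"
proof (rule homeomorphic_maps_imp_map)
  let ?X = "pullback_topology (range F) (inv F) (euclidean :: 'e topology)"
  show "homeomorphic_maps ?X euclidean (inv F) F"
    unfolding homeomorphic_maps_def
  proof (intro conjI)
    show "continuous_map ?X euclidean (inv F)"
      by (auto simp: continuous_map_def openin_pullback_topology topspace_global)
    show "continuous_map euclidean ?X F"
      using inj by (auto simp: continuous_map_def openin_pullback_topology topspace_global
          vimage_def inj_eq intro!: exI)
    show "\<forall>x\<in>topspace ?X. F (inv F x) = x"
      by (auto simp: topspace_global f_inv_into_f)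
  qed (use inj in auto)
qed

lemma smoothly_compatible_global: "smoothly_compatible (range F, inv F) (range F, inv F)"
  using inj by (simp add: smoothly_compatible_def image_inv_range inv_into_inv comp_def smooth_on_ident)

lemma topological_chart_global:
  "topological_chart (pullback_topology (range F) (inv F) euclidean) (range F, inv F)"
proof -
  have "openin (pullback_topology (range F) (inv F) euclidean) (range F)"
    using openin_topspace topspace_global by metis
  then show ?thesis
    using homeomorphic_map_global subtopology_topspace[of "pullback_topology (range F) (inv F) euclidean"]
    by (simp add: topological_chart_def image_inv_range topspace_global)
qed

lemma global_in_coordinate_systems:
  "(range F, inv F) \<in> coordinate_systems (pullback_topology (range F) (inv F) euclidean) {(range F, inv F)}"
  by (simp add: coordinate_systems_def topological_chart_global smoothly_compatible_global)

lemma smooth_manifold_global: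
  "smooth_manifold (pullback_topology (range F) (inv F) euclidean) {(range F, inv F)}"
proof -
  let ?X = "pullback_topology (range F) (inv F) (euclidean :: 'e topology)"
  have "?X homeomorphic_space (euclidean :: 'e topology)"
    using homeomorphic_map_global homeomorphic_map_imp_homeomorphic_space by blast
  moreover have "second_countable (euclidean :: 'e topology)"
  proof -
    obtain B :: "'e set set" where "countable B" "topological_basis B"
      using ex_countable_basis by blast
    then show ?thesis
      unfolding second_countable_def open_openin[symmetric]
      by (meson topological_basisE topological_basis_open)
  qed
  moreover have "connected_space (euclidean :: 'e topology)"
    using connectedin_topspace[of "euclidean :: 'e topology"] connected_UNIV[where 'a = 'e] by simp
  ultimately have "Hausdorff_space ?X" "second_countable ?X" "connected_space ?X"
    using homeomorphic_Hausdorff_space homeomorphic_space_second_countability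
      homeomorphic_connected_space Hausdorff_space_euclidean by blast+
  then show ?thesis
    by (simp add: smooth_manifold_def topological_chart_global topspace_global smoothly_compatible_global)
qed

lemma C_inf_global: "C_inf {(range F, inv F)} (range F) = {f. smooth_on UNIV (f \<circ> F)}"
  by (simp add: C_inf_def image_inv_range inv_into_inv)

text \<open>With a single chart, a vector field is one smooth coefficient function \<open>a\<close>
  acting on pullbacks along \<open>F\<close>.\<close>

lemma vector_fields_globalD:
  assumes "V \<in> vector_fields (pullback_topology (range F) (inv F) euclidean) {(range F, inv F)}"
  obtains a where "smooth_on UNIV a"
    "\<And>f v. smooth_on UNIV (f \<circ> F) \<Longrightarrow> V f (F v) = frechet_derivative (f \<circ> F) (at v) (a v)"
  using assms inj that
  by (auto simp: vector_fields_def topspace_global C_inf_global image_inv_range inv_into_inv)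

end


section \<open>Integrals of derivatives along translations\<close>

text \<open>By Fubini and the fundamental theorem of calculus, the integral of \<open>H\<close> over
  \<open>{0..1} \<times> space L\<close> is that of \<open>G 1 - G 0\<close>; invariance makes the former
  \<open>integral\<^sup>L L (H 0)\<close> and the latter zero.\<close>

lemma integral_derivative_eq_0:
  fixes G H :: "real \<Rightarrow> 'x \<Rightarrow> real"
  assumes "sigma_finite_measure L"
    and deriv: "\<And>t x. x \<in> space L \<Longrightarrow> ((\<lambda>t. G t x) has_real_derivative H t x) (at t)"
    and cont: "\<And>t x. x \<in> space L \<Longrightarrow> isCont (\<lambda>t. H t x) t"
    and meas_G: "\<And>t. G t \<in> borel_measurable L"
    and meas_H: "(\<lambda>(t, x). H t x) \<in> borel_measurable (lborel \<Otimes>\<^sub>M L)"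
    and \<tau>: "\<And>t. \<tau> t \<in> measurable L L" "\<And>t. distr L L (\<tau> t) = L"
    and inv: "\<And>t x. x \<in> space L \<Longrightarrow> G t (\<tau> t x) = G 0 x" "\<And>t x. x \<in> space L \<Longrightarrow> H t (\<tau> t x) = H 0 x"
    and int: "integrable L (G 0)" "integrable L (H 0)"
  shows "integral\<^sup>L L (H 0) = 0"
proof -
  interpret L: sigma_finite_measure L by fact
  interpret pair_sigma_finite lborel L ..
  have transfer: "integrable L g \<longleftrightarrow> integrable L (\<lambda>x. g (\<tau> t x))" "integral\<^sup>L L g = (LINT x|L. g (\<tau> t x))"
    if "g \<in> borel_measurable L" for g :: "'x \<Rightarrow> real" and t
    using integrable_distr_eq[OF \<tau>(1) that] integral_distr[OF \<tau>(1) that] \<tau>(2)[of t] by metis+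
  have meas_Ht [measurable]: "H t \<in> borel_measurable L" for t
    using measurable_compose[OF measurable_Pair1' meas_H, of t] by simp
  have int_G: "integrable L (G t)" "integral\<^sup>L L (G t) = integral\<^sup>L L (G 0)" for t
  proof -
    have "integrable L (\<lambda>x. G t (\<tau> t x))"
      using int(1) by (subst Bochner_Integration.integrable_cong[OF refl inv(1)])
    then show "integrable L (G t)"
      by (subst transfer(1)[OF meas_G, of _ t])
    have "(LINT x|L. G t (\<tau> t x)) = integral\<^sup>L L (G 0)"
      by (rule Bochner_Integration.integral_cong[OF refl inv(1)])
    then show "integral\<^sup>L L (G t) = integral\<^sup>L L (G 0)"
      by (subst transfer(2)[OF meas_G, of _ t])
  qed
  have int_H: "integrable L (H t)" "integral\<^sup>L L (H t) = integral\<^sup>L L (H 0)"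
    "(LINT x|L. \<bar>H t x\<bar>) = (LINT x|L. \<bar>H 0 x\<bar>)" for t
  proof -
    have "integrable L (\<lambda>x. H t (\<tau> t x))"
      using int(2) by (subst Bochner_Integration.integrable_cong[OF refl inv(2)])
    then show "integrable L (H t)"
      by (subst transfer(1)[OF meas_Ht, of _ t])
    have "(LINT x|L. H t (\<tau> t x)) = integral\<^sup>L L (H 0)"
      by (rule Bochner_Integration.integral_cong[OF refl inv(2)])
    then show "integral\<^sup>L L (H t) = integral\<^sup>L L (H 0)"
      by (subst transfer(2)[OF meas_Ht, of _ t])
    have "(LINT x|L. \<bar>H t (\<tau> t x)\<bar>) = (LINT x|L. \<bar>H 0 x\<bar>)"
      by (rule Bochner_Integration.integral_cong[OF refl]) (simp add: inv(2))
    then show "(LINT x|L. \<bar>H t x\<bar>) = (LINT x|L. \<bar>H 0 x\<bar>)"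
      by (subst transfer(2)[where t = t]) auto
  qed
  define f where "f = (\<lambda>t x. H t x * indicator {0..1} t)"
  have [measurable]: "(\<lambda>(t, x). f t x) \<in> borel_measurable (lborel \<Otimes>\<^sub>M L)"
    using borel_measurable_times[OF meas_H, of "\<lambda>z. indicator {0..1} (fst z)"]
    by (simp add: f_def split_beta')
  \<comment> \<open>By invariance the L1 norm of \<open>H t\<close> is the same for all t, so the
    integral of the absolute value over the unit strip is that of \<open>H 0\<close>.\<close>
  have "integrable (lborel \<Otimes>\<^sub>M L) (\<lambda>(t, x). f t x)"
  proof (rule Fubini_integrable)
    have "(LINT x|L. norm (case (t, x) of (t, x) \<Rightarrow> f t x)) = (LINT x|L. \<bar>H 0 x\<bar>) * indicator {0..1} t" for t
      by (simp add: f_def abs_mult int_H(3)[of t])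
    then show "integrable lborel (\<lambda>t. LINT x|L. norm (case (t, x) of (t, x) \<Rightarrow> f t x))"
      by simp
    show "AE t in lborel. integrable L (\<lambda>x. case (t, x) of (t, x) \<Rightarrow> f t x)"
      using int_H(1) by (simp add: f_def)
  qed simp
  then have "(LINT x|L. LINT t|lborel. f t x) = (LINT t|lborel. LINT x|L. f t x)"
    by (rule Fubini_integral)
  also have "(LINT t|lborel. LINT x|L. f t x) = (LINT t|lborel. integral\<^sup>L L (H 0) * indicator {0..1::real} t)"
    by (rule Bochner_Integration.integral_cong[OF refl]) (simp add: f_def, metis int_H(2))
  also have "\<dots> = integral\<^sup>L L (H 0)"
    by simp
  also have "(LINT x|L. LINT t|lborel. f t x) = (LINT x|L. G 1 x - G 0 x)"
  proof (rule Bochner_Integration.integral_cong[OF refl])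
    fix x assume "x \<in> space L"
    then show "(LINT t|lborel. f t x) = G 1 x - G 0 x"
      unfolding f_def by (intro integral_FTC_Icc_real deriv cont) auto
  qed
  also have "\<dots> = 0"
    using int_G[of 1] int(1) by simp
  finally show ?thesis by simp
qed

section \<open>Location families of power densities\<close>

text \<open>The family itself (a one-element index set) and its repetitions (indices 1 to k) live on
  sample spaces of different types; \<open>X m\<close> stands for the m-th component in both cases.
  \<open>diagonal\<close> supplies points with all components equal, and \<open>\<tau> w\<close>
  translates every component by \<open>w\<close>.\<close>

locale location_family = sigma_finite_measure L for L :: "'x measure" +
  fixes I :: "'i set" and X :: "'i \<Rightarrow> 'x \<Rightarrow> 'e::euclidean_space" and \<tau> :: "'e \<Rightarrow> 'x \<Rightarrow> 'x"
    and K c E :: real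
  assumes finite_I: "finite I" "I \<noteq> {}"
    and measurable_X [measurable]: "\<And>m. m \<in> I \<Longrightarrow> X m \<in> borel_measurable L"
    and diagonal: "\<And>v. \<exists>x\<in>space L. \<forall>m\<in>I. X m x = v"
    and measurable_translate: "\<And>w. \<tau> w \<in> measurable L L"
    and distr_translate: "\<And>w. distr L L (\<tau> w) = L"
    and X_translate: "\<And>w m x. m \<in> I \<Longrightarrow> x \<in> space L \<Longrightarrow> X m (\<tau> w x) = X m x + w"
    and pos: "K > 0" "c > 0" "E > 0"
    and mass_one: "(\<integral>\<^sup>+x. ennreal (K * (c + pi * (\<Sum>m\<in>I. (norm (X m x))\<^sup>2)) powr (- E)) \<partial>L) = 1"
begin

definition s :: "'e \<Rightarrow> 'x \<Rightarrow> real" where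
  "s v x = c + pi * (\<Sum>m\<in>I. (norm (X m x - v))\<^sup>2)"

text \<open>Half the gradient in \<open>v\<close> of the sum of squares in \<open>s\<close>.\<close>

definition y :: "'e \<Rightarrow> 'x \<Rightarrow> 'e" where
  "y v x = (\<Sum>m\<in>I. v - X m x)"

definition F :: "'e \<Rightarrow> 'x \<Rightarrow> real" where
  "F v = (\<lambda>x\<in>space L. K * s v x powr (- E))"

text \<open>\<open>D\<close> and \<open>D2\<close> are the first and second derivatives of
  \<open>F\<close> in the parameter, in closed form: measurability, bounds and behaviour under
  translation can be read off.\<close>

definition D :: "'e \<Rightarrow> 'x \<Rightarrow> 'e \<Rightarrow> real" where
  "D v x a = - (2 * pi * K * E) * (s v x powr (- E - 1) * (y v x \<bullet> a))"

definition D2 :: "'e \<Rightarrow> 'x \<Rightarrow> 'e \<Rightarrow> 'e \<Rightarrow> real" where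
  "D2 v x a b = - (2 * pi * K * E) * (2 * pi * (- E - 1) * s v x powr (- E - 2) * (y v x \<bullet> a) * (y v x \<bullet> b)
     + real (card I) * s v x powr (- E - 1) * (a \<bullet> b))"

lemma s_ge: "s v x \<ge> c"
  by (simp add: s_def sum_nonneg)

lemma s_pos: "s v x > 0"
  using s_ge[of v x] pos(2) by linarith

lemma measurable_s [measurable]: "s v \<in> borel_measurable L"
  unfolding s_def by measurable

lemma measurable_y [measurable]: "y v \<in> borel_measurable L"
  unfolding y_def by measurable

text \<open>Joint measurability along a line of parameters, as required for Fubini.\<close>

lemma measurable_s_pair [measurable]:
  "(\<lambda>z. s (v + fst z *\<^sub>R a) (snd z)) \<in> borel_measurable ((lborel :: real measure) \<Otimes>\<^sub>M L)"
  unfolding s_def by measurable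

lemma measurable_y_pair [measurable]:
  "(\<lambda>z. y (v + fst z *\<^sub>R a) (snd z)) \<in> borel_measurable ((lborel :: real measure) \<Otimes>\<^sub>M L)"
  unfolding y_def by measurable

lemma measurable_D [measurable]: "(\<lambda>x. D v x a) \<in> borel_measurable L"
  unfolding D_def by measurable

lemma measurable_D2 [measurable]: "(\<lambda>x. D2 v x a b) \<in> borel_measurable L"
  unfolding D2_def by measurable

lemma measurable_F [measurable]: "F v \<in> borel_measurable L"
proof (subst measurable_cong)
  show "(\<lambda>x. K * s v x powr (- E)) \<in> borel_measurable L"
    by measurable
qed (simp add: F_def)

lemma y_has_derivative: "((\<lambda>v. y v x) has_derivative (\<lambda>a. real (card I) *\<^sub>R a)) (at v)"
  unfolding y_def by (auto intro!: derivative_eq_intros simp: sum_constant_scaleR)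

lemma s_has_derivative: "((\<lambda>v. s v x) has_derivative (\<lambda>a. 2 * pi * (y v x \<bullet> a))) (at v)"
proof -
  have "((\<lambda>v. s v x) has_derivative (\<lambda>a. pi * (\<Sum>m\<in>I. (X m x - v) \<bullet> (0 - a) + (0 - a) \<bullet> (X m x - v)))) (at v)"
    unfolding s_def power2_norm_eq_inner
    by (rule has_derivative_eq_rhs, (rule has_derivative_add[OF has_derivative_const]
          has_derivative_mult_right has_derivative_sum has_derivative_inner
          has_derivative_diff[OF has_derivative_const has_derivative_ident])+) simp
  moreover have "(\<lambda>a. pi * (\<Sum>m\<in>I. (X m x - v) \<bullet> (0 - a) + (0 - a) \<bullet> (X m x - v))) = (\<lambda>a. 2 * pi * (y v x \<bullet> a))"
  proof
    fix a
    have "(X m x - v) \<bullet> (0 - a) + (0 - a) \<bullet> (X m x - v) = 2 * ((v - X m x) \<bullet> a)" for m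
      by (simp add: inner_commute[of a] inner_diff_left)
    then show "pi * (\<Sum>m\<in>I. (X m x - v) \<bullet> (0 - a) + (0 - a) \<bullet> (X m x - v)) = 2 * pi * (y v x \<bullet> a)"
      by (simp only: y_def inner_sum_left mult.assoc flip: sum_distrib_left)
  qed
  ultimately show ?thesis by simp
qed

lemma s_powr_has_derivative:
  "((\<lambda>v. s v x powr e) has_derivative (\<lambda>a. 2 * pi * e * s v x powr (e - 1) * (y v x \<bullet> a))) (at v)"
  using has_derivative_compose[OF s_has_derivative
      has_real_derivative_powr[OF s_pos, of e, unfolded has_field_derivative_def]]
  by (simp add: mult_ac)

lemma F_has_derivative:
  assumes "x \<in> space L"
  shows "((\<lambda>v. F v x) has_derivative D v x) (at v)"
proof -
  have "((\<lambda>v. F v x) has_derivative (\<lambda>a. K * (2 * pi * (- E) * s v x powr (- E - 1) * (y v x \<bullet> a)))) (at v)"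
    using assms has_derivative_mult_right[OF s_powr_has_derivative[of x "- E" v], of K]
    by (simp add: F_def)
  moreover have "(\<lambda>a. K * (2 * pi * (- E) * s v x powr (- E - 1) * (y v x \<bullet> a))) = D v x"
    by (simp add: D_def fun_eq_iff)
  ultimately show ?thesis by simp
qed

text \<open>The direction \<open>b\<close> moves with \<open>v\<close> because it will be the
  coefficient of a vector field; the product rule then adds a first-order term to the
  Hessian.\<close>

lemma D_has_derivative:
  assumes "(b has_derivative b') (at v)"
  shows "((\<lambda>v. D v x (b v)) has_derivative (\<lambda>a. D2 v x a (b v) + D v x (b' a))) (at v)"
proof -
  have "((\<lambda>v. D v x (b v)) has_derivative (\<lambda>a. - (2 * pi * K * E) *
      (s v x powr (- E - 1) * (y v x \<bullet> b' a + (real (card I) *\<^sub>R a) \<bullet> b v) +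
       (2 * pi * (- E - 1) * s v x powr (- E - 1 - 1) * (y v x \<bullet> a)) * (y v x \<bullet> b v)))) (at v)"
    unfolding D_def
    by (intro has_derivative_mult_right has_derivative_mult s_powr_has_derivative
        has_derivative_inner y_has_derivative assms)
  moreover have "(\<lambda>a. - (2 * pi * K * E) *
      (s v x powr (- E - 1) * (y v x \<bullet> b' a + (real (card I) *\<^sub>R a) \<bullet> b v) +
       (2 * pi * (- E - 1) * s v x powr (- E - 1 - 1) * (y v x \<bullet> a)) * (y v x \<bullet> b v)))
     = (\<lambda>a. D2 v x a (b v) + D v x (b' a))"
    by (simp add: D_def D2_def fun_eq_iff algebra_simps)
  ultimately show ?thesis by simp
qed

text \<open>Expanding the squares exhibits \<open>s\<close> as a quadratic polynomial in
  \<open>v\<close>.\<close>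

lemma smooth_on_s: "smooth_on UNIV (\<lambda>v. s v x)"
proof -
  have "s v x = (c + pi * (\<Sum>m\<in>I. X m x \<bullet> X m x)) + ((- 2 * pi) *\<^sub>R (\<Sum>m\<in>I. X m x)) \<bullet> v
      + pi * real (card I) * (v \<bullet> v)" for v
  proof -
    have "(X m x - v) \<bullet> (X m x - v) = X m x \<bullet> X m x - 2 * (X m x \<bullet> v) + v \<bullet> v" for m
      by (simp add: inner_diff_left inner_diff_right inner_commute)
    then show ?thesis
      by (simp add: s_def power2_norm_eq_inner sum.distrib sum_subtractf inner_sum_left
          algebra_simps flip: sum_distrib_left)
  qed
  then have "(\<lambda>v. s v x) = (\<lambda>v. (c + pi * (\<Sum>m\<in>I. X m x \<bullet> X m x)) + ((- 2 * pi) *\<^sub>R (\<Sum>m\<in>I. X m x)) \<bullet> v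
      + pi * real (card I) * (v \<bullet> v))"
    by blast
  then show ?thesis
    by (simp only:) (rule smooth_on_add[OF open_UNIV smooth_on_add[OF open_UNIV smooth_on_const[OF open_UNIV]
          smooth_on_bounded_linear[OF open_UNIV bounded_linear_inner_right]]
        smooth_on_mult[OF open_UNIV smooth_on_const[OF open_UNIV]
          smooth_on_inner[OF open_UNIV smooth_on_ident[OF open_UNIV] smooth_on_ident[OF open_UNIV]]]])
qed

lemma smooth_on_y: "smooth_on UNIV (\<lambda>v. y v x)"
proof -
  have "(\<lambda>v. y v x) = (\<lambda>v. real (card I) *\<^sub>R v + - (\<Sum>m\<in>I. X m x))"
    by (simp add: y_def sum_subtractf sum_constant_scaleR fun_eq_iff)
  then show ?thesis
    by (simp only:) (intro smooth_on_add smooth_on_const smooth_on_bounded_linear bounded_linear_scaleR_right open_UNIV)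
qed

lemma smooth_on_F: "x \<in> space L \<Longrightarrow> smooth_on UNIV (\<lambda>v. F v x)"
  unfolding F_def
  by simp (intro smooth_on_mult smooth_on_const smooth_on_powr smooth_on_s s_pos open_UNIV)

lemma smooth_on_D: "smooth_on UNIV b \<Longrightarrow> smooth_on UNIV (\<lambda>v. D v x (b v))"
  unfolding D_def
  by (intro smooth_on_mult smooth_on_const smooth_on_powr smooth_on_s smooth_on_y smooth_on_inner s_pos open_UNIV)

lemma s_translate: "x \<in> space L \<Longrightarrow> s (v + w) (\<tau> w x) = s v x"
  by (simp add: s_def X_translate)

lemma y_translate: "x \<in> space L \<Longrightarrow> y (v + w) (\<tau> w x) = y v x"
  by (simp add: y_def X_translate)

lemma translate_space: "x \<in> space L \<Longrightarrow> \<tau> w x \<in> space L"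
  using measurable_space[OF measurable_translate] .

lemma F_translate: "x \<in> space L \<Longrightarrow> F (v + w) (\<tau> w x) = F v x"
  by (simp add: F_def s_translate translate_space)

lemma F_pos: "x \<in> space L \<Longrightarrow> F v x > 0"
  using pos s_pos[of v x] by (simp add: F_def)

section \<open>Total mass, integrability and vanishing means of the derivatives\<close>

lemma nn_integral_F: "(\<integral>\<^sup>+x. ennreal (F v x) \<partial>L) = 1"
proof -
  have "(\<integral>\<^sup>+x. ennreal (F v x) \<partial>L) = (\<integral>\<^sup>+x. ennreal (F v x) \<partial>distr L L (\<tau> v))"
    by (simp add: distr_translate)
  also have "\<dots> = (\<integral>\<^sup>+x. ennreal (F v (\<tau> v x)) \<partial>L)"
    by (intro nn_integral_distr measurable_translate) measurable
  also have "\<dots> = (\<integral>\<^sup>+x. ennreal (K * s 0 x powr (- E)) \<partial>L)"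
    using F_translate[of _ 0 v] by (intro nn_integral_cong) (simp add: F_def)
  also have "\<dots> = 1"
    using mass_one by (simp add: s_def)
  finally show ?thesis .
qed

lemma has_bochner_integral_F: "has_bochner_integral L (F v) 1"
  using F_pos by (intro has_bochner_integral_nn_integral) (auto simp: nn_integral_F less_imp_le)

text \<open>A rescaled density. Multiples of it dominate all the derivatives below.\<close>

lemma integrable_s_powr: "integrable L (\<lambda>x. s v x powr (- E))"
proof -
  have "integrable L (\<lambda>x. (1 / K) * F v x)"
    using has_bochner_integral_F by (intro integrable_mult_right) (auto simp: has_bochner_integral_iff)
  then show ?thesis
    by (rule Bochner_Integration.integrable_cong[THEN iffD1, rotated 2]) (use pos in \<open>auto simp: F_def\<close>)
qed

text \<open>Each derivative costs one power of \<open>s\<close> and gains at most one factor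
  \<open>y\<close>. Since \<open>y\<close> grows no faster than \<open>s\<close>, the balance never
  exceeds \<open>s powr (- E)\<close>.\<close>

lemma norm_y_le: "norm (y v x) \<le> (real (card I) / c + 1 / pi) * s v x"
proof -
  have "norm (y v x) \<le> (\<Sum>m\<in>I. 1 + (norm (X m x - v))\<^sup>2)"
  proof (unfold y_def, rule sum_norm_le)
    fix m
    have "0 \<le> (1 - norm (v - X m x))\<^sup>2"
      by simp
    then have "2 * norm (v - X m x) \<le> 1 + (norm (v - X m x))\<^sup>2"
      by (simp add: power2_diff)
    moreover have "0 \<le> norm (v - X m x)"
      by simp
    ultimately have "norm (v - X m x) \<le> 1 + (norm (v - X m x))\<^sup>2"
      by linarith
    then show "norm (v - X m x) \<le> 1 + (norm (X m x - v))\<^sup>2"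
      by (simp add: norm_minus_commute)
  qed
  also have "\<dots> = real (card I) + (s v x - c) / pi"
    by (simp add: s_def sum.distrib)
  also have "real (card I) \<le> real (card I) / c * s v x"
    using mult_left_mono[OF s_ge[of v x], of "real (card I)"] pos by (simp add: field_simps)
  also have "(s v x - c) / pi \<le> 1 / pi * s v x"
    using pos by (simp add: field_simps)
  finally show ?thesis by (simp add: algebra_simps)
qed

lemma inner_y_le: "\<bar>y v x \<bullet> a\<bar> \<le> (real (card I) / c + 1 / pi) * s v x * norm a"
  using norm_y_le[of v x] Cauchy_Schwarz_ineq2[of "y v x" a]
  by (meson mult_right_mono norm_ge_zero order_trans)

lemma s_powr_diff: "s v x powr (- E - 1) * s v x = s v x powr (- E)"
    "s v x powr (- E - 2) * (s v x * s v x) = s v x powr (- E)"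
  using s_pos[of v x] by (simp_all add: powr_diff power2_eq_square)

lemma integrable_D: "integrable L (\<lambda>x. D v x a)"
proof (rule Bochner_Integration.integrable_bound)
  let ?\<kappa> = "real (card I) / c + 1 / pi"
  show "integrable L (\<lambda>x. (2 * pi * K * E * ?\<kappa> * norm a) * s v x powr (- E))"
    by (intro integrable_mult_right integrable_s_powr)
  have "\<bar>s v x powr (- E - 1) * (y v x \<bullet> a)\<bar> \<le> ?\<kappa> * norm a * s v x powr (- E)" for x
  proof -
    have "\<bar>s v x powr (- E - 1) * (y v x \<bullet> a)\<bar> \<le> s v x powr (- E - 1) * (?\<kappa> * s v x * norm a)"
      by (simp add: abs_mult mult_left_mono inner_y_le)
    also have "\<dots> = ?\<kappa> * norm a * (s v x powr (- E - 1) * s v x)"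
      by (simp only: mult_ac)
    finally show ?thesis by (simp only: s_powr_diff)
  qed
  then have "norm (D v x a) \<le> (2 * pi * K * E) * (?\<kappa> * norm a * s v x powr (- E))" for x
    unfolding D_def real_norm_def abs_mult[of "- (2 * pi * K * E)"] using pos by (intro mult_mono) auto
  then have "norm (D v x a) \<le> (2 * pi * K * E * ?\<kappa> * norm a) * s v x powr (- E)" for x
    by (simp only: mult.assoc)
  then show "AE x in L. norm (D v x a) \<le> norm ((2 * pi * K * E * ?\<kappa> * norm a) * s v x powr (- E))"
    by (intro AE_I2) (metis abs_ge_self order_trans real_norm_def)
qed measurable

lemma integrable_D2: "integrable L (\<lambda>x. D2 v x a b)"
proof -
  let ?\<kappa> = "real (card I) / c + 1 / pi"
  have 1: "integrable L (\<lambda>x. s v x powr (- E - 2) * (y v x \<bullet> a) * (y v x \<bullet> b))"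
  proof (rule Bochner_Integration.integrable_bound)
    show "integrable L (\<lambda>x. (?\<kappa>\<^sup>2 * norm a * norm b) * s v x powr (- E))"
      by (intro integrable_mult_right integrable_s_powr)
    have "\<bar>s v x powr (- E - 2) * (y v x \<bullet> a) * (y v x \<bullet> b)\<bar> \<le> ?\<kappa>\<^sup>2 * norm a * norm b * s v x powr (- E)" for x
    proof -
      have "\<bar>s v x powr (- E - 2) * (y v x \<bullet> a) * (y v x \<bullet> b)\<bar>
          \<le> s v x powr (- E - 2) * ((?\<kappa> * s v x * norm a) * (?\<kappa> * s v x * norm b))"
        unfolding abs_mult mult.assoc[of _ "\<bar>y v x \<bullet> a\<bar>"] abs_of_nonneg[OF powr_ge_zero]
        using inner_y_le[of v x] s_pos[of v x] pos
        by (intro mult_left_mono mult_mono) auto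
      also have "\<dots> = ?\<kappa>\<^sup>2 * norm a * norm b * (s v x powr (- E - 2) * (s v x * s v x))"
        by (simp only: power2_eq_square mult_ac)
      finally show ?thesis by (simp only: s_powr_diff)
    qed
    then show "AE x in L. norm (s v x powr (- E - 2) * (y v x \<bullet> a) * (y v x \<bullet> b))
        \<le> norm ((?\<kappa>\<^sup>2 * norm a * norm b) * s v x powr (- E))"
      by (intro AE_I2) (auto intro: order_trans)
  qed measurable
  \<comment> \<open>The part of the Hessian without \<open>y\<close>: the surplus negative power of
    \<open>s\<close> costs only a factor 1 / c, as \<open>s\<close> is at least
    \<open>c\<close>.\<close>
  have 2: "integrable L (\<lambda>x. s v x powr (- E - 1))"
  proof (rule Bochner_Integration.integrable_bound)
    show "integrable L (\<lambda>x. (1 / c) * s v x powr (- E))"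
      by (intro integrable_mult_right integrable_s_powr)
    show "AE x in L. norm (s v x powr (- E - 1)) \<le> norm (1 / c * s v x powr (- E))"
    proof (rule AE_I2)
      fix x
      have "s v x powr (- E) / s v x \<le> s v x powr (- E) / c"
        using s_ge[of v x] pos by (intro divide_left_mono) (auto intro: mult_pos_pos s_pos)
      then show "norm (s v x powr (- E - 1)) \<le> norm (1 / c * s v x powr (- E))"
        using s_pos[of v x] pos by (simp add: powr_diff)
    qed
  qed measurable
  have "integrable L (\<lambda>x. - (2 * pi * K * E) * (2 * pi * (- E - 1) * (s v x powr (- E - 2) * (y v x \<bullet> a) * (y v x \<bullet> b))
      + (real (card I) * (a \<bullet> b)) * s v x powr (- E - 1)))"
    by (intro integrable_mult_right Bochner_Integration.integrable_add 1 2)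
  then show ?thesis
    unfolding D2_def by (simp only: mult_ac)
qed

lemma line_has_real_derivative:
  assumes "\<And>u. (f has_derivative f' u) (at u)"
  shows "((\<lambda>t. f (v + t *\<^sub>R a)) has_real_derivative f' (v + t *\<^sub>R a) a) (at t)"
proof -
  have "((\<lambda>t. v + t *\<^sub>R a) has_derivative (\<lambda>h. h *\<^sub>R a)) (at t)"
    by (auto intro!: derivative_eq_intros)
  from has_derivative_compose[OF this assms]
  have "((\<lambda>t. f (v + t *\<^sub>R a)) has_derivative (\<lambda>h. f' (v + t *\<^sub>R a) (h *\<^sub>R a))) (at t)" .
  moreover have "(\<lambda>h. f' (v + t *\<^sub>R a) (h *\<^sub>R a)) = (*) (f' (v + t *\<^sub>R a) a)"
    by (simp add: fun_eq_iff linear_cmul[OF has_derivative_linear[OF assms]] mult.commute)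
  ultimately show ?thesis by (simp add: has_field_derivative_def)
qed

lemma line_isCont:
  assumes "smooth_on UNIV (f :: 'e \<Rightarrow> real)"
  shows "isCont (\<lambda>t. f (v + t *\<^sub>R a)) t"
proof -
  have "continuous_on UNIV f"
    using assms Ck_on.simps(1) unfolding smooth_on_def by blast
  then have "isCont f (v + t *\<^sub>R a)"
    by (simp add: continuous_on_eq_continuous_at)
  then show ?thesis
    by (rule isCont_o2[rotated]) (intro continuous_intros)
qed

lemma smooth_on_D2: "smooth_on UNIV (\<lambda>v. D2 v x a b)"
  unfolding D2_def
  by (intro smooth_on_add smooth_on_mult smooth_on_const smooth_on_powr smooth_on_s smooth_on_y
      smooth_on_inner s_pos open_UNIV)

text \<open>Moving the parameter and the sample point by the same vector leaves \<open>F\<close> and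
  \<open>D\<close> unchanged; this is the invariance that \<open>integral_derivative_eq_0\<close>
  asks for.\<close>

lemma integral_D: "(LINT x|L. D v x a) = 0"
proof -
  \<comment> \<open>The summand \<open>0 *\<^sub>R a\<close> brings the integrand into the shape
    \<open>H 0\<close>.\<close>
  have "(LINT x|L. D (v + 0 *\<^sub>R a) x a) = 0"
  proof (rule integral_derivative_eq_0[where G = "\<lambda>t x. F (v + t *\<^sub>R a) x" and \<tau> = "\<lambda>t. \<tau> (t *\<^sub>R a)"])
    show "((\<lambda>t. F (v + t *\<^sub>R a) x) has_real_derivative D (v + t *\<^sub>R a) x a) (at t)" if "x \<in> space L" for t x
      by (intro line_has_real_derivative F_has_derivative that)
    show "isCont (\<lambda>t. D (v + t *\<^sub>R a) x a) t" for t x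
      by (intro line_isCont smooth_on_D smooth_on_const open_UNIV)
    show "(\<lambda>(t, x). D (v + t *\<^sub>R a) x a) \<in> borel_measurable (lborel \<Otimes>\<^sub>M L)"
      unfolding D_def split_beta' by measurable
  qed (use F_translate[of _ v] s_translate[of _ v] y_translate[of _ v] integrable_D[of v] has_bochner_integral_F in
      \<open>auto simp: D_def has_bochner_integral_iff measurable_translate distr_translate
        sigma_finite_measure_axioms\<close>)
  then show ?thesis by simp
qed

text \<open>The same argument one order higher, with \<open>D\<close> in the place of
  \<open>F\<close>.\<close>

lemma integral_D2: "(LINT x|L. D2 v x a b) = 0"
proof -
  have "(LINT x|L. D2 (v + 0 *\<^sub>R a) x a b) = 0"
  proof (rule integral_derivative_eq_0[where G = "\<lambda>t x. D (v + t *\<^sub>R a) x b" and \<tau> = "\<lambda>t. \<tau> (t *\<^sub>R a)"])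
    show "((\<lambda>t. D (v + t *\<^sub>R a) x b) has_real_derivative D2 (v + t *\<^sub>R a) x a b) (at t)" for t x
    proof (rule line_has_real_derivative)
      fix u
      have "D u x 0 = 0"
        by (simp add: D_def)
      then show "((\<lambda>v. D v x b) has_derivative (\<lambda>a. D2 u x a b)) (at u)"
        using D_has_derivative[OF has_derivative_const[of b "at u"], of x] by simp
    qed
    show "isCont (\<lambda>t. D2 (v + t *\<^sub>R a) x a b) t" for t x
      by (intro line_isCont smooth_on_D2)
    show "(\<lambda>(t, x). D2 (v + t *\<^sub>R a) x a b) \<in> borel_measurable (lborel \<Otimes>\<^sub>M L)"
      unfolding D2_def split_beta' by measurable
  qed (use s_translate[of _ v] y_translate[of _ v] integrable_D[of v b] integrable_D2[of v a b] in
      \<open>auto simp: D_def D2_def measurable_translate distr_translate sigma_finite_measure_axioms\<close>)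
  then show ?thesis by simp
qed

end

section \<open>Topology, nondegeneracy and the axioms of a statistical model\<close>

context location_family
begin

text \<open>At a diagonal point \<open>s\<close> depends on the distance of the parameters only.
  Such points give injectivity, the topology and the nondegeneracy of the scores.\<close>

lemma s_diagonal:
  obtains x where "x \<in> space L" "\<And>w. s w x = c + pi * (real (card I) * (norm (v - w))\<^sup>2)"
    "\<And>w. y w x = real (card I) *\<^sub>R (w - v)"
proof -
  obtain x where x: "x \<in> space L" "\<And>m. m \<in> I \<Longrightarrow> X m x = v"
    using diagonal[of v] by blast
  have "s w x = c + pi * (real (card I) * (norm (v - w))\<^sup>2)" for w
    using x(2) by (simp add: s_def)
  moreover have "y w x = real (card I) *\<^sub>R (w - v)" for w
    using x(2) by (simp add: y_def sum_constant_scaleR)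
  ultimately show ?thesis
    using that x(1) by blast
qed

lemma card_I_pos: "real (card I) > 0"
  using finite_I by (simp add: card_gt_0_iff)

lemma F_less_iff:
  assumes "x \<in> space L"
  shows "F v x < F w x \<longleftrightarrow> s w x < s v x"
proof -
  have "F v x < F w x \<longleftrightarrow> s v x powr (- E) < s w x powr (- E)"
    using assms pos by (simp add: F_def)
  also have "\<dots> \<longleftrightarrow> s w x < s v x"
    using s_pos[of v x] s_pos[of w x] pos
    by (metis less_le_not_le linorder_not_less neg_less_0_iff_less powr_less_mono2_neg powr_mono2')
  finally show ?thesis .
qed

text \<open>At the diagonal point of \<open>v\<close>, the parameter \<open>v\<close> is the only
  minimizer of \<open>s\<close>.\<close>

lemma inj_F: "inj F"
proof (rule injI)
  fix v w assume eq: "F v = F w"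
  obtain x where x: "x \<in> space L" "\<And>w. s w x = c + pi * (real (card I) * (norm (v - w))\<^sup>2)"
    using s_diagonal[of v] by metis
  have "\<not> s v x < s w x"
    using F_less_iff[OF x(1), of w v] eq by simp
  then have "(norm (v - w))\<^sup>2 \<le> 0"
    using card_I_pos pi_gt_zero by (simp add: x(2) not_less mult_le_0_iff del: pi_gt_zero)
  then show "v = w" by simp
qed

lemma ev_comp_F: "ev x \<circ> F = (\<lambda>v. F v x)"
  by (simp add: ev_def comp_def)

lemma F_in_prob_densities: "F v \<in> prob_densities L"
proof -
  have "integrable (completion L) (F v)" "integral\<^sup>L (completion L) (F v) = 1"
    using has_bochner_integral_F[of v]
    by (simp_all add: has_bochner_integral_iff integrable_completion integral_completion)
  moreover have "(LINT x|completion L. \<bar>F v x\<bar>) = integral\<^sup>L (completion L) (F v)"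
    by (rule Bochner_Integration.integral_cong[OF refl]) (simp add: less_imp_le F_pos)
  moreover have "F v \<in> extensional (space L)"
    by (simp add: F_def)
  moreover have "AE x in completion L. F v x > 0"
    by (rule AE_I2) (simp add: F_pos)
  ultimately show ?thesis
    by (simp add: prob_densities_def)
qed

abbreviation manifold :: "('x \<Rightarrow> real) topology" where
  "manifold \<equiv> pullback_topology (range F) (inv F) euclidean"

lemma manifold_eq_generated:
  "manifold = topology_generated_by {{p \<in> range F. ev x p \<in> G} | x G. x \<in> space L \<and> open G}"
  (is "_ = topology_generated_by ?S")
proof (rule topology_eq[THEN iffD2], intro allI iffI)
  fix U assume "openin manifold U"
  then obtain T where T: "open T" "U = inv F -` T \<inter> range F"
    by (auto simp: openin_pullback_topology)
  have "\<exists>V. openin (topology_generated_by ?S) V \<and> p \<in> V \<and> V \<subseteq> U" if "p \<in> U" for p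
  proof -
    obtain v where v: "p = F v" "v \<in> T"
      using \<open>p \<in> U\<close> T(2) inj_F by auto
    then obtain r where r: "r > 0" "\<And>w. dist v w < r \<Longrightarrow> w \<in> T"
      using T(1) by (metis open_dist dist_commute)
    obtain x where x: "x \<in> space L" "\<And>w. s w x = c + pi * (real (card I) * (norm (v - w))\<^sup>2)"
      using s_diagonal[of v] by metis
    \<comment> \<open>The density at the diagonal point of \<open>v\<close> for any parameter at
      distance \<open>r\<close> from \<open>v\<close>.\<close>
    define \<rho> where "\<rho> = K * (c + pi * (real (card I) * r\<^sup>2)) powr (- E)"
    have iff: "\<rho> < F w x \<longleftrightarrow> norm (v - w) < r" for w
    proof -
      \<comment> \<open>A unit vector realizes \<open>\<rho>\<close> as the value for the parameter
        \<open>v + r *\<^sub>R b\<close>, so that \<open>F_less_iff\<close> applies.\<close>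
      obtain b :: 'e where b: "b \<in> Basis"
        using nonempty_Basis by blast
      have "F (v + r *\<^sub>R b) x = \<rho>"
        using x r(1) b by (simp add: F_def \<rho>_def)
      then have "\<rho> < F w x \<longleftrightarrow> s w x < s (v + r *\<^sub>R b) x"
        using F_less_iff[OF x(1)] by metis
      also have "\<dots> \<longleftrightarrow> norm (v - w) < r"
        using r(1) b card_I_pos by (auto simp: x(2) power_strict_mono intro: power2_less_imp_less)
      finally show ?thesis .
    qed
    let ?V = "{p \<in> range F. ev x p \<in> {\<rho><..}}"
    have "openin (topology_generated_by ?S) ?V"
      using x(1) by (intro topology_generated_by_Basis) (auto intro!: exI[of _ x] exI[of _ "{\<rho><..}"])
    moreover have "p \<in> ?V"
      using iff[of v] r(1) by (simp add: v(1) ev_def)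
    moreover have "?V \<subseteq> U"
      using iff r(2) inj_F by (auto simp: T(2) ev_def dist_norm)
    ultimately show ?thesis by blast
  qed
  then show "openin (topology_generated_by ?S) U"
    by (subst openin_subopen) blast
next
  fix U assume "openin (topology_generated_by ?S) U"
  then have "generate_topology_on ?S U"
    by (rule openin_topology_generated_by)
  then show "openin manifold U"
  proof (rule generate_topology_on_coarsest[OF istopology_openin, rotated])
    fix V assume "V \<in> ?S"
    then obtain x G where xG: "x \<in> space L" "open G" "V = {p \<in> range F. ev x p \<in> G}"
      by blast
    have "continuous_on UNIV (\<lambda>v. F v x)"
      using smooth_on_F[OF xG(1)] Ck_on.simps(1) unfolding smooth_on_def by blast
    then have "open ((\<lambda>v. F v x) -` G)"
      using xG(2) by (simp add: continuous_on_open_vimage)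
    moreover have "V = inv F -` ((\<lambda>v. F v x) -` G) \<inter> range F"
      using xG(3) inj_F by (auto simp: ev_def)
    ultimately show "openin manifold V"
      unfolding openin_pullback_topology by auto
  qed
qed

theorem statistical_model_F: "statistical_model L manifold {(range F, inv F)}"
proof -
  note [simp] = topspace_global[OF inj_F] image_inv_range[OF inj_F] inv_into_inv[OF inj_F]
    C_inf_global[OF inj_F]
  let ?XV = "vector_fields manifold {(range F, inv F)}"
  have first: "V (ev x) (F v) = D v x (a v)"
    if "x \<in> space L" "\<And>f v. smooth_on UNIV (f \<circ> F) \<Longrightarrow> V f (F v) = frechet_derivative (f \<circ> F) (at v) (a v)"
    for V x v and a :: "'e \<Rightarrow> 'e"
    using that(2)[of "ev x" v, unfolded ev_comp_F, OF smooth_on_F[OF that(1)]]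
    unfolding frechet_derivative_at[OF F_has_derivative[OF that(1)], symmetric] .
  have smooth: "\<forall>x\<in>space L. ev x \<in> C_inf {(range F, inv F)} (topspace manifold)"
    by (simp add: ev_comp_F smooth_on_F)
  have measurable: "(\<lambda>x. dir_deriv vs (ev x \<circ> F) v) \<in> borel_measurable L" for vs v
    unfolding ev_comp_F by (intro borel_measurable_dir_deriv smooth_on_F measurable_F)
  have nondegenerate: "(\<forall>x\<in>space L. V (ev x) p = 0) \<longleftrightarrow> (\<forall>f\<in>C_inf {(range F, inv F)} (topspace manifold). V f p = 0)"
    if V: "V \<in> ?XV" and p: "p \<in> range F" for V p
  proof
    assume zero: "\<forall>x\<in>space L. V (ev x) p = 0"
    obtain v where v: "p = F v"
      using p by blast
    obtain a where a: "\<And>f v. smooth_on UNIV (f \<circ> F) \<Longrightarrow> V f (F v) = frechet_derivative (f \<circ> F) (at v) (a v)"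
      using vector_fields_globalD[OF inj_F V] by metis
    \<comment> \<open>The diagonal point is displaced from \<open>v\<close> by the tested direction
      itself. There \<open>y\<close> is a positive multiple of \<open>a v\<close>, and the
      derivative is a nonzero multiple of the squared norm of \<open>a v\<close>.\<close>
    obtain x where x: "x \<in> space L" "y v x = real (card I) *\<^sub>R (v - (v - a v))"
      using s_diagonal[of "v - a v"] by metis
    have "D v x (a v) = 0"
      using bspec[OF zero x(1)] first[OF x(1) a, of v] unfolding v by (rule trans[OF sym, rotated])
    then have "a v = 0"
      using pos card_I_pos s_pos[of v x] by (simp add: D_def x(2))
    have "V f (F v) = 0" if "smooth_on UNIV (f \<circ> F)" for f
      using a[OF that, of v] linear_0[OF has_derivative_linear[OF smooth_on_has_derivative[OF that UNIV_I]]]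
      by (simp add: \<open>a v = 0\<close>)
    then show "\<forall>f\<in>C_inf {(range F, inv F)} (topspace manifold). V f p = 0"
      by (simp add: v)
  qed (use smooth in blast)
  have scores: "integrable L (\<lambda>x. V (ev x) p) \<and> (LINT x|L. V (ev x) p) = 0 \<and>
      integrable L (\<lambda>x. V (W (ev x)) p) \<and> (LINT x|L. V (W (ev x)) p) = 0"
    if V: "V \<in> ?XV" and W: "W \<in> ?XV" and p: "p \<in> range F" for V W p
  proof -
    obtain v where v: "p = F v"
      using p by blast
    obtain a where a: "\<And>f v. smooth_on UNIV (f \<circ> F) \<Longrightarrow> V f (F v) = frechet_derivative (f \<circ> F) (at v) (a v)"
      using vector_fields_globalD[OF inj_F V] by metis
    obtain b where b: "smooth_on UNIV b"
      "\<And>f v. smooth_on UNIV (f \<circ> F) \<Longrightarrow> W f (F v) = frechet_derivative (f \<circ> F) (at v) (b v)"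
      using vector_fields_globalD[OF inj_F W] by metis
    define b' where "b' = frechet_derivative b (at v)"
    have b': "(b has_derivative b') (at v)"
      unfolding b'_def by (rule smooth_on_has_derivative[OF b(1) UNIV_I])
    have second: "V (W (ev x)) p = D2 v x (a v) (b v) + D v x (b' (a v))" if "x \<in> space L" for x
    proof -
      \<comment> \<open>\<open>V\<close> sees \<open>W (ev x)\<close> only through its pullback
        along \<open>F\<close>, which is the explicit derivative in the moving direction
        \<open>b v\<close>.\<close>
      have *: "W (ev x) \<circ> F = (\<lambda>v. D v x (b v))"
        using first[OF that b(2)] by (simp add: fun_eq_iff)
      show ?thesis
        using a[of "W (ev x)" v, unfolded *, OF smooth_on_D[OF b(1)]]
        unfolding v frechet_derivative_at[OF D_has_derivative[OF b'], symmetric] .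
    qed
    have first': "V (ev x) p = D v x (a v)" if "x \<in> space L" for x
      unfolding v by (rule first[OF that a])
    have "integrable L (\<lambda>x. V (ev x) p)" "(LINT x|L. V (ev x) p) = 0"
      by (simp_all add: integrable_D integral_D first'
          cong: Bochner_Integration.integrable_cong Bochner_Integration.integral_cong)
    moreover have "integrable L (\<lambda>x. V (W (ev x)) p)" "(LINT x|L. V (W (ev x)) p) = 0"
      by (simp_all add: integrable_D integrable_D2 integral_D integral_D2 second
          cong: Bochner_Integration.integrable_cong Bochner_Integration.integral_cong)
    ultimately show ?thesis by blast
  qed
  have set_integral: "set_integrable (completion L) (space L) f" "(LINT x:space L|completion L. f x) = integral\<^sup>L L f"
    if "integrable L f" for f :: "'x \<Rightarrow> real"
  proof -
    have *: "indicat_real (space L) x *\<^sub>R f x = f x" if "x \<in> space (completion L)" for x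
      using that by simp
    have f: "f \<in> borel_measurable L"
      using that by simp
    show "set_integrable (completion L) (space L) f"
      unfolding set_integrable_def
      using that f by (subst Bochner_Integration.integrable_cong[OF refl *]) (simp_all add: integrable_completion)
    show "(LINT x:space L|completion L. f x) = integral\<^sup>L L f"
      unfolding set_lebesgue_integral_def
      using f by (subst Bochner_Integration.integral_cong[OF refl *]) (simp_all add: integral_completion)
  qed
  show ?thesis
    unfolding statistical_model_def
  \<comment> \<open>The densities are smooth in the parameter at every sample point, so the
    exceptional set is empty.\<close>
  proof (intro conjI bexI[of _ "{}"])
    show "smooth_manifold manifold {(range F, inv F)}"
      by (rule smooth_manifold_global[OF inj_F])
    show "topspace manifold \<subseteq> prob_densities L"
      using F_in_prob_densities by auto
    show "manifold = topology_generated_by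
        {{p \<in> topspace manifold. ev x p \<in> G} | x G. x \<in> space L - {} \<and> open G}"
      unfolding Diff_empty topspace_global[OF inj_F] by (rule manifold_eq_generated)
    show "\<forall>x\<in>space L - {}. ev x \<in> C_inf {(range F, inv F)} (topspace manifold)"
      using smooth by simp
    show "\<forall>(U, \<phi>)\<in>{(range F, inv F)}. \<forall>p\<in>U. \<forall>vs.
        (\<lambda>x. dir_deriv vs (ev x \<circ> inv_into U \<phi>) (\<phi> p)) \<in> borel_measurable (restrict_space L (space L - {}))"
      using measurable by (simp add: measurable_restrict_space1)
    show "\<forall>V\<in>?XV. \<forall>p\<in>topspace manifold. (\<forall>x\<in>space L - {}. V (ev x) p = 0) \<longleftrightarrow>
        (\<forall>f\<in>C_inf {(range F, inv F)} (topspace manifold). V f p = 0)"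
      using nondegenerate unfolding Diff_empty topspace_global[OF inj_F] by blast
    show "\<forall>V\<in>?XV. \<forall>W\<in>?XV. \<forall>p\<in>topspace manifold.
        set_integrable (completion L) (space L - {}) (\<lambda>x. V (ev x) p) \<and>
        (LINT x:space L - {}|completion L. V (ev x) p) = 0 \<and>
        set_integrable (completion L) (space L - {}) (\<lambda>x. V (W (ev x)) p) \<and>
        (LINT x:space L - {}|completion L. V (W (ev x)) p) = 0"
      unfolding Diff_empty topspace_global[OF inj_F] by (intro ballI conjI) (simp_all only: scores set_integral)
    show "{} \<in> null_sets (completion L)"
      by simp
  qed
qed

end

section \<open>The two instances\<close>

text \<open>Preimages of boxes are boxes, and a product measure is determined by its values on
  boxes. It serves both the translation of all components and the reflection of a single
  one.\<close>

lemma distr_PiM_componentwise: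
  assumes "finite I" "product_sigma_finite M"
    and T: "\<And>i. i \<in> I \<Longrightarrow> T i \<in> measurable (M i) (M i)" "\<And>i. i \<in> I \<Longrightarrow> distr (M i) (M i) (T i) = M i"
  shows "(\<lambda>x. \<lambda>i\<in>I. T i (x i)) \<in> measurable (PiM I M) (PiM I M)"
    and "distr (PiM I M) (PiM I M) (\<lambda>x. \<lambda>i\<in>I. T i (x i)) = PiM I M"
proof -
  interpret product_sigma_finite M by fact
  show meas: "(\<lambda>x. \<lambda>i\<in>I. T i (x i)) \<in> measurable (PiM I M) (PiM I M)"
    by (intro measurable_restrict) (rule measurable_compose[OF measurable_component_singleton], simp_all add: T(1))
  show "distr (PiM I M) (PiM I M) (\<lambda>x. \<lambda>i\<in>I. T i (x i)) = PiM I M"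
  proof (rule PiM_eqI[OF assms(1)])
    fix A assume A: "\<And>i. i \<in> I \<Longrightarrow> A i \<in> sets (M i)"
    have vimage: "(\<lambda>x. \<lambda>i\<in>I. T i (x i)) -` Pi\<^sub>E I A \<inter> space (PiM I M)
        = Pi\<^sub>E I (\<lambda>i. T i -` A i \<inter> space (M i))"
      by (auto simp: space_PiM PiE_iff)
    have "emeasure (M i) (T i -` A i \<inter> space (M i)) = emeasure (M i) (A i)" if "i \<in> I" for i
      using T[OF that] A[OF that] by (metis emeasure_distr)
    then show "emeasure (distr (PiM I M) (PiM I M) (\<lambda>x. \<lambda>i\<in>I. T i (x i))) (Pi\<^sub>E I A)
        = (\<Prod>i\<in>I. emeasure (M i) (A i))"
      using A T(1) meas assms(1)
      by (subst emeasure_distr) (auto simp: vimage emeasure_PiM intro!: sets_PiM_I_finite measurable_sets)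
  qed simp
qed

lemma distr_lborel_translate: "distr lborel lborel (\<lambda>x. x + w) = (lborel :: 'a::euclidean_space measure)"
proof -
  have "distr lborel lborel (\<lambda>x. x + w) = distr lborel borel ((+) w)"
    by (rule distr_cong) (auto simp: add.commute)
  then show ?thesis
    using lborel_distr_plus[of w] by simp
qed

text \<open>An affine map with factor -1, whose Jacobian has absolute value one.\<close>

lemma distr_lborel_reflect: "distr lborel lborel (\<lambda>x. 2 *\<^sub>R v - x) = (lborel :: 'a::euclidean_space measure)"
proof -
  have "lborel = density (distr lborel borel (\<lambda>x :: 'a. 2 *\<^sub>R v + (- 1) *\<^sub>R x)) (\<lambda>_. \<bar>- 1 :: real\<bar> ^ DIM('a))"
    by (rule lborel_affine) simp
  then have "lborel = distr lborel borel (\<lambda>x :: 'a. 2 *\<^sub>R v - x)"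
    by (simp add: density_1)
  also have "\<dots> = distr lborel lborel (\<lambda>x. 2 *\<^sub>R v - x)"
    by (rule distr_cong) auto
  finally show ?thesis ..
qed

lemma product_sigma_finite_lborel: "product_sigma_finite (\<lambda>i. lborel :: 'a::euclidean_space measure)"
  by standard

lemma sigma_finite_leb_pow: "sigma_finite_measure (leb_pow k :: (nat \<Rightarrow> real^'d) measure)"
proof -
  interpret product_sigma_finite "\<lambda>i. lborel :: (real^'d) measure" by (rule product_sigma_finite_lborel)
  show ?thesis
    unfolding leb_pow_def by (rule sigma_finite) simp
qed

lemma measurable_leb_pow_component:
  "m \<in> {1..k} \<Longrightarrow> (\<lambda>x. x m) \<in> measurable (leb_pow k) borel"
  unfolding leb_pow_def using measurable_component_singleton[of m "{1..k}" "\<lambda>_. lborel"] by simp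

section \<open>The constants of the repetition and of the original densities\<close>

locale repetition_parameters =
  fixes q d :: real
  assumes q: "q > 1" "d * (q - 1) < 2" and d: "d > 0"
begin

abbreviation "A \<equiv> rep_A d q"

lemma A_eq: "A k = 1 / (q - 1) + (real k + 3) * d / 2"
  using q by (simp add: rep_A_def rep_a_def field_simps)

lemma A_pos: "A k > 0" and a_pos: "rep_a d q k > 0"
  using q d by (auto simp: rep_A_def rep_a_def intro!: divide_pos_pos add_pos_nonneg mult_nonneg_nonneg)

lemma A_add: "A (k + k') - real k' * d / 2 = A k"
  by (simp add: A_eq field_simps)

text \<open>The solution of \<open>gker (A 0) C = 1\<close>. Integrating out all k variables lowers
  \<open>A k\<close> to \<open>A 0\<close>, so this one constant normalizes every k.\<close>

definition C :: real where
  "C = Gamma (A 0) powr (1 / A 0)"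

lemma C_pos: "C > 0"
  using Gamma_real_pos[OF A_pos, of 0] by (simp add: C_def)

lemma gker_C: "gker (A 0) C = 1"
proof -
  define g where "g = Gamma (A 0)"
  have "g > 0"
    unfolding g_def by (rule Gamma_real_pos[OF A_pos])
  then show ?thesis
    using A_pos[of 0] by (simp add: gker_def C_def powr_powr powr_minus flip: g_def)
qed

text \<open>This is what the choice of \<open>rep_beta\<close> and \<open>rep_nu\<close> achieves:
  \<open>1 + (1 - q) * u\<close> is \<open>C + pi * S\<close> times the common factor
  \<open>\<Gamma> k powr (- 1 / A k)\<close>. Raising to the power \<open>rep_a\<close> makes the
  total exponent \<open>- A k\<close>, which turns this factor into
  \<open>Gamma (A k)\<close>.\<close>

lemma exp_q_rep:
  assumes "S \<ge> 0"
  shows "exp_q q (- rep_beta d q k * S - rep_nu d q k) \<noteq> \<infinity>"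
    and "real_of_ereal (exp_q q (- rep_beta d q k * S - rep_nu d q k)) powr rep_a d q k
      = gker (A k) (C + pi * S)"
proof -
  define u where "u = - rep_beta d q k * S - rep_nu d q k"
  define \<Gamma> where "\<Gamma> = (\<lambda>k. Gamma (A k))"
  have \<Gamma>: "\<Gamma> k > 0" for k
    by (simp add: \<Gamma>_def Gamma_real_pos A_pos)
  have beta: "(q - 1) * rep_beta d q k = pi * \<Gamma> k powr (- 1 / A k)"
    using q by (simp add: rep_beta_def \<Gamma>_def)
  have "1 + (q - 1) * rep_nu d q k = (\<Gamma> k powr (1 / rep_a d q k) * \<Gamma> 0 powr (- 1 / rep_a d q 0)) powr (1 - q)"
    using q by (simp add: rep_nu_def ln_q_def \<Gamma>_def field_simps)
  also have "\<dots> = \<Gamma> k powr (1 / rep_a d q k * (1 - q)) * \<Gamma> 0 powr (- 1 / rep_a d q 0 * (1 - q))"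
    by (simp add: powr_mult powr_powr)
  also have "1 / rep_a d q k * (1 - q) = - 1 / A k"
    using q by (simp add: rep_A_def)
  also have "- 1 / rep_a d q 0 * (1 - q) = 1 / A 0"
    using q a_pos[of 0] by (simp add: rep_A_def field_simps)
  finally have nu: "1 + (q - 1) * rep_nu d q k = \<Gamma> k powr (- 1 / A k) * C"
    by (simp add: C_def \<Gamma>_def)
  have "1 + (1 - q) * u = (q - 1) * rep_beta d q k * S + (1 + (q - 1) * rep_nu d q k)"
    by (simp add: u_def algebra_simps)
  also have "\<dots> = \<Gamma> k powr (- 1 / A k) * (C + pi * S)"
    unfolding beta nu by (simp add: algebra_simps)
  finally have eq: "1 + (1 - q) * u = \<Gamma> k powr (- 1 / A k) * (C + pi * S)" .
  have pos: "C + pi * S > 0"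
    using C_pos assms by (simp add: add_pos_nonneg)
  then have pos': "1 + (1 - q) * u > 0"
    unfolding eq using \<Gamma>[of k] by (intro mult_pos_pos) auto
  \<comment> \<open>A positive base is the same as an argument below the pole of
    \<open>exp_q\<close>.\<close>
  then have fin: "u < 1 / (q - 1)"
    using q by (simp add: field_simps)
  then have exp: "exp_q q u = ereal ((1 + (1 - q) * u) powr (1 / (1 - q)))"
    by (simp add: exp_q_def)
  show "exp_q q (- rep_beta d q k * S - rep_nu d q k) \<noteq> \<infinity>"
    unfolding u_def[symmetric] exp by simp
  have "real_of_ereal (exp_q q u) powr rep_a d q k = (1 + (1 - q) * u) powr (1 / (1 - q) * rep_a d q k)"
    by (simp add: exp powr_powr)
  also have "1 / (1 - q) * rep_a d q k = - A k"
    using q by (simp add: rep_A_def field_simps)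
  also have "(1 + (1 - q) * u) powr (- A k)
      = \<Gamma> k powr (- 1 / A k * (- A k)) * (C + pi * S) powr (- A k)"
    unfolding eq using pos by (simp add: powr_mult powr_powr)
  also have "\<dots> = gker (A k) (C + pi * S)"
    using A_pos[of k] \<Gamma>[of k] by (simp add: gker_def \<Gamma>_def)
  finally show "real_of_ereal (exp_q q (- rep_beta d q k * S - rep_nu d q k)) powr rep_a d q k
      = gker (A k) (C + pi * S)"
    by (simp only: u_def)
qed

text \<open>With these constants \<open>dens\<close> takes the shape K (c + pi |x - v|^2)^(-B): the
  factor (q - 1) / pi is pulled out of the bracket and goes into \<open>dens_K\<close>.\<close>

definition dens_B :: real where "dens_B = 1 / (q - 1)"
definition dens_l :: real where
  "dens_l = (((q - 1) / pi) powr (d / 2) * Gamma (1 / (q - 1)) / Gamma (1 / (q - 1) - d / 2))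
        powr (2 * (1 - q) / (2 + d * (1 - q)))"
definition dens_K :: real where "dens_K = (pi / (q - 1)) powr dens_B"
definition dens_c :: real where "dens_c = dens_l * (pi / (q - 1))"

text \<open>The hypothesis \<open>d * (q - 1) < 2\<close> in the form needed for integrability of
  the density over the d-dimensional space.\<close>

lemma dens_B_gt: "dens_B > d / 2"
  using q by (simp add: dens_B_def field_simps)

lemma dens_B_pos: "dens_B > 0"
  using q by (simp add: dens_B_def)

lemma Gamma_dens_pos: "Gamma dens_B > 0" "Gamma (dens_B - d / 2) > 0"
  using dens_B_gt dens_B_pos by (auto intro: Gamma_real_pos)

lemma dens_l_pos: "dens_l > 0"
proof -
  have "((q - 1) / pi) powr (d / 2) * Gamma (1 / (q - 1)) / Gamma (1 / (q - 1) - d / 2) > 0"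
    using Gamma_dens_pos q unfolding dens_B_def by (intro divide_pos_pos mult_pos_pos) auto
  then show ?thesis
    unfolding dens_l_def by (simp only: powr_gt_zero)
qed

lemma dens_pos: "dens_K > 0" "dens_c > 0"
  using dens_l_pos q by (auto simp: dens_K_def dens_c_def)

end

text \<open>The \<open>itself\<close> argument carries the index type \<open>'d\<close>, whose
  cardinality is the dimension.\<close>

locale dens_family = repetition_parameters q "real CARD('d)" for q :: real and ty :: "'d::finite itself"
begin

lemma space_leb_pow: "space (leb_pow k) = {1..k} \<rightarrow>\<^sub>E (UNIV :: (real^'d) set)"
  by (simp add: leb_pow_def space_PiM)

lemma dens_rep_eq:
  fixes p :: "(real^'d) \<Rightarrow> real"
  assumes "x \<in> space (leb_pow k)"
  shows "dens_rep q k p x = gker (A k) (C + pi * (\<Sum>m\<in>{1..k}. (norm (x m - coord q p))\<^sup>2))"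
  using assms exp_q_rep(2)[of "\<Sum>m\<in>{1..k}. (norm (x m - coord q p))\<^sup>2"]
  by (simp add: dens_rep_def sum_nonneg Let_def)

lemma dens_eq':
  fixes v x :: "real^'d"
  shows "dens q v x = ((q - 1) * (norm (x - v))\<^sup>2 + dens_l) powr (1 / (1 - q))"
  by (simp only: dens_def dens_l_def Let_def)

lemma dens_eq:
  fixes v x :: "real^'d"
  shows "dens q v x = dens_K * (dens_c + pi * (norm (x - v))\<^sup>2) powr (- dens_B)"
proof -
  define s where "s = dens_c + pi * (norm (x - v))\<^sup>2"
  have s: "s > 0"
    using dens_pos by (simp add: s_def add_pos_nonneg)
  have 1: "(q - 1) * (norm (x - v))\<^sup>2 + dens_l = ((q - 1) / pi) * s"
    using q by (simp add: s_def dens_c_def field_simps)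
  have 2: "1 / (1 - q) = - dens_B"
    using q by (simp add: dens_B_def field_simps)
  have 3: "((q - 1) / pi) powr (- dens_B) = dens_K"
  proof -
    have "(q - 1) / pi = inverse (pi / (q - 1))"
      by simp
    then show ?thesis
      using q by (simp only: powr_minus inverse_powr dens_K_def inverse_inverse_eq)
  qed
  have "((q - 1) / pi * s) powr (- dens_B) = ((q - 1) / pi) powr (- dens_B) * s powr (- dens_B)"
    by (rule powr_mult)
  then show ?thesis
    by (simp only: dens_eq' 1 2 3 s_def)
qed

text \<open>The Gaussian mixture gives the mass in terms of Gamma values and a power of
  \<open>dens_c\<close>; the intricate constant \<open>dens_l\<close> is the one that makes it equal
  to one.\<close>

lemma dens_mass: "(\<integral>\<^sup>+x. ennreal (dens_K * (dens_c + pi * (norm (x :: real^'d))\<^sup>2) powr (- dens_B)) \<partial>lborel) = 1"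
proof -
  let ?d = "real CARD('d)"
  define r where "r = (q - 1) / pi"
  have r: "r > 0"
    using q by (simp add: r_def)
  have "(\<integral>\<^sup>+x. ennreal (dens_K * (dens_c + pi * (norm (x :: real^'d))\<^sup>2) powr (- dens_B)) \<partial>lborel)
      = (\<integral>\<^sup>+x. ennreal (dens_K / Gamma dens_B) * ennreal (gker dens_B (dens_c + pi * (norm ((x :: real^'d) - 0))\<^sup>2)) \<partial>lborel)"
    using Gamma_dens_pos dens_pos by (intro nn_integral_cong) (simp add: gker_def flip: ennreal_mult')
  also have "\<dots> = ennreal (dens_K / Gamma dens_B) * (\<integral>\<^sup>+x. ennreal (gker dens_B (dens_c + pi * (norm ((x :: real^'d) - 0))\<^sup>2)) \<partial>lborel)"
    by (rule nn_integral_cmult) measurable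
  also have "(\<integral>\<^sup>+x. ennreal (gker dens_B (dens_c + pi * (norm ((x :: real^'d) - 0))\<^sup>2)) \<partial>lborel)
      = ennreal (gker (dens_B - ?d / 2) dens_c)"
    using nn_integral_gker[of dens_B dens_c "0 :: real^'d"] dens_B_gt dens_pos by simp
  also have "ennreal (dens_K / Gamma dens_B) * ennreal (gker (dens_B - ?d / 2) dens_c)
      = ennreal (dens_K / Gamma dens_B * gker (dens_B - ?d / 2) dens_c)"
    using Gamma_dens_pos dens_pos by (simp flip: ennreal_mult')
  also have "dens_K / Gamma dens_B * gker (dens_B - ?d / 2) dens_c = 1"
  proof -
    let ?G = "Gamma (dens_B - ?d / 2)"
    \<comment> \<open>The outer exponent in \<open>dens_l\<close> is the reciprocal of
      \<open>- (dens_B - d / 2)\<close>, so the power of \<open>dens_c\<close> left by the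
      integration undoes it.\<close>
    have e: "2 * (1 - q) / (2 + ?d * (1 - q)) * - (dens_B - ?d / 2) = 1"
    proof -
      define z where "z = 2 + ?d * (1 - q)"
      have z: "z > 0"
        using q by (simp add: z_def algebra_simps)
      have "dens_B - ?d / 2 = z / (2 * (q - 1))"
        using q by (simp add: z_def dens_B_def field_simps)
      moreover have "2 * (1 - q) / z * - (z / (2 * (q - 1))) = 1"
        using z q by (simp add: field_simps)
      ultimately show ?thesis
        by (simp only: z_def)
    qed
    have pos: "r powr (?d / 2) * Gamma dens_B / ?G > 0"
      using Gamma_dens_pos r by (intro divide_pos_pos mult_pos_pos) auto
    have "dens_l powr - (dens_B - ?d / 2) = (r powr (?d / 2) * Gamma dens_B / ?G) powr 1"
      using e by (simp only: dens_l_def r_def[symmetric] dens_B_def[symmetric] powr_powr)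
    also have "\<dots> = r powr (?d / 2) * Gamma dens_B / ?G"
      using pos by (simp only: powr_one less_imp_le)
    finally have l: "dens_l powr - (dens_B - ?d / 2) = r powr (?d / 2) * Gamma dens_B / ?G" .
    have c: "dens_c = dens_l * inverse r" and K: "dens_K = inverse r powr dens_B"
      using q by (simp_all add: dens_c_def dens_K_def r_def)
    have "dens_c powr - (dens_B - ?d / 2) = (r powr (?d / 2) * Gamma dens_B / ?G) * inverse r powr - (dens_B - ?d / 2)"
      using dens_l_pos r by (simp only: c powr_mult less_imp_le inverse_nonnegative_iff_nonnegative l)
    moreover have "inverse r powr dens_B * (r powr (?d / 2) * inverse r powr - (dens_B - ?d / 2)) = 1"
    proof -
      have "r powr (?d / 2) = inverse r powr (- (?d / 2))"
        using r by (simp add: powr_minus inverse_powr)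
      then have "inverse r powr dens_B * (r powr (?d / 2) * inverse r powr - (dens_B - ?d / 2))
          = inverse r powr (dens_B + (- (?d / 2) + - (dens_B - ?d / 2)))"
        by (simp only: powr_add)
      also have "dens_B + (- (?d / 2) + - (dens_B - ?d / 2)) = 0"
        by simp
      finally show ?thesis using r by simp
    qed
    ultimately show ?thesis
      using Gamma_dens_pos by (simp add: gker_def K field_simps)
  qed
  finally show ?thesis by simp
qed

lemma location_family_dens:
  "location_family (lborel :: (real^'d) measure) {()} (\<lambda>_ x. x) (\<lambda>w x. x + w) dens_K dens_c dens_B"
proof (intro location_family.intro location_family_axioms.intro)
  show "(\<integral>\<^sup>+x. ennreal (dens_K * (dens_c + pi * (\<Sum>m\<in>{()}. (norm (x :: real^'d))\<^sup>2)) powr - dens_B) \<partial>lborel) = 1"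
    using dens_mass by simp
  show "sigma_finite_measure (lborel :: (real^'d) measure)"
    by (rule lborel.sigma_finite_measure_axioms)
qed (simp_all add: dens_pos dens_B_pos distr_lborel_translate)

lemma location_family_dens_F:
  "location_family.F (lborel :: (real^'d) measure) {()} (\<lambda>_ x. x) dens_K dens_c dens_B = dens q"
proof -
  interpret location_family "lborel :: (real^'d) measure" "{()}" "\<lambda>_ x. x" "\<lambda>w x. x + w" dens_K dens_c dens_B
    by (rule location_family_dens)
  show ?thesis
    by (simp add: fun_eq_iff F_def s_def dens_eq)
qed

lemma leb_pow_mass: "(\<integral>\<^sup>+x. ennreal (gker (A k) (C + pi * (\<Sum>m\<in>{1..k}. (norm (x m - v))\<^sup>2))) \<partial>(leb_pow k :: (nat \<Rightarrow> real^'d) measure)) = 1"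
proof -
  have "A k - real k * real CARD('d) / 2 = A 0"
    using A_add[of 0 k] by simp
  moreover from this have "A k > real k * real CARD('d) / 2"
    using A_pos[of 0] by linarith
  ultimately show ?thesis
    using nn_integral_gker_PiM[of "{1..k}" "A k" C v] C_pos gker_C
    by (simp add: leb_pow_def)
qed

lemma location_family_dens_rep:
  assumes "k \<ge> 1"
  shows "location_family (leb_pow k :: (nat \<Rightarrow> real^'d) measure) {1..k} (\<lambda>m x. x m)
    (\<lambda>w x. \<lambda>m\<in>{1..k}. x m + w) (Gamma (A k)) C (A k)"
proof (intro location_family.intro location_family_axioms.intro)
  show "\<exists>x\<in>space (leb_pow k). \<forall>m\<in>{1..k}. x m = v" for v :: "real^'d"
    by (intro bexI[of _ "\<lambda>m\<in>{1..k}. v"]) (auto simp: space_leb_pow)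
  show "(\<integral>\<^sup>+x. ennreal (Gamma (A k) * (C + pi * (\<Sum>m\<in>{1..k}. (norm (x m :: real^'d))\<^sup>2)) powr - A k) \<partial>leb_pow k) = 1"
    using leb_pow_mass[of k 0] by (simp add: gker_def)
  show "sigma_finite_measure (leb_pow k :: (nat \<Rightarrow> real^'d) measure)"
    by (rule sigma_finite_leb_pow)
  show "(\<lambda>x. x m) \<in> borel_measurable (leb_pow k :: (nat \<Rightarrow> real^'d) measure)" if "m \<in> {1..k}" for m
    using that by (rule measurable_leb_pow_component)
  show "(\<lambda>x. \<lambda>m\<in>{1..k}. x m + w) \<in> measurable (leb_pow k) (leb_pow k)"
    and "distr (leb_pow k) (leb_pow k) (\<lambda>x. \<lambda>m\<in>{1..k}. x m + w) = leb_pow k" for w :: "real^'d"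
    using distr_PiM_componentwise[of "{1..k}" "\<lambda>_. lborel" "\<lambda>_ x. x + w", folded leb_pow_def]
    by (simp_all add: distr_lborel_translate product_sigma_finite_lborel)
  show "Gamma (A k) > 0"
    by (rule Gamma_real_pos[OF A_pos])
qed (use assms in \<open>simp_all add: A_pos C_pos\<close>)

lemma location_family_dens_rep_F:
  assumes "k \<ge> 1"
  shows "location_family.F (leb_pow k :: (nat \<Rightarrow> real^'d) measure) {1..k} (\<lambda>m x. x m) (Gamma (A k)) C (A k) v
    = dens_rep q k (dens q v)"
proof -
  interpret location_family "leb_pow k :: (nat \<Rightarrow> real^'d) measure" "{1..k}" "\<lambda>m x. x m"
    "\<lambda>w x. \<lambda>m\<in>{1..k}. x m + w" "Gamma (A k)" C "A k"
    by (rule location_family_dens_rep[OF assms])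
  show ?thesis
  proof
    fix x :: "nat \<Rightarrow> real^'d"
    show "F v x = dens_rep q k (dens q v) x"
    proof (cases "x \<in> space (leb_pow k :: (nat \<Rightarrow> real^'d) measure)")
      case True
      then show ?thesis
        unfolding F_def s_def dens_rep_eq[OF True] by (simp add: coord_dens[OF q] gker_def)
    next
      case False
      then show ?thesis
        unfolding F_def by (simp add: dens_rep_def Let_def)
    qed
  qed
qed

end

section \<open>The family and its repetition\<close>

text \<open>Allows exponents of different representations to be compared. Finiteness is assumed
  because all arguments beyond the pole share the value \<infinity>.\<close>

lemma exp_q_inject:
  assumes "q > 1" "exp_q q u = exp_q q u'" "exp_q q u \<noteq> \<infinity>"
  shows "u = u'"
proof -
  have u: "u < 1 / (q - 1)" "u' < 1 / (q - 1)"
    using assms(2,3) by (auto simp: exp_q_def split: if_splits)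
  then have pos: "1 + (1 - q) * u > 0" "1 + (1 - q) * u' > 0"
    using assms(1) by (auto simp: field_simps)
  have "(1 + (1 - q) * u) powr (1 / (1 - q)) = (1 + (1 - q) * u') powr (1 / (1 - q))"
    using assms(2) u by (simp add: exp_q_def)
  then have "((1 + (1 - q) * u) powr (1 / (1 - q))) powr (1 - q) = ((1 + (1 - q) * u') powr (1 / (1 - q))) powr (1 - q)"
    by simp
  then have "1 + (1 - q) * u = 1 + (1 - q) * u'"
    using assms(1) pos by (simp add: powr_powr)
  then show ?thesis
    using assms(1) by simp
qed

context dens_family
begin

lemma inj_dens: "inj (dens q :: real^'d \<Rightarrow> _)"
  using location_family.inj_F[OF location_family_dens] unfolding location_family_dens_F .

lemma topspace_dens: "topspace (dens_topology q) = range (dens q :: real^'d \<Rightarrow> _)"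
  unfolding dens_topology_def coord_def by (rule topspace_global[OF inj_dens])

lemma C_inf_dens: "C_inf (dens_atlas q) (range (dens q :: real^'d \<Rightarrow> _)) = {f. smooth_on UNIV (f \<circ> dens q)}"
  unfolding dens_atlas_def coord_def by (rule C_inf_global[OF inj_dens])

lemma exp_q_dens:
  fixes x v :: "real^'d"
  shows "exp_q q (- (norm (x - v))\<^sup>2 + (1 - dens_l) / (q - 1)) = ereal (dens q v x)"
proof -
  let ?u = "- (norm (x - v))\<^sup>2 + (1 - dens_l) / (q - 1)"
  have eq: "1 + (1 - q) * ?u = (q - 1) * (norm (x - v))\<^sup>2 + dens_l"
    using q by (simp add: field_simps)
  then have "1 + (1 - q) * ?u > 0"
    using q dens_l_pos by (simp add: add_nonneg_pos)
  then have "?u < 1 / (q - 1)"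
    using q by (simp add: field_simps)
  then show ?thesis
    by (simp only: exp_q_def if_True eq dens_eq')
qed

text \<open>Expanding -|x - v|^2 = 2 v \<bullet> x - x \<bullet> x - v \<bullet> v gives
  \<open>T\<close>, \<open>c\<close> and, up to a constant, \<open>\<psi>\<close>.\<close>

lemma exp_representation_dens:
  "exp_representation q (dens_topology q) (dens_atlas q) (range (dens q :: real^'d \<Rightarrow> _)) (coord q)
     (\<lambda>x. 2 *\<^sub>R x) (\<lambda>x. x \<bullet> x) (\<lambda>p. coord q p \<bullet> coord q p - (1 - dens_l) / (q - 1))"
  unfolding exp_representation_def
proof (intro conjI ballI allI)
  show "(range (dens q :: real^'d \<Rightarrow> _), coord q) \<in> coordinate_systems (dens_topology q) (dens_atlas q)"
    unfolding dens_topology_def dens_atlas_def coord_def by (rule global_in_coordinate_systems[OF inj_dens])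
  have "(\<lambda>p. coord q p \<bullet> coord q p - (1 - dens_l) / (q - 1)) \<circ> dens q
      = (\<lambda>v :: real^'d. v \<bullet> v + - ((1 - dens_l) / (q - 1)))"
    by (simp add: fun_eq_iff coord_dens[OF q])
  moreover have "smooth_on UNIV (\<lambda>v :: real^'d. v \<bullet> v + - ((1 - dens_l) / (q - 1)))"
    by (intro smooth_on_add smooth_on_inner smooth_on_ident smooth_on_const open_UNIV)
  ultimately show "(\<lambda>p. coord q p \<bullet> coord q p - (1 - dens_l) / (q - 1))
      \<in> C_inf (dens_atlas q) (range (dens q :: real^'d \<Rightarrow> _))"
    by (simp add: C_inf_dens)
  fix p :: "(real^'d) \<Rightarrow> real" and x assume "p \<in> range (dens q)"
  then obtain v where v: "p = dens q v" ..
  have "coord q p \<bullet> 2 *\<^sub>R x - x \<bullet> x - (coord q p \<bullet> coord q p - (1 - dens_l) / (q - 1))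
      = - (norm (x - v))\<^sup>2 + (1 - dens_l) / (q - 1)"
    by (simp add: v coord_dens[OF q] power2_norm_eq_inner inner_diff_left inner_diff_right inner_commute)
  then show "ereal (p x) = exp_q q (coord q p \<bullet> 2 *\<^sub>R x - x \<bullet> x - (coord q p \<bullet> coord q p - (1 - dens_l) / (q - 1)))"
    by (simp only: exp_q_dens v)
qed (intro continuous_intros)+

theorem exponential_family_dens:
  "exponential_family q (dens_topology q) (dens_atlas q :: ((real^'d) \<Rightarrow> real, real^'d) chart set)"
proof -
  have "statistical_model lborel (dens_topology q) (dens_atlas q :: ((real^'d) \<Rightarrow> real, real^'d) chart set)"
    using location_family.statistical_model_F[OF location_family_dens]
    unfolding location_family_dens_F dens_topology_def dens_atlas_def coord_def .
  then show ?thesis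
    using exp_representation_dens unfolding exponential_family_def topspace_dens by blast
qed

text \<open>However \<open>\<theta>\<close>, \<open>T\<close>, \<open>c\<close> and
  \<open>\<psi>\<close> are chosen, the exponent is forced. Both the repetition formula and the
  affine form of \<open>T\<close> are drawn from this identity.\<close>

lemma exp_representationD:
  fixes \<theta> :: "((real^'d) \<Rightarrow> real) \<Rightarrow> real^'n"
  assumes "exp_representation q X \<A> (range (dens q)) \<theta> T c \<psi>"
  shows "\<theta> (dens q v) \<bullet> T x - c x - \<psi> (dens q v) = - (norm (x - v))\<^sup>2 + (1 - dens_l) / (q - 1)"
proof (rule exp_q_inject[OF q(1)])
  show "exp_q q (\<theta> (dens q v) \<bullet> T x - c x - \<psi> (dens q v)) = exp_q q (- (norm (x - v))\<^sup>2 + (1 - dens_l) / (q - 1))"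
    using assms unfolding exp_representation_def exp_q_dens by auto
  then show "exp_q q (\<theta> (dens q v) \<bullet> T x - c x - \<psi> (dens q v)) \<noteq> \<infinity>"
    unfolding exp_q_dens by simp
qed

lemma sum_join:
  "(\<Sum>m\<in>{1..k + k'}. g (join k k' x y m)) = (\<Sum>m\<in>{1..k}. g (x m)) + (\<Sum>m\<in>{1..k'}. g (y m))"
proof -
  have "(\<Sum>m\<in>{1..k + k'}. g (join k k' x y m))
      = (\<Sum>m\<in>{1..k}. g (join k k' x y m)) + (\<Sum>m\<in>{1 + k..k' + k}. g (join k k' x y m))"
    by (subst sum.ub_add_nat) (auto simp: add.commute)
  also have "(\<Sum>m\<in>{1 + k..k' + k}. g (join k k' x y m)) = (\<Sum>m\<in>{1..k'}. g (y m))"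
    unfolding sum.shift_bounds_cl_nat_ivl by (rule sum.cong) (auto simp: join_def)
  also have "(\<Sum>m\<in>{1..k}. g (join k k' x y m)) = (\<Sum>m\<in>{1..k}. g (x m))"
    by (rule sum.cong) (auto simp: join_def)
  finally show ?thesis .
qed

lemma measurable_gker_sum:
  "(\<lambda>x. gker a (r + pi * (\<Sum>m\<in>{1..k}. (norm (x m - v))\<^sup>2))) \<in> borel_measurable (leb_pow k :: (nat \<Rightarrow> real^'d) measure)"
proof -
  have [measurable]: "(\<lambda>x. x m) \<in> borel_measurable (leb_pow k :: (nat \<Rightarrow> real^'d) measure)" if "m \<in> {1..k}" for m
    using that by (rule measurable_leb_pow_component)
  show ?thesis by measurable
qed

text \<open>With \<open>x\<close> fixed, its squares merely enlarge the additive constant from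
  \<open>C\<close> to \<open>r\<close>, so the mixture formula applies to the remaining k'
  variables.\<close>

lemma dens_rep_marginal:
  fixes p :: "(real^'d) \<Rightarrow> real"
  assumes "x \<in> space (leb_pow k)"
  shows "has_bochner_integral (completion (leb_pow k')) (\<lambda>y. dens_rep q (k + k') p (join k k' x y)) (dens_rep q k p x)"
proof -
  define r where "r = C + pi * (\<Sum>m\<in>{1..k}. (norm (x m - coord q p))\<^sup>2)"
  have r: "r > 0"
    using C_pos by (simp add: r_def add_pos_nonneg sum_nonneg)
  have f: "dens_rep q (k + k') p (join k k' x y)
      = gker (A (k + k')) (r + pi * (\<Sum>m\<in>{1..k'}. (norm (y m - coord q p))\<^sup>2))" for y
  proof -
    have "join k k' x y \<in> space (leb_pow (k + k'))"
      by (simp add: space_leb_pow join_def)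
    from dens_rep_eq[OF this, of p] show ?thesis
      unfolding sum_join[of "\<lambda>z. (norm (z - coord q p))\<^sup>2"] r_def by (simp only: distrib_left add.assoc)
  qed
  have A: "A (k + k') - real k' * real CARD('d) / 2 = A k"
    by (rule A_add)
  have "(\<integral>\<^sup>+y. ennreal (gker (A (k + k')) (r + pi * (\<Sum>m\<in>{1..k'}. (norm (y m - coord q p))\<^sup>2)))
      \<partial>(leb_pow k' :: (nat \<Rightarrow> real^'d) measure)) = ennreal (gker (A k) r)"
    unfolding leb_pow_def using A A_pos[of k] r
    by (subst nn_integral_gker_PiM) auto
  moreover have "gker (A (k + k')) (r + pi * (\<Sum>m\<in>{1..k'}. (norm (y m - coord q p))\<^sup>2)) \<ge> 0" for y
    using gker_pos[OF A_pos, of "r + pi * (\<Sum>m\<in>{1..k'}. (norm (y m - coord q p))\<^sup>2)" "k + k'"] r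
    by (simp add: add_pos_nonneg sum_nonneg less_imp_le)
  ultimately have "has_bochner_integral (leb_pow k' :: (nat \<Rightarrow> real^'d) measure)
      (\<lambda>y. gker (A (k + k')) (r + pi * (\<Sum>m\<in>{1..k'}. (norm (y m - coord q p))\<^sup>2))) (gker (A k) r)"
    using gker_pos[OF A_pos r, of k] measurable_gker_sum
    by (intro has_bochner_integral_nn_integral) auto
  then show ?thesis
    unfolding f dens_rep_eq[OF assms] r_def[symmetric]
    by (auto simp: has_bochner_integral_iff integrable_completion integral_completion dest: borel_measurable_integrable)
qed

theorem repetition_dens_rep:
  "repetition q (dens_topology q) (dens_atlas q :: ((real^'d) \<Rightarrow> real, real^'d) chart set) (dens_rep q)"
  unfolding repetition_def topspace_dens
proof (intro conjI allI impI ballI)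
  fix k k' :: nat and p :: "(real^'d) \<Rightarrow> real" and x
  assume "x \<in> space (leb_pow k :: (nat \<Rightarrow> real^'d) measure)"
  then show "has_bochner_integral (completion (leb_pow k')) (\<lambda>y. dens_rep q (k + k') p (join k k' x y)) (dens_rep q k p x)"
    by (rule dens_rep_marginal)
next
  fix k :: nat assume k: "k \<ge> 1"
  interpret location_family "leb_pow k :: (nat \<Rightarrow> real^'d) measure" "{1..k}" "\<lambda>m x. x m"
    "\<lambda>w x. \<lambda>m\<in>{1..k}. x m + w" "Gamma (A k)" C "A k"
    by (rule location_family_dens_rep[OF k])
  have F: "F v = dens_rep q k (dens q v)" for v
    by (rule location_family_dens_rep_F[OF k])
  define \<beta> where "\<beta> = rep_beta (real CARD('d)) q k"
  define \<kappa> where "\<kappa> = (1 - dens_l) / (q - 1)"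
  let ?\<alpha> = "\<lambda>r :: real. r powr rep_a (real CARD('d)) q k"
  let ?M = "range (dens q :: real^'d \<Rightarrow> _)"
  have "Gamma (A k) > 0"
    by (rule Gamma_real_pos[OF A_pos])
  then have \<beta>_pos: "\<beta> > 0"
    using q by (simp add: \<beta>_def rep_beta_def)
  show "\<exists>\<alpha> b. smooth_on {0<..} \<alpha> \<and> (\<forall>r>0. \<alpha> r > 0) \<and> strict_mono_on {0<..} \<alpha> \<and>
        b \<in> C_inf (dens_atlas q) ?M \<and> (\<forall>p\<in>?M. b p > 0) \<and> inj_on (dens_rep q k) ?M \<and>
        (\<exists>Y (B :: ((nat \<Rightarrow> real^'d) \<Rightarrow> real, real^'d) chart set).
           topspace Y = dens_rep q k ` ?M \<and> statistical_model (leb_pow k) Y B) \<and>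
        (\<forall>\<theta> T c \<psi>. exp_representation q (dens_topology q) (dens_atlas q :: ((real^'d) \<Rightarrow> real, real^'d) chart set) ?M \<theta> T c \<psi> \<longrightarrow>
           (\<exists>\<psi>k \<in> C_inf (dens_atlas q) ?M. \<forall>p\<in>?M. \<forall>x\<in>space (leb_pow k).
              (let u = b p * (\<Sum>m=1..k. \<theta> p \<bullet> T (x m) - c (x m)) - \<psi>k p
               in exp_q q u \<noteq> \<infinity> \<and> dens_rep q k p x = \<alpha> (real_of_ereal (exp_q q u)))))"
  \<comment> \<open>\<alpha> is the power with exponent \<open>rep_a\<close>, and b is constant on
    the family because \<open>rep_beta\<close> does not depend on the location.\<close>
  proof (intro exI[of _ ?\<alpha>] exI[of _ "\<lambda>_. \<beta>"] conjI allI impI ballI)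
    show "smooth_on {0<..} ?\<alpha>"
      by (intro smooth_on_powr smooth_on_ident open_greaterThan) simp
    show "strict_mono_on {0<..} ?\<alpha>"
      using a_pos[of k] by (auto intro!: strict_mono_onI powr_less_mono2)
    show "(\<lambda>_. \<beta>) \<in> C_inf (dens_atlas q) ?M"
      by (simp add: C_inf_dens comp_def smooth_on_const)
    show "inj_on (dens_rep q k) ?M"
      using inj_F unfolding inj_def inj_on_def F by blast
    show "\<exists>Y (B :: ((nat \<Rightarrow> real^'d) \<Rightarrow> real, real^'d) chart set).
        topspace Y = dens_rep q k ` ?M \<and> statistical_model (leb_pow k) Y B"
    proof -
      have "dens_rep q k ` ?M = range F"
        unfolding image_image F ..
      then show ?thesis
        using statistical_model_F topspace_global[OF inj_F] by metis
    qed
    fix \<theta> :: "((real^'d) \<Rightarrow> real) \<Rightarrow> real^'d" and T c \<psi>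
    assume rep: "exp_representation q (dens_topology q) (dens_atlas q) ?M \<theta> T c \<psi>"
    \<comment> \<open>Summing the forced exponent over m yields k (\<psi> + \<kappa>) minus the sum
      of squares. Here \<psi>k removes the first part, scaled by \<beta>, and supplies
      \<open>rep_nu\<close>.\<close>
    define \<psi>k where "\<psi>k = (\<lambda>p. \<beta> * real k * (\<psi> p + \<kappa>) + rep_nu (real CARD('d)) q k)"
    show "\<exists>\<psi>k \<in> C_inf (dens_atlas q) ?M. \<forall>p\<in>?M. \<forall>x\<in>space (leb_pow k).
        (let u = \<beta> * (\<Sum>m=1..k. \<theta> p \<bullet> T (x m) - c (x m)) - \<psi>k p
         in exp_q q u \<noteq> \<infinity> \<and> dens_rep q k p x = ?\<alpha> (real_of_ereal (exp_q q u)))"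
    proof (intro bexI[of _ \<psi>k] ballI)
      have "smooth_on UNIV (\<psi> \<circ> dens q)"
        using rep unfolding exp_representation_def C_inf_dens by blast
      then have "smooth_on UNIV (\<lambda>v. \<beta> * real k * ((\<psi> \<circ> dens q) v + \<kappa>) + rep_nu (real CARD('d)) q k)"
        by (intro smooth_on_add smooth_on_mult smooth_on_const open_UNIV)
      then show "\<psi>k \<in> C_inf (dens_atlas q) ?M"
        by (simp add: C_inf_dens \<psi>k_def comp_def)
      fix p :: "(real^'d) \<Rightarrow> real" and x :: "nat \<Rightarrow> real^'d"
      assume "p \<in> ?M" and x: "x \<in> space (leb_pow k)"
      then obtain v where v: "p = dens q v" by blast
      define S where "S = (\<Sum>m\<in>{1..k}. (norm (x m - v))\<^sup>2)"
      have eq: "\<theta> p \<bullet> T (x m) - c (x m) = (\<psi> p + \<kappa>) - (norm (x m - v))\<^sup>2" for m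
        using exp_representationD[OF rep, of v "x m"] by (simp add: v \<kappa>_def)
      have "\<beta> * (\<Sum>m=1..k. \<theta> p \<bullet> T (x m) - c (x m)) - \<psi>k p
          = - \<beta> * S - rep_nu (real CARD('d)) q k"
        unfolding eq by (simp add: sum_subtractf \<psi>k_def S_def algebra_simps)
      moreover have "dens_rep q k p x = ?\<alpha> (real_of_ereal (exp_q q (- \<beta> * S - rep_nu (real CARD('d)) q k)))"
        using dens_rep_eq[OF x, of p] exp_q_rep(2)[of S k]
        by (simp add: S_def \<beta>_def v coord_dens[OF q] sum_nonneg)
      moreover have "exp_q q (- \<beta> * S - rep_nu (real CARD('d)) q k) \<noteq> \<infinity>"
        unfolding \<beta>_def by (rule exp_q_rep(1)) (simp add: S_def sum_nonneg)
      ultimately show "let u = \<beta> * (\<Sum>m=1..k. \<theta> p \<bullet> T (x m) - c (x m)) - \<psi>k p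
         in exp_q q u \<noteq> \<infinity> \<and> dens_rep q k p x = ?\<alpha> (real_of_ereal (exp_q q u))"
        by (simp only: Let_def simp_thms)
    qed
  qed (use \<beta>_pos in auto)
qed

end

section \<open>A strong law from symmetric fourth moments\<close>

text \<open>The odd terms cancel, leaving 2 u^2 + 8 (a \<bullet> b)^2, and Cauchy-Schwarz bounds the
  last square. The coefficient 6 is half of 4 + 8.\<close>

lemma norm_power4_symmetrized:
  fixes a b :: "'a::real_inner"
  shows "norm (a + b) ^ 4 + norm (a - b) ^ 4 \<le> 2 * (norm a ^ 4 + 6 * ((norm a)\<^sup>2 * (norm b)\<^sup>2) + norm b ^ 4)"
proof -
  define u where "u = (norm a)\<^sup>2 + (norm b)\<^sup>2"
  have e: "(norm (a + b))\<^sup>2 = u + 2 * (a \<bullet> b)" "(norm (a - b))\<^sup>2 = u - 2 * (a \<bullet> b)"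
    by (simp_all add: u_def power2_norm_eq_inner inner_add_left inner_add_right inner_diff_left inner_diff_right inner_commute)
  have p4: "norm z ^ 4 = ((norm z)\<^sup>2)\<^sup>2" for z :: 'a
    by (simp flip: power_mult)
  have "norm (a + b) ^ 4 + norm (a - b) ^ 4 = 2 * u\<^sup>2 + 8 * (a \<bullet> b)\<^sup>2"
    unfolding p4 e by (simp add: power2_eq_square algebra_simps)
  also have "(a \<bullet> b)\<^sup>2 \<le> (norm a)\<^sup>2 * (norm b)\<^sup>2"
    using Cauchy_Schwarz_ineq[of a b] by (simp add: power2_norm_eq_inner)
  finally show ?thesis
    by (simp add: u_def p4 power2_eq_square algebra_simps)
qed

text \<open>Takes the place of "odd moments vanish": since f and its composite with R have the same
  integral, a bound on their average suffices, and the odd terms never have to be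
  integrated.\<close>

lemma nn_integral_symmetrize:
  fixes f g :: "'x \<Rightarrow> real"
  assumes inv: "\<And>h :: 'x \<Rightarrow> ennreal. h \<in> borel_measurable M \<Longrightarrow> (\<integral>\<^sup>+x. h (R x) \<partial>M) = (\<integral>\<^sup>+x. h x \<partial>M)"
    and R: "R \<in> measurable M M" and f: "f \<in> borel_measurable M" and g: "g \<in> borel_measurable M"
    and nonneg: "\<And>x. f x \<ge> 0"
    and le: "\<And>x. x \<in> space M \<Longrightarrow> f x + f (R x) \<le> 2 * g x"
  shows "(\<integral>\<^sup>+x. ennreal (f x) \<partial>M) \<le> (\<integral>\<^sup>+x. ennreal (g x) \<partial>M)"
proof -
  have [measurable]: "f \<in> borel_measurable M" "R \<in> measurable M M" "g \<in> borel_measurable M"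
    by fact+
  have "2 * (\<integral>\<^sup>+x. ennreal (f x) \<partial>M) = (\<integral>\<^sup>+x. ennreal (f x) \<partial>M) + (\<integral>\<^sup>+x. ennreal (f (R x)) \<partial>M)"
    using inv[of "\<lambda>x. ennreal (f x)"] by (simp add: mult_2)
  also have "\<dots> = (\<integral>\<^sup>+x. ennreal (f x + f (R x)) \<partial>M)"
    using nonneg by (simp add: nn_integral_add)
  also have "\<dots> \<le> (\<integral>\<^sup>+x. 2 * ennreal (g x) \<partial>M)"
  proof (rule nn_integral_mono)
    fix x assume "x \<in> space M"
    then have "ennreal (f x + f (R x)) \<le> ennreal (2 * g x)"
      by (intro ennreal_leI le)
    also have "\<dots> = 2 * ennreal (g x)"
      by (simp add: ennreal_mult')
    finally show "ennreal (f x + f (R x)) \<le> 2 * ennreal (g x)" .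
  qed
  also have "\<dots> = 2 * (\<integral>\<^sup>+x. ennreal (g x) \<partial>M)"
    by (rule nn_integral_cmult) measurable
  finally show ?thesis
    by (subst (asm) ennreal_mult_le_mult_iff) auto
qed

text \<open>Flipping the sign of the newest summand replaces independence. A further summand after j
  of them raises the fourth moment by at most (6 j + 1) B.\<close>

lemma fourth_moment_sum_symmetric:
  fixes y :: "nat \<Rightarrow> 'x \<Rightarrow> 'e::euclidean_space"
  assumes y: "\<And>m. m \<in> {1..n} \<Longrightarrow> y m \<in> borel_measurable M"
    and R: "\<And>j. j \<in> {1..n} \<Longrightarrow> R j \<in> measurable M M"
    and inv: "\<And>j (h :: 'x \<Rightarrow> ennreal). j \<in> {1..n} \<Longrightarrow> h \<in> borel_measurable M \<Longrightarrow>
      (\<integral>\<^sup>+x. h (R j x) \<partial>M) = (\<integral>\<^sup>+x. h x \<partial>M)"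
    and flip: "\<And>j m x. j \<in> {1..n} \<Longrightarrow> m \<in> {1..n} \<Longrightarrow> x \<in> space M \<Longrightarrow>
      y m (R j x) = (if m = j then - y m x else y m x)"
    and B: "\<And>m. m \<in> {1..n} \<Longrightarrow> (\<integral>\<^sup>+x. ennreal (norm (y m x) ^ 4) \<partial>M) \<le> ennreal B" "B \<ge> 0"
  shows "(\<integral>\<^sup>+x. ennreal (norm (\<Sum>m\<in>{1..n}. y m x) ^ 4) \<partial>M) \<le> ennreal (3 * (real n)\<^sup>2 * B)"
proof -
  define S where "S = (\<lambda>j x. \<Sum>m\<in>{1..j}. y m x)"
  have S_Suc: "S (Suc j) x = S j x + y (Suc j) x" for j x
    by (simp add: S_def)
  have meas_S [measurable]: "S j \<in> borel_measurable M" if "j \<le> n" for j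
    unfolding S_def using that by (intro borel_measurable_sum y) auto
  have S_flip: "S j (R i x) = S j x" if "i \<in> {1..n}" "j < i" "x \<in> space M" for i j x
    unfolding S_def using that by (intro sum.cong) (auto simp: flip)
  \<comment> \<open>The factors are dependent, so the mixed moment does not split; the inequality of
    the means reduces it to fourth moments.\<close>
  have yy: "(\<integral>\<^sup>+x. ennreal ((norm (y i x))\<^sup>2 * (norm (y j x))\<^sup>2) \<partial>M) \<le> ennreal B"
    if ij: "i \<in> {1..n}" "j \<in> {1..n}" for i j
  proof -
    have [measurable]: "y i \<in> borel_measurable M" "y j \<in> borel_measurable M"
      using y ij by auto
    define h :: real where "h = 1 / 2"
    have h: "h \<ge> 0" "h * (b + b) = b" for b
      by (simp_all add: h_def)
    have "(\<integral>\<^sup>+x. ennreal ((norm (y i x))\<^sup>2 * (norm (y j x))\<^sup>2) \<partial>M)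
        \<le> (\<integral>\<^sup>+x. ennreal h * (ennreal (norm (y i x) ^ 4) + ennreal (norm (y j x) ^ 4)) \<partial>M)"
    proof (rule nn_integral_mono)
      fix x
      have "0 \<le> ((norm (y i x))\<^sup>2 - (norm (y j x))\<^sup>2)\<^sup>2"
        by simp
      then have "(norm (y i x))\<^sup>2 * (norm (y j x))\<^sup>2 \<le> h * (norm (y i x) ^ 4 + norm (y j x) ^ 4)"
        by (simp add: h_def power2_diff flip: power_mult)
      then show "ennreal ((norm (y i x))\<^sup>2 * (norm (y j x))\<^sup>2)
          \<le> ennreal h * (ennreal (norm (y i x) ^ 4) + ennreal (norm (y j x) ^ 4))"
        using h(1) by (simp flip: ennreal_plus ennreal_mult' add: ennreal_leI)
    qed
    also have "\<dots> = ennreal h * ((\<integral>\<^sup>+x. ennreal (norm (y i x) ^ 4) \<partial>M) + (\<integral>\<^sup>+x. ennreal (norm (y j x) ^ 4) \<partial>M))"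
      by (subst nn_integral_cmult) (auto simp: nn_integral_add)
    also have "\<dots> \<le> ennreal h * (ennreal B + ennreal B)"
      by (intro mult_left_mono add_mono B ij) auto
    also have "\<dots> = ennreal (h * (B + B))"
      using B(2) h(1) by (simp only: ennreal_plus ennreal_mult')
    also have "\<dots> = ennreal B"
      by (simp only: h(2))
    finally show ?thesis .
  qed
  \<comment> \<open>With j < i, a flip of any summand of \<open>S j\<close> leaves
    \<open>y i\<close> unchanged.\<close>
  have Sy: "(\<integral>\<^sup>+x. ennreal ((norm (S j x))\<^sup>2 * (norm (y i x))\<^sup>2) \<partial>M) \<le> ennreal (real j * B)"
    if "i \<in> {1..n}" "j < i" for i j
    using that(2)
  proof (induction j)
    case 0
    then show ?case by (simp add: S_def)
  next
    case (Suc j)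
    then have j: "Suc j \<in> {1..n}" "j \<le> n" "Suc j \<noteq> i" "Suc j \<le> n" "j < i" "j < Suc j"
      using that by auto
    have [measurable]: "y i \<in> borel_measurable M" "y (Suc j) \<in> borel_measurable M"
        "S j \<in> borel_measurable M" "S (Suc j) \<in> borel_measurable M"
      using y meas_S that(1) j by auto
    have "(\<integral>\<^sup>+x. ennreal ((norm (S (Suc j) x))\<^sup>2 * (norm (y i x))\<^sup>2) \<partial>M)
        \<le> (\<integral>\<^sup>+x. ennreal ((norm (S j x))\<^sup>2 * (norm (y i x))\<^sup>2 + (norm (y (Suc j) x))\<^sup>2 * (norm (y i x))\<^sup>2) \<partial>M)"
    proof (rule nn_integral_symmetrize[OF inv[OF j(1)] R[OF j(1)]])
      fix x assume x: "x \<in> space M"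
      have 1: "S (Suc j) (R (Suc j) x) = S j x - y (Suc j) x"
        using x j by (simp add: S_Suc S_flip flip)
      have 2: "y i (R (Suc j) x) = y i x"
        using x j that(1) by (simp add: flip)
      \<comment> \<open>The parallelogram law removes the cross term.\<close>
      have 3: "(norm (S j x + y (Suc j) x))\<^sup>2 + (norm (S j x - y (Suc j) x))\<^sup>2
          = 2 * ((norm (S j x))\<^sup>2 + (norm (y (Suc j) x))\<^sup>2)"
        by (simp add: power2_norm_eq_inner inner_add_left inner_add_right inner_diff_left inner_diff_right)
      show "(norm (S (Suc j) x))\<^sup>2 * (norm (y i x))\<^sup>2
            + (norm (S (Suc j) (R (Suc j) x)))\<^sup>2 * (norm (y i (R (Suc j) x)))\<^sup>2
          \<le> 2 * ((norm (S j x))\<^sup>2 * (norm (y i x))\<^sup>2 + (norm (y (Suc j) x))\<^sup>2 * (norm (y i x))\<^sup>2)"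
        unfolding 1 2 S_Suc[of j x] distrib_right[symmetric] 3 mult.assoc by (rule order_refl)
    qed simp_all
    also have "\<dots> = (\<integral>\<^sup>+x. ennreal ((norm (S j x))\<^sup>2 * (norm (y i x))\<^sup>2) \<partial>M)
        + (\<integral>\<^sup>+x. ennreal ((norm (y (Suc j) x))\<^sup>2 * (norm (y i x))\<^sup>2) \<partial>M)"
      by (simp add: nn_integral_add)
    also have "\<dots> \<le> ennreal (real j * B) + ennreal B"
      using Suc.IH[OF j(5)] yy[OF j(1) that(1)] by (intro add_mono)
    also have "\<dots> = ennreal (real (Suc j) * B)"
      using B(2) by (simp add: algebra_simps flip: ennreal_plus)
    finally show ?case .
  qed
  have "(\<integral>\<^sup>+x. ennreal (norm (S j x) ^ 4) \<partial>M) \<le> ennreal (3 * (real j)\<^sup>2 * B)" if "j \<le> n" for j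
    using that
  proof (induction j)
    case 0
    then show ?case by (simp add: S_def)
  next
    case (Suc j)
    then have j: "Suc j \<in> {1..n}" "j \<le> n" "j < Suc j"
      by auto
    have [measurable]: "y (Suc j) \<in> borel_measurable M" "S j \<in> borel_measurable M" "S (Suc j) \<in> borel_measurable M"
      using y meas_S Suc.prems j by auto
    have "(\<integral>\<^sup>+x. ennreal (norm (S (Suc j) x) ^ 4) \<partial>M)
        \<le> (\<integral>\<^sup>+x. ennreal (norm (S j x) ^ 4 + 6 * ((norm (S j x))\<^sup>2 * (norm (y (Suc j) x))\<^sup>2) + norm (y (Suc j) x) ^ 4) \<partial>M)"
    proof (rule nn_integral_symmetrize[OF inv[OF j(1)] R[OF j(1)]])
      fix x assume x: "x \<in> space M"
      have "S (Suc j) (R (Suc j) x) = S j x - y (Suc j) x"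
        using x j by (simp add: S_Suc S_flip flip)
      then show "norm (S (Suc j) x) ^ 4 + norm (S (Suc j) (R (Suc j) x)) ^ 4
          \<le> 2 * (norm (S j x) ^ 4 + 6 * ((norm (S j x))\<^sup>2 * (norm (y (Suc j) x))\<^sup>2) + norm (y (Suc j) x) ^ 4)"
        using norm_power4_symmetrized[of "S j x" "y (Suc j) x"] by (simp add: S_Suc)
    qed simp_all
    also have "\<dots> = (\<integral>\<^sup>+x. ennreal (norm (S j x) ^ 4) \<partial>M)
        + 6 * (\<integral>\<^sup>+x. ennreal ((norm (S j x))\<^sup>2 * (norm (y (Suc j) x))\<^sup>2) \<partial>M)
        + (\<integral>\<^sup>+x. ennreal (norm (y (Suc j) x) ^ 4) \<partial>M)"
      by (simp add: nn_integral_add nn_integral_cmult ennreal_mult'[of 6])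
    also have "\<dots> \<le> ennreal (3 * (real j)\<^sup>2 * B) + 6 * ennreal (real j * B) + ennreal B"
      using j by (intro add_mono mult_left_mono Suc.IH Sy B) auto
    also have "\<dots> = ennreal (3 * (real j)\<^sup>2 * B + 6 * (real j * B) + B)"
      using B(2) by (simp add: ennreal_plus ennreal_mult'[of 6])
    \<comment> \<open>The increment fits because 3 j^2 + 6 j + 1 \<le> 3 (j + 1)^2.\<close>
    also have "\<dots> \<le> ennreal (3 * (real (Suc j))\<^sup>2 * B)"
      using B(2) by (intro ennreal_leI) (simp add: power2_eq_square algebra_simps)
    finally show ?case .
  qed
  then show ?thesis
    by (simp add: S_def)
qed

text \<open>The fourth powers of the averages have integrals of order 1 / k^2, so their series is
  finite almost everywhere and its terms tend to zero. A second moment of order k would leave the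
  divergent series of 1 / k.\<close>

lemma strong_law_fourth_moment:
  fixes S :: "nat \<Rightarrow> 'w \<Rightarrow> 'e::euclidean_space"
  assumes [measurable]: "\<And>k. k \<ge> 1 \<Longrightarrow> S k \<in> borel_measurable P"
    and bound: "\<And>k. k \<ge> 1 \<Longrightarrow> (\<integral>\<^sup>+\<omega>. ennreal (norm (S k \<omega>) ^ 4) \<partial>P) \<le> ennreal (B * (real k)\<^sup>2)"
    and "B \<ge> 0"
  shows "AE \<omega> in P. (\<lambda>k. (1 / real k) *\<^sub>R S k \<omega>) \<longlonglongrightarrow> 0"
proof -
  \<comment> \<open>Shifted by one so that no average over zero summands occurs.\<close>
  define g where "g = (\<lambda>k \<omega>. (norm (S (Suc k) \<omega>) / real (Suc k)) ^ 4)"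
  have meas [measurable]: "S (Suc k) \<in> borel_measurable P" for k
    by (rule assms(1)) simp
  have [measurable]: "g k \<in> borel_measurable P" for k
    unfolding g_def by measurable
  have le: "(\<integral>\<^sup>+\<omega>. ennreal (g k \<omega>) \<partial>P) \<le> ennreal (B * (1 / (real (Suc k))\<^sup>2))" for k
  proof -
    have "ennreal (g k \<omega>) = ennreal (1 / real (Suc k) ^ 4) * ennreal (norm (S (Suc k) \<omega>) ^ 4)" for \<omega>
      by (simp add: g_def power_divide flip: ennreal_mult')
    then have "(\<integral>\<^sup>+\<omega>. ennreal (g k \<omega>) \<partial>P) = ennreal (1 / real (Suc k) ^ 4) * (\<integral>\<^sup>+\<omega>. ennreal (norm (S (Suc k) \<omega>) ^ 4) \<partial>P)"
      by (simp only:) (rule nn_integral_cmult, measurable)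
    also have "\<dots> \<le> ennreal (1 / real (Suc k) ^ 4) * ennreal (B * (real (Suc k))\<^sup>2)"
      by (intro mult_left_mono bound) auto
    also have "\<dots> = ennreal (1 / real (Suc k) ^ 4 * (B * (real (Suc k))\<^sup>2))"
      using assms(3) by (simp only: ennreal_mult'' mult_nonneg_nonneg zero_le_power2)
    also have "1 / real (Suc k) ^ 4 * (B * (real (Suc k))\<^sup>2) = B * (1 / (real (Suc k))\<^sup>2)"
      by (simp add: power2_eq_square power4_eq_xxxx field_simps del: of_nat_Suc)
    finally show ?thesis .
  qed
  have "summable (\<lambda>k. B * (1 / (real (Suc k))\<^sup>2))"
    using inverse_squares_sums by (intro summable_mult) (auto simp: sums_iff add.commute)
  then have "(\<Sum>k. ennreal (B * (1 / (real (Suc k))\<^sup>2))) \<noteq> \<infinity>"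
    using assms(3) by (subst suminf_ennreal2) auto
  moreover have "(\<integral>\<^sup>+\<omega>. (\<Sum>k. ennreal (g k \<omega>)) \<partial>P) \<le> (\<Sum>k. ennreal (B * (1 / (real (Suc k))\<^sup>2)))"
  proof -
    have "(\<integral>\<^sup>+\<omega>. (\<Sum>k. ennreal (g k \<omega>)) \<partial>P) = (\<Sum>k. \<integral>\<^sup>+\<omega>. ennreal (g k \<omega>) \<partial>P)"
      by (rule nn_integral_suminf) simp
    also have "\<dots> \<le> (\<Sum>k. ennreal (B * (1 / (real (Suc k))\<^sup>2)))"
      by (rule suminf_le[OF le]) simp_all
    finally show ?thesis .
  qed
  ultimately have "(\<integral>\<^sup>+\<omega>. (\<Sum>k. ennreal (g k \<omega>)) \<partial>P) \<noteq> \<infinity>"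
    by (auto simp: top_unique)
  then have "AE \<omega> in P. (\<Sum>k. ennreal (g k \<omega>)) \<noteq> \<infinity>"
    by (intro nn_integral_noteq_infinite) auto
  then show ?thesis
  proof eventually_elim
    case (elim \<omega>)
    have "summable (\<lambda>k. g k \<omega>)"
      using elim by (intro summable_suminf_not_top) (auto simp: g_def)
    then have "(\<lambda>k. (norm (S (Suc k) \<omega>) / real (Suc k)) ^ 4) \<longlonglongrightarrow> 0"
      unfolding g_def by (rule summable_LIMSEQ_zero)
    then have "(\<lambda>k. norm (S (Suc k) \<omega>) / real (Suc k)) \<longlonglongrightarrow> 0"
      by (subst (asm) power_tendsto_0_iff) auto
    then have "(\<lambda>k. norm ((1 / real (Suc k)) *\<^sub>R S (Suc k) \<omega>)) \<longlonglongrightarrow> 0"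
      by (simp add: field_simps)
    then have "(\<lambda>k. (1 / real (Suc k)) *\<^sub>R S (Suc k) \<omega>) \<longlonglongrightarrow> 0"
      by (rule tendsto_norm_zero_cancel)
    then show ?case
      by (rule LIMSEQ_imp_Suc)
  qed
qed

section \<open>Fourth moments of the repetition and the limit of the averages\<close>

context dens_family
begin

text \<open>A bound for the fourth moment of one variable. With s = C + pi |x - v|^2, the fourth
  power is at most s^2 / pi^2, which lowers the exponent from \<open>A 1\<close> to
  \<open>A 1 - 2\<close>; the integration over x then lowers it by d / 2.\<close>

definition mom4 :: real where
  "mom4 = Gamma (A 1) / Gamma (A 1 - 2) / pi\<^sup>2 * gker (A 1 - 2 - real CARD('d) / 2) C"

text \<open>Here the offset 3 in \<open>rep_a\<close> pays off: the left side is 1 / (q - 1) + 3 d /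
  2 - 2, which exceeds 2 d - 2 \<ge> 0, so fourth moments exist even for d = 1.\<close>

lemma A_1_gt: "A 1 - 2 - real CARD('d) / 2 > 0"
proof -
  have "1 / (q - 1) > real CARD('d) / 2"
    using q by (simp add: field_simps)
  moreover have "real CARD('d) \<ge> 1"
    by (simp add: Suc_leI)
  moreover have "A 1 = 1 / (q - 1) + 2 * real CARD('d)"
    by (simp add: A_eq)
  ultimately show ?thesis
    by linarith
qed

lemma mom4_nonneg: "mom4 \<ge> 0"
proof -
  have "Gamma (A 1) > 0" "Gamma (A 1 - 2) > 0"
    using A_1_gt d by (auto intro!: Gamma_real_pos A_pos)
  then show ?thesis
    using gker_pos[OF A_1_gt C_pos] by (simp add: mom4_def)
qed

lemma nn_integral_norm4_gker:
  fixes v :: "real^'d"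
  shows "(\<integral>\<^sup>+x. ennreal (norm (x - v) ^ 4 * gker (A 1) (C + pi * (norm (x - v))\<^sup>2)) \<partial>lborel) \<le> ennreal mom4"
proof -
  define \<gamma> where "\<gamma> = Gamma (A 1) / Gamma (A 1 - 2) / pi\<^sup>2"
  have G: "Gamma (A 1) > 0" "Gamma (A 1 - 2) > 0"
    using A_1_gt d by (auto intro!: Gamma_real_pos A_pos)
  then have \<gamma>: "\<gamma> \<ge> 0"
    by (simp add: \<gamma>_def)
  have "(\<integral>\<^sup>+x. ennreal (norm (x - v) ^ 4 * gker (A 1) (C + pi * (norm (x - v))\<^sup>2)) \<partial>lborel)
      \<le> (\<integral>\<^sup>+x. ennreal \<gamma> * ennreal (gker (A 1 - 2) (C + pi * (norm (x - v))\<^sup>2)) \<partial>lborel)"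
  proof (rule nn_integral_mono)
    fix x :: "real^'d"
    define s where "s = C + pi * (norm (x - v))\<^sup>2"
    have s: "s > 0"
      using C_pos by (simp add: s_def add_pos_nonneg)
    have "(pi * (norm (x - v))\<^sup>2)\<^sup>2 \<le> s\<^sup>2"
      using C_pos by (intro power_mono) (auto simp: s_def)
    then have "norm (x - v) ^ 4 \<le> s\<^sup>2 / pi\<^sup>2"
      by (simp add: field_simps power_mult_distrib flip: power_mult)
    then have "norm (x - v) ^ 4 * gker (A 1) s \<le> s\<^sup>2 / pi\<^sup>2 * gker (A 1) s"
      using gker_pos[OF A_pos s, of 1] by (intro mult_right_mono) auto
    also have "\<dots> = \<gamma> * gker (A 1 - 2) s"
    proof -
      have "s powr (- (A 1 - 2)) = s powr (- A 1) * s\<^sup>2"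
        using s by (simp add: powr_diff powr_minus field_simps)
      then show ?thesis
        using G(2) by (simp add: \<gamma>_def gker_def)
    qed
    finally have "ennreal (norm (x - v) ^ 4 * gker (A 1) s) \<le> ennreal (\<gamma> * gker (A 1 - 2) s)"
      by (rule ennreal_leI)
    then show "ennreal (norm (x - v) ^ 4 * gker (A 1) (C + pi * (norm (x - v))\<^sup>2))
        \<le> ennreal \<gamma> * ennreal (gker (A 1 - 2) (C + pi * (norm (x - v))\<^sup>2))"
      using \<gamma> by (simp add: s_def ennreal_mult')
  qed
  also have "\<dots> = ennreal \<gamma> * (\<integral>\<^sup>+x. ennreal (gker (A 1 - 2) (C + pi * (norm (x - v))\<^sup>2)) \<partial>lborel)"
    by (rule nn_integral_cmult) measurable
  also have "(\<integral>\<^sup>+x. ennreal (gker (A 1 - 2) (C + pi * (norm (x - v))\<^sup>2)) \<partial>lborel)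
      = ennreal (gker (A 1 - 2 - real CARD('d) / 2) C)"
    using A_1_gt C_pos nn_integral_gker[of "A 1 - 2" C v] by simp
  also have "ennreal \<gamma> * ennreal (gker (A 1 - 2 - real CARD('d) / 2) C) = ennreal mom4"
    unfolding mom4_def \<gamma>_def[symmetric] using \<gamma> by (rule ennreal_mult'[symmetric])
  finally show ?thesis .
qed

abbreviation rho :: "nat \<Rightarrow> real^'d \<Rightarrow> (nat \<Rightarrow> real^'d) \<Rightarrow> real" where
  "rho k v x \<equiv> gker (A k) (C + pi * (\<Sum>m\<in>{1..k}. (norm (x m - v))\<^sup>2))"

lemma rho_pos: "rho k v x > 0"
  using C_pos by (intro gker_pos A_pos) (simp add: add_pos_nonneg sum_nonneg)

text \<open>The density is symmetric in its variables, so each component has the same marginal as a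
  single variable, and the bound depends neither on m nor on k.\<close>

lemma fourth_moment_component:
  fixes v :: "real^'d"
  assumes m: "m \<in> {1..k}"
  shows "(\<integral>\<^sup>+x. ennreal (norm (x m - v) ^ 4) \<partial>density (leb_pow k) (\<lambda>x. ennreal (rho k v x))) \<le> ennreal mom4"
proof -
  interpret product_sigma_finite "\<lambda>_ :: nat. lborel :: (real^'d) measure"
    by (rule product_sigma_finite_lborel)
  define J where "J = {1..k} - {m}"
  have J: "finite J" "m \<notin> J" "{1..k} = insert m J" "card J = k - 1"
    using m by (auto simp: J_def)
  have meas_J: "(\<lambda>x. ennreal (gker (A k) (s + pi * (\<Sum>i\<in>J. (norm (x i - v))\<^sup>2))))
      \<in> borel_measurable (\<Pi>\<^sub>M i\<in>J. lborel)" for s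
    by measurable
  note [measurable] = measurable_gker_sum[of "A k" C v k] measurable_leb_pow_component[OF m]
  have "(\<integral>\<^sup>+x. ennreal (norm (x m - v) ^ 4) \<partial>density (leb_pow k) (\<lambda>x. ennreal (rho k v x)))
      = (\<integral>\<^sup>+x. ennreal (norm (x m - v) ^ 4 * rho k v x) \<partial>leb_pow k)"
  proof -
    have "(\<integral>\<^sup>+x. ennreal (norm (x m - v) ^ 4) \<partial>density (leb_pow k) (\<lambda>x. ennreal (rho k v x)))
        = (\<integral>\<^sup>+x. ennreal (rho k v x) * ennreal (norm (x m - v) ^ 4) \<partial>leb_pow k)"
      by (rule nn_integral_density) measurable
    also have "\<dots> = (\<integral>\<^sup>+x. ennreal (norm (x m - v) ^ 4 * rho k v x) \<partial>leb_pow k)"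
      by (intro nn_integral_cong, subst ennreal_mult''[OF less_imp_le[OF rho_pos]]) (rule mult.commute)
    finally show ?thesis .
  qed
  also have "\<dots> = (\<integral>\<^sup>+y. \<integral>\<^sup>+x. ennreal (norm (y - v) ^ 4 *
      gker (A k) ((C + pi * (norm (y - v))\<^sup>2) + pi * (\<Sum>i\<in>J. (norm (x i - v))\<^sup>2))) \<partial>(\<Pi>\<^sub>M i\<in>J. lborel) \<partial>lborel)"
  proof -
    have "(\<lambda>x. ennreal (norm (x m - v) ^ 4 * rho k v x)) \<in> borel_measurable (\<Pi>\<^sub>M i\<in>insert m J. lborel)"
      unfolding J(3)[symmetric] leb_pow_def[symmetric] by measurable
    from product_nn_integral_insert_rev[OF J(1,2) this]
    have "(\<integral>\<^sup>+x. ennreal (norm (x m - v) ^ 4 * rho k v x) \<partial>leb_pow k)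
        = (\<integral>\<^sup>+y. \<integral>\<^sup>+x. ennreal (norm ((x(m := y)) m - v) ^ 4 * rho k v (x(m := y))) \<partial>(\<Pi>\<^sub>M i\<in>J. lborel) \<partial>lborel)"
      unfolding leb_pow_def J(3) .
    moreover have "C + pi * (\<Sum>i\<in>{1..k}. (norm ((x(m := y)) i - v))\<^sup>2)
        = (C + pi * (norm (y - v))\<^sup>2) + pi * (\<Sum>i\<in>J. (norm (x i - v))\<^sup>2)" for x y
    proof -
      have "(\<Sum>i\<in>J. (norm ((x(m := y)) i - v))\<^sup>2) = (\<Sum>i\<in>J. (norm (x i - v))\<^sup>2)"
        using J(2) by (intro sum.cong) auto
      then show ?thesis
        unfolding J(3) using J(1,2) by (simp add: algebra_simps)
    qed
    ultimately show ?thesis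
      by (simp only: fun_upd_same)
  qed
  also have "\<dots> = (\<integral>\<^sup>+y. ennreal (norm (y - v) ^ 4 * gker (A 1) (C + pi * (norm (y - v))\<^sup>2)) \<partial>lborel)"
  proof (rule nn_integral_cong)
    fix y :: "real^'d"
    define s where "s = C + pi * (norm (y - v))\<^sup>2"
    have s: "s > 0"
      using C_pos by (simp add: s_def add_pos_nonneg)
    \<comment> \<open>Integrating out the other k - 1 variables takes the exponent from
      \<open>A k\<close> to \<open>A 1\<close>.\<close>
    have A: "A k - real (card J) * real CARD('d) / 2 = A 1"
      using m A_add[of 1 "k - 1"] by (simp add: J(4))
    have "(\<integral>\<^sup>+x. ennreal (norm (y - v) ^ 4 * gker (A k) (s + pi * (\<Sum>i\<in>J. (norm (x i - v))\<^sup>2))) \<partial>(\<Pi>\<^sub>M i\<in>J. lborel))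
       = (\<integral>\<^sup>+x. ennreal (norm (y - v) ^ 4) * ennreal (gker (A k) (s + pi * (\<Sum>i\<in>J. (norm (x i - v))\<^sup>2))) \<partial>(\<Pi>\<^sub>M i\<in>J. lborel))"
      by (simp add: ennreal_mult')
    also have "\<dots> = ennreal (norm (y - v) ^ 4) * (\<integral>\<^sup>+x. ennreal (gker (A k) (s + pi * (\<Sum>i\<in>J. (norm (x i - v))\<^sup>2))) \<partial>(\<Pi>\<^sub>M i\<in>J. lborel))"
      by (rule nn_integral_cmult[OF meas_J])
    also have "\<dots> = ennreal (norm (y - v) ^ 4) * ennreal (gker (A 1) s)"
      using A A_pos[of 1] s J(1) nn_integral_gker_PiM[of J "A k" s v] by simp
    finally show "(\<integral>\<^sup>+x. ennreal (norm (y - v) ^ 4 *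
        gker (A k) ((C + pi * (norm (y - v))\<^sup>2) + pi * (\<Sum>i\<in>J. (norm (x i - v))\<^sup>2))) \<partial>(\<Pi>\<^sub>M i\<in>J. lborel))
      = ennreal (norm (y - v) ^ 4 * gker (A 1) (C + pi * (norm (y - v))\<^sup>2))"
      by (simp add: s_def ennreal_mult')
  qed
  also have "\<dots> \<le> ennreal mom4"
    by (rule nn_integral_norm4_gker)
  finally show ?thesis .
qed

lemma fourth_moment_sum:
  fixes v :: "real^'d"
  shows "(\<integral>\<^sup>+x. ennreal (norm (\<Sum>m\<in>{1..k}. x m - v) ^ 4) \<partial>density (leb_pow k) (\<lambda>x. ennreal (rho k v x)))
    \<le> ennreal (3 * (real k)\<^sup>2 * mom4)"
proof (rule fourth_moment_sum_symmetric[OF _ _ _ _ fourth_moment_component mom4_nonneg])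
  let ?L = "leb_pow k :: (nat \<Rightarrow> real^'d) measure"
  let ?M = "density ?L (\<lambda>x. ennreal (rho k v x))"
  \<comment> \<open>Reflects the j-th component at \<open>v\<close>. This preserves Lebesgue measure
    and all distances to \<open>v\<close>, hence the density, while changing the sign of
    \<open>x j - v\<close>.\<close>
  define R where "R = (\<lambda>j (x :: nat \<Rightarrow> real^'d). \<lambda>m\<in>{1..k}. (if m = j then (\<lambda>z. 2 *\<^sub>R v - z) else (\<lambda>z. z)) (x m))"
  have [measurable]: "(\<lambda>x. x i) \<in> borel_measurable ?L" if "i \<in> {1..k}" for i
    using that by (rule measurable_leb_pow_component)
  note [measurable] = measurable_gker_sum[of "A k" C v k]
  show "(\<lambda>x. x m - v) \<in> borel_measurable ?M" if "m \<in> {1..k}" for m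
    using that by simp
  have T: "(if m = j then (\<lambda>z. 2 *\<^sub>R v - z) else (\<lambda>z. z)) \<in> measurable lborel lborel"
    "distr lborel lborel (if m = j then (\<lambda>z. 2 *\<^sub>R v - z) else (\<lambda>z. z)) = lborel" for m j :: nat
    by (auto simp: distr_lborel_reflect distr_id2)
  have R: "R j \<in> measurable ?L ?L" "distr ?L ?L (R j) = ?L" for j
    unfolding R_def leb_pow_def
    by (rule distr_PiM_componentwise[OF finite_atLeastAtMost product_sigma_finite_lborel T])+
  then show "R j \<in> measurable ?M ?M" for j
    by simp
  show flip: "R j x m - v = (if m = j then - (x m - v) else x m - v)" if "m \<in> {1..k}" for j m x
    using that by (simp add: R_def scaleR_2)
  have rho_R: "rho k v (R j x) = rho k v x" for j x
  proof -
    have "(\<Sum>m\<in>{1..k}. (norm (R j x m - v))\<^sup>2) = (\<Sum>m\<in>{1..k}. (norm (x m - v))\<^sup>2)"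
    proof (rule sum.cong[OF refl])
      fix m assume "m \<in> {1..k}"
      show "(norm (R j x m - v))\<^sup>2 = (norm (x m - v))\<^sup>2"
        unfolding flip[OF \<open>m \<in> {1..k}\<close>] by (simp add: norm_minus_commute)
    qed
    then show ?thesis by simp
  qed
  show "(\<integral>\<^sup>+x. h (R j x) \<partial>?M) = (\<integral>\<^sup>+x. h x \<partial>?M)" if "h \<in> borel_measurable ?M" for j and h :: "_ \<Rightarrow> ennreal"
  proof -
    have [measurable]: "h \<in> borel_measurable ?L" "R j \<in> measurable ?L ?L"
      using that R by simp_all
    have "(\<integral>\<^sup>+x. h (R j x) \<partial>?M) = (\<integral>\<^sup>+x. ennreal (rho k v (R j x)) * h (R j x) \<partial>?L)"
      unfolding rho_R by (rule nn_integral_density) measurable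
    also have "\<dots> = (\<integral>\<^sup>+x. ennreal (rho k v x) * h x \<partial>distr ?L ?L (R j))"
      by (rule nn_integral_distr[symmetric]) measurable
    also have "\<dots> = (\<integral>\<^sup>+x. h x \<partial>?M)"
      unfolding R(2) by (rule nn_integral_density[symmetric]) measurable
    finally show ?thesis .
  qed
qed

text \<open>The coordinates \<open>\<theta>\<close> fill an open set, so the linear equations that the representation
  imposes on \<open>T x\<close> have a unique solution; it is affine in \<open>x\<close>.\<close>

lemma exp_representation_affine:
  fixes v :: "real^'d" and T :: "real^'d \<Rightarrow> real^'n"
  assumes "exp_representation q X \<A> (range (dens q)) \<theta> T c \<psi>"
  obtains l where "bounded_linear l" "\<And>x. T x = T v + l (x - v)"
proof -
  have "open (\<theta> ` range (dens q))"
    using assms by (simp add: exp_representation_def coordinate_systems_def topological_chart_def)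
  then obtain e where e: "e > 0" "\<And>z. dist z (\<theta> (dens q v)) < e \<Longrightarrow> z \<in> \<theta> ` range (dens q)"
    by (metis open_dist imageI rangeI)
  \<comment> \<open>Parameters whose coordinate differs from that of \<open>v\<close> by a small
    step along one basis vector; each isolates one component of \<open>T\<close>.\<close>
  have "\<exists>w. \<theta> (dens q w) = \<theta> (dens q v) + (e / 2) *\<^sub>R b" if "b \<in> Basis" for b
  proof -
    have "\<theta> (dens q v) + (e / 2) *\<^sub>R b \<in> \<theta> ` range (dens q)"
      using e(1) that by (intro e(2)) (simp add: dist_norm)
    then show ?thesis by fastforce
  qed
  then obtain w where w: "\<And>b. b \<in> Basis \<Longrightarrow> \<theta> (dens q (w b)) = \<theta> (dens q v) + (e / 2) *\<^sub>R b"
    by metis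
  \<comment> \<open>The factor 4 / e solves (e / 2) (T x - T v) \<bullet> b = 2 (w b - v) \<bullet>
    (x - v), the equation derived below, for the component of \<open>T x - T v\<close>.\<close>
  define l where "l = (\<lambda>z. \<Sum>b\<in>Basis. ((4 / e) * ((w b - v) \<bullet> z)) *\<^sub>R (b :: real^'n))"
  have coord: "(T x - T v) \<bullet> b = (4 / e) * ((w b - v) \<bullet> (x - v))" if "b \<in> Basis" for x b
  proof -
    note rep = exp_representationD[OF assms]
    \<comment> \<open>A mixed second difference in parameter and sample point: \<open>c\<close> and
      \<open>\<psi>\<close> cancel, and so do the pure squares, leaving a bilinear
      expression.\<close>
    have "(\<theta> (dens q (w b)) - \<theta> (dens q v)) \<bullet> (T x - T v)
        = (norm (x - v))\<^sup>2 - (norm (x - w b))\<^sup>2 - ((norm (v - v))\<^sup>2 - (norm (v - w b))\<^sup>2)"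
      using rep[of "w b" x] rep[of v x] rep[of "w b" v] rep[of v v]
      by (simp add: inner_diff_left inner_diff_right)
    also have "\<dots> = 2 * ((w b - v) \<bullet> (x - v))"
      by (simp add: power2_norm_eq_inner inner_diff_left inner_diff_right inner_commute)
    finally have "(e / 2) * (b \<bullet> (T x - T v)) = 2 * ((w b - v) \<bullet> (x - v))"
      by (simp add: w[OF that])
    then show ?thesis
      using e(1) by (simp add: field_simps inner_commute)
  qed
  have "T x = T v + l (x - v)" for x
  proof -
    have "T x - T v = (\<Sum>b\<in>Basis. ((T x - T v) \<bullet> b) *\<^sub>R b)"
      by (rule euclidean_representation[symmetric])
    also have "\<dots> = l (x - v)"
      unfolding l_def by (intro sum.cong refl) (simp only: coord)
    finally show ?thesis by (simp add: algebra_simps)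
  qed
  moreover have "linear l"
    unfolding l_def
    by (intro linear_compose_sum ballI linearI)
      (simp_all add: inner_add_right distrib_left scaleR_add_left mult_ac)
  ultimately show ?thesis
    using that linear_conv_bounded_linear by blast
qed

lemma dens_rep_1:
  fixes v x :: "real^'d"
  shows "dens_rep q 1 (dens q v) (\<lambda>m\<in>{1..1}. x) = gker (A 1) (C + pi * (norm (x - v))\<^sup>2)"
  by (subst dens_rep_eq) (simp_all add: space_leb_pow coord_dens[OF q])

text \<open>The linear part is odd under the reflection at \<open>v\<close>, which preserves the
  density, so only \<open>t\<close> remains. The first moment is finite because the norm is at most
  one plus its fourth power.\<close>

lemma has_bochner_integral_affine:
  fixes v :: "real^'d" and l :: "real^'d \<Rightarrow> real^'n"
  assumes l: "bounded_linear l"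
  shows "has_bochner_integral lborel (\<lambda>x. gker (A 1) (C + pi * (norm (x - v))\<^sup>2) *\<^sub>R (t + l (x - v))) t"
proof -
  define g where "g = (\<lambda>x :: real^'d. gker (A 1) (C + pi * (norm (x - v))\<^sup>2))"
  have [measurable]: "g \<in> borel_measurable borel"
    unfolding g_def by measurable
  have pos: "g x > 0" for x
    unfolding g_def using C_pos by (intro gker_pos A_pos) (simp add: add_pos_nonneg)
  have A1: "A 1 - real CARD('d) / 2 = A 0"
    using A_add[of 0 1] by simp
  have "(\<integral>\<^sup>+x. ennreal (g x) \<partial>lborel) = ennreal 1"
    unfolding g_def
    using nn_integral_gker[of "A 1" C v] A1 A_pos[of 0] C_pos gker_C by simp
  then have g1: "has_bochner_integral lborel g 1"
    using pos by (intro has_bochner_integral_nn_integral) (auto simp: less_imp_le)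
  have int: "integrable lborel (\<lambda>x. g x *\<^sub>R (x - v))"
  proof (rule Bochner_Integration.integrable_bound)
    have "integrable lborel (\<lambda>x. norm (x - v) ^ 4 * g x)"
    proof (rule integrableI_bounded)
      have "(\<integral>\<^sup>+x. ennreal (norm (norm (x - v) ^ 4 * g x)) \<partial>lborel) \<le> ennreal mom4"
        using nn_integral_norm4_gker[of v] pos by (simp add: g_def abs_mult less_imp_le)
      then show "(\<integral>\<^sup>+x. ennreal (norm (norm (x - v) ^ 4 * g x)) \<partial>lborel) < \<infinity>"
        by (rule le_less_trans) simp
    qed measurable
    then show "integrable lborel (\<lambda>x. g x + norm (x - v) ^ 4 * g x)"
      using g1 by (intro Bochner_Integration.integrable_add) (auto simp: has_bochner_integral_iff)
    show "AE x in lborel. norm (g x *\<^sub>R (x - v)) \<le> norm (g x + norm (x - v) ^ 4 * g x)"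
    proof (rule AE_I2)
      fix x
      have "norm (x - v) \<le> 1 + norm (x - v) ^ 4"
      proof (cases "norm (x - v) \<le> 1")
        case False
        then show ?thesis
          using power_increasing[of 1 4 "norm (x - v)"] by simp
      qed (simp add: add_increasing2)
      then have "g x * norm (x - v) \<le> g x * (1 + norm (x - v) ^ 4)"
        using pos by (intro mult_left_mono) (auto simp: less_imp_le)
      also have "g x * (1 + norm (x - v) ^ 4) = g x + norm (x - v) ^ 4 * g x"
        by (simp only: distrib_left mult_1_right mult.commute)
      finally have "g x * norm (x - v) \<le> norm (g x + norm (x - v) ^ 4 * g x)"
        by (rule order_trans) simp
      then show "norm (g x *\<^sub>R (x - v)) \<le> norm (g x + norm (x - v) ^ 4 * g x)"
        using pos[of x] by (simp only: norm_scaleR abs_of_pos)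
    qed
  qed measurable
  have "(LINT x|lborel. g x *\<^sub>R (x - v)) = (LINT x|distr lborel lborel (\<lambda>x. 2 *\<^sub>R v - x). g x *\<^sub>R (x - v))"
    by (simp only: distr_lborel_reflect)
  also have "\<dots> = (LINT x|lborel. g (2 *\<^sub>R v - x) *\<^sub>R (2 *\<^sub>R v - x - v))"
    by (rule integral_distr) measurable
  also have "\<dots> = (LINT x|lborel. - (g x *\<^sub>R (x - v)))"
  proof (rule Bochner_Integration.integral_cong[OF refl])
    fix x
    have eq: "2 *\<^sub>R v - x - v = - (x - v)"
      by (simp add: scaleR_2)
    have "g (2 *\<^sub>R v - x) = g x"
      unfolding g_def eq norm_minus_cancel ..
    then show "g (2 *\<^sub>R v - x) *\<^sub>R (2 *\<^sub>R v - x - v) = - (g x *\<^sub>R (x - v))"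
      by (simp only: eq scaleR_minus_right)
  qed
  also have "\<dots> = - (LINT x|lborel. g x *\<^sub>R (x - v))"
    by simp
  finally have "2 *\<^sub>R (LINT x|lborel. g x *\<^sub>R (x - v)) = 0"
    \<comment> \<open>The integral equals its own negative.\<close>
    by (simp only: eq_neg_iff_add_eq_0 scaleR_2)
  then have "(LINT x|lborel. g x *\<^sub>R (x - v)) = 0"
    by (simp only: scaleR_eq_0_iff) simp
  with int have "has_bochner_integral lborel (\<lambda>x. g x *\<^sub>R (x - v)) 0"
    by (simp add: has_bochner_integral_iff)
  from has_bochner_integral_add[OF has_bochner_integral_scaleR_left[OF g1, of t] has_bochner_integral_bounded_linear[OF l this]]
  show ?thesis
    by (simp add: g_def scaleR_add_right linear_simps[OF l])
qed

text \<open>Both the limit of the averages and the integral equal \<open>T v\<close>: the linear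
  part of \<open>T\<close> commutes with averaging and is continuous, so convergence of the centred
  averages to zero suffices.\<close>

theorem law_of_large_numbers:
  fixes v :: "real^'d" and T :: "real^'d \<Rightarrow> real^'n" and X :: "nat \<Rightarrow> 'w \<Rightarrow> real^'d"
  assumes X: "dependent_identically_distributed (dens_rep q) (dens q v) P X"
    and rep: "exp_representation q Y \<A> (range (dens q)) \<theta> T c \<psi>"
  shows "integrable lborel (\<lambda>x. dens_rep q 1 (dens q v) (\<lambda>m\<in>{1..1}. x) *\<^sub>R T x)"
    and "AE \<omega> in P. (\<lambda>k. (1 / real k) *\<^sub>R (\<Sum>m=1..k. T (X m \<omega>)))
           \<longlonglongrightarrow> (LINT x|lborel. dens_rep q 1 (dens q v) (\<lambda>m\<in>{1..1}. x) *\<^sub>R T x)"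
proof -
  obtain l where l: "bounded_linear l" "\<And>x. T x = T v + l (x - v)"
    using exp_representation_affine[OF rep] by metis
  have "(\<lambda>x. gker (A 1) (C + pi * (norm (x - v))\<^sup>2) *\<^sub>R (T v + l (x - v)))
      = (\<lambda>x. dens_rep q 1 (dens q v) (\<lambda>m\<in>{1..1}. x) *\<^sub>R T x)"
    unfolding dens_rep_1 l(2)[symmetric] ..
  with has_bochner_integral_affine[OF l(1), of v "T v"]
  have int: "has_bochner_integral lborel (\<lambda>x. dens_rep q 1 (dens q v) (\<lambda>m\<in>{1..1}. x) *\<^sub>R T x) (T v)"
    by (simp only:)
  then show "integrable lborel (\<lambda>x. dens_rep q 1 (dens q v) (\<lambda>m\<in>{1..1}. x) *\<^sub>R T x)"
    by (simp only: has_bochner_integral_iff)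
  have meas [measurable]: "X m \<in> borel_measurable P" if "m \<ge> 1" for m
    using X that by (simp add: dependent_identically_distributed_def)
  have bound: "(\<integral>\<^sup>+\<omega>. ennreal (norm (\<Sum>m\<in>{1..k}. X m \<omega> - v) ^ 4) \<partial>P) \<le> ennreal (3 * mom4 * (real k)\<^sup>2)"
    if k: "k \<ge> 1" for k
  proof -
    let ?L = "leb_pow k :: (nat \<Rightarrow> real^'d) measure"
    have [measurable]: "(\<lambda>x. x i) \<in> borel_measurable ?L" if "i \<in> {1..k}" for i
      using that by (rule measurable_leb_pow_component)
    have dist: "distributed P ?L (\<lambda>\<omega>. \<lambda>m\<in>{1..k}. X m \<omega>) (\<lambda>x. ennreal (dens_rep q k (dens q v) x))"
      using X k by (simp add: dependent_identically_distributed_def)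
    have "(\<integral>\<^sup>+\<omega>. ennreal (norm (\<Sum>m\<in>{1..k}. X m \<omega> - v) ^ 4) \<partial>P)
        = (\<integral>\<^sup>+\<omega>. ennreal (norm (\<Sum>m\<in>{1..k}. (\<lambda>m\<in>{1..k}. X m \<omega>) m - v) ^ 4) \<partial>P)"
      by (intro nn_integral_cong arg_cong[where f = "\<lambda>z. ennreal (norm z ^ 4)"] sum.cong) auto
    \<comment> \<open>The only place where the variables enter: the moment bound for k uses nothing
      but the joint law of the first k of them.\<close>
    also have "\<dots> = (\<integral>\<^sup>+x. ennreal (dens_rep q k (dens q v) x) * ennreal (norm (\<Sum>m\<in>{1..k}. x m - v) ^ 4) \<partial>?L)"
      by (rule distributed_nn_integral[OF dist, symmetric]) measurable
    also have "\<dots> = (\<integral>\<^sup>+x. ennreal (rho k v x) * ennreal (norm (\<Sum>m\<in>{1..k}. x m - v) ^ 4) \<partial>?L)"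
      by (intro nn_integral_cong) (simp add: dens_rep_eq coord_dens[OF q])
    also have "\<dots> = (\<integral>\<^sup>+x. ennreal (norm (\<Sum>m\<in>{1..k}. x m - v) ^ 4) \<partial>density ?L (\<lambda>x. ennreal (rho k v x)))"
      using measurable_gker_sum[of "A k" C v k] by (subst nn_integral_density) auto
    also have "\<dots> \<le> ennreal (3 * (real k)\<^sup>2 * mom4)"
      by (rule fourth_moment_sum)
    finally show ?thesis
      by (simp only: mult_ac)
  qed
  have "AE \<omega> in P. (\<lambda>k. (1 / real k) *\<^sub>R (\<Sum>m\<in>{1..k}. X m \<omega> - v)) \<longlonglongrightarrow> 0"
    by (rule strong_law_fourth_moment[OF _ bound]) (auto simp: mom4_nonneg)
  then show "AE \<omega> in P. (\<lambda>k. (1 / real k) *\<^sub>R (\<Sum>m=1..k. T (X m \<omega>)))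
      \<longlonglongrightarrow> (LINT x|lborel. dens_rep q 1 (dens q v) (\<lambda>m\<in>{1..1}. x) *\<^sub>R T x)"
  proof eventually_elim
    case (elim \<omega>)
    have lim: "(\<lambda>k. T v + l ((1 / real k) *\<^sub>R (\<Sum>m\<in>{1..k}. X m \<omega> - v))) \<longlonglongrightarrow> T v + l 0"
      by (intro tendsto_add tendsto_const bounded_linear.tendsto[OF l(1) elim])
    have eq: "T v + l ((1 / real k) *\<^sub>R (\<Sum>m\<in>{1..k}. X m \<omega> - v)) = (1 / real k) *\<^sub>R (\<Sum>m\<in>{1..k}. T (X m \<omega>))"
      if "k > 0" for k
    proof -
      have "(\<Sum>m\<in>{1..k}. T (X m \<omega>)) = real k *\<^sub>R T v + l (\<Sum>m\<in>{1..k}. X m \<omega> - v)"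
        by (subst l(2)) (simp add: sum.distrib sum_constant_scaleR
            linear_sum[OF bounded_linear.linear[OF l(1)]] del: sum_constant)
      then show ?thesis
        using that by (simp add: scaleR_add_right linear_cmul[OF bounded_linear.linear[OF l(1)]])
    qed
    \<comment> \<open>The identity can fail at k = 0, where the right side is zero, so the two
      sequences are compared eventually.\<close>
    have "\<forall>\<^sub>F k in sequentially. T v + l ((1 / real k) *\<^sub>R (\<Sum>m\<in>{1..k}. X m \<omega> - v))
        = (1 / real k) *\<^sub>R (\<Sum>m\<in>{1..k}. T (X m \<omega>))"
      by (rule eventually_mono[OF eventually_gt_at_top[of 0] eq])
    with lim have "(\<lambda>k. (1 / real k) *\<^sub>R (\<Sum>m\<in>{1..k}. T (X m \<omega>))) \<longlonglongrightarrow> T v + l 0"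
      by (rule Lim_transform_eventually)
    moreover have "(LINT x|lborel. dens_rep q 1 (dens q v) (\<lambda>m\<in>{1..1}. x) *\<^sub>R T x) = T v + l 0"
      using int linear_0[OF bounded_linear.linear[OF l(1)]] by (simp only: has_bochner_integral_iff) simp
    ultimately show ?case by (simp only:)
  qed
qed

end

theorem theorem1p5:
  fixes q :: real
  assumes "q > 1" and "real CARD('d::finite) * (q - 1) < 2"
  shows
    "exponential_family q (dens_topology q) (dens_atlas q :: ((real^'d) \<Rightarrow> real, real^'d) chart set) \<and>
     identically_repeatable q (dens_topology q) (dens_atlas q :: ((real^'d) \<Rightarrow> real, real^'d) chart set) \<and>
     repetition q (dens_topology q) (dens_atlas q :: ((real^'d) \<Rightarrow> real, real^'d) chart set) (dens_rep q) \<and>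
     (\<forall>p \<in> range (dens q :: real^'d \<Rightarrow> _). \<forall>(P :: 'w measure) X \<theta> T c \<psi>.
        prob_space P \<longrightarrow>
        dependent_identically_distributed (dens_rep q) p P X \<longrightarrow>
        exp_representation q (dens_topology q) (dens_atlas q) (range (dens q)) \<theta> T c \<psi> \<longrightarrow>
        integrable lborel (\<lambda>x. dens_rep q 1 p (\<lambda>m\<in>{1..1}. x) *\<^sub>R T x) \<and>
        (AE \<omega> in P. (\<lambda>k. (1 / real k) *\<^sub>R (\<Sum>m=1..k. T (X m \<omega>)))
           \<longlonglongrightarrow> (LINT x|lborel. dens_rep q 1 p (\<lambda>m\<in>{1..1}. x) *\<^sub>R T x)))"
proof -
  interpret dens_family q "TYPE('d)"
    by standard (use assms in auto)
  show ?thesis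
    using exponential_family_dens repetition_dens_rep law_of_large_numbers
    unfolding identically_repeatable_def by blast
qed

end
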